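(* Let $\mathfrak g$ be a non-compact simple finite-dimensional real Lie algebra, $\theta$ a Cartan involution of $\mathfrak g$ with Cartan decomposition $\mathfrak g=\mathfrak k\oplus\mathfrak p$, $\mathfrak a\subseteq\mathfrak p$ a maximal abelian subspace, $\Sigma=\Sigma(\mathfrak g,\mathfrak a)\subseteq\mathfrak a^*$ the (irreducible) restricted root system, of type $X_n$, and $\Pi=\{\alpha_1,\dots,\alpha_n\}$ a system of simple roots, numbered according to Bourbaki's tables. For $j=1,\dots,n$ let $h_j\in\mathfrak a$ be the unique element with $\alpha_k(h_j)=\delta_{jk}$ for all $k$. Then every Euler element $h\in\mathfrak a$ with $\alpha(h)\ge 0$ for all $\alpha\in\Pi$ is one of $h_1,\dots,h_n$, and for each irreducible root system the Euler elements among the $h_j$ are exactly: $A_n$: $h_1,\dots,h_n$; $B_n$: $h_1$; $C_n$: $h_n$; $D_n$: $h_1,h_{n-1},h_n$; $E_6$: $h_1,h_6$; $E_7$: $h_7$. For the root systems $BC_n$, $E_8$, $F_4$ and $G_2$ no Euler element exists. The symmetric Euler elements among these are exactly: $A_{2n-1}$: $h_n$; $B_n$: $h_1$; $C_n$: $h_n$; $D_n$: $h_1$; $D_{2n}$: $h_{2n-1},h_{2n}$ (in addition to $h_1$); $E_7$: $h_7$ (and for $A_n$ with $n$ even, and for $E_6$, no $h_j$ is symmetric).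
   Context: An element $x$ of a finite-dimensional real Lie algebra $\mathfrak g$ is an Euler element if $x\neq 0$ and $\operatorname{ad}x$ is diagonalizable with $\operatorname{Spec}(\operatorname{ad}x)\subseteq\{-1,0,1\}$. For $x\in\mathfrak g$ let $\mathcal O_x=\operatorname{Inn}(\mathfrak g)x$ be its orbit under the group $\operatorname{Inn}(\mathfrak g)=\langle e^{\operatorname{ad}\mathfrak g}\rangle$ of inner automorphisms; an Euler element $x$ is called symmetric if $-x\in\mathcal O_x$. The numbering of simple roots is that of Bourbaki (Lie Groups and Lie Algebras, Ch. IV–VI, Plates): $A_n$ is the chain $\alpha_1,\dots,\alpha_n$; for $B_n$ the root $\alpha_n$ is short, for $C_n$ the root $\alpha_n$ is long (both with chain $\alpha_1,\dots,\alpha_n$); for $D_n$ the nodes $\alpha_{n-1},\alpha_n$ are the two end nodes of the fork attached to $\alpha_{n-2}$; for $E_6,E_7,E_8$ the node $\alpha_2$ is attached to $\alpha_4$ and $\alpha_1,\alpha_3,\alpha_4,\dots,\alpha_n$ form a chain. *)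

theory Defs
  imports "HOL-Analysis.Analysis"
begin

definition lie_algebra :: "('g::euclidean_space \<Rightarrow> 'g \<Rightarrow> 'g) \<Rightarrow> bool" where
  "lie_algebra br \<longleftrightarrow> bilinear br \<and> (\<forall>x. br x x = 0) \<and>
     (\<forall>x y z. br x (br y z) + br y (br z x) + br z (br x y) = 0)"

definition lie_ideal :: "('g::euclidean_space \<Rightarrow> 'g \<Rightarrow> 'g) \<Rightarrow> 'g set \<Rightarrow> bool" where
  "lie_ideal br I \<longleftrightarrow> subspace I \<and> (\<forall>x y. y \<in> I \<longrightarrow> br x y \<in> I)"

definition simple_lie :: "('g::euclidean_space \<Rightarrow> 'g \<Rightarrow> 'g) \<Rightarrow> bool" where
  "simple_lie br \<longleftrightarrow> lie_algebra br \<and> (\<exists>x y. br x y \<noteq> 0) \<and>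
     (\<forall>I. lie_ideal br I \<longrightarrow> I = {0} \<or> I = UNIV)"

definition ltrace :: "('g::euclidean_space \<Rightarrow> 'g) \<Rightarrow> real" where
  "ltrace f = (\<Sum>i\<in>Basis. f i \<bullet> i)"

definition killing :: "('g::euclidean_space \<Rightarrow> 'g \<Rightarrow> 'g) \<Rightarrow> 'g \<Rightarrow> 'g \<Rightarrow> real" where
  "killing br x y = ltrace (br x \<circ> br y)"

definition noncompact_lie :: "('g::euclidean_space \<Rightarrow> 'g \<Rightarrow> 'g) \<Rightarrow> bool" where
  "noncompact_lie br \<longleftrightarrow> \<not> (\<forall>x. x \<noteq> 0 \<longrightarrow> killing br x x < 0)"

definition cartan_involution ::
  "('g::euclidean_space \<Rightarrow> 'g \<Rightarrow> 'g) \<Rightarrow> ('g \<Rightarrow> 'g) \<Rightarrow> bool" where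
  "cartan_involution br \<theta> \<longleftrightarrow> linear \<theta> \<and> (\<forall>x. \<theta> (\<theta> x) = x) \<and>
     (\<forall>x y. \<theta> (br x y) = br (\<theta> x) (\<theta> y)) \<and>
     (\<forall>x. x \<noteq> 0 \<longrightarrow> - killing br x (\<theta> x) > 0)"

definition ppart :: "('g::euclidean_space \<Rightarrow> 'g) \<Rightarrow> 'g set" where
  "ppart \<theta> = {x. \<theta> x = - x}"

definition abelian_sub :: "('g::euclidean_space \<Rightarrow> 'g \<Rightarrow> 'g) \<Rightarrow> 'g set \<Rightarrow> bool" where
  "abelian_sub br A \<longleftrightarrow> subspace A \<and> (\<forall>x\<in>A. \<forall>y\<in>A. br x y = 0)"

definition max_abelian_in_p ::
  "('g::euclidean_space \<Rightarrow> 'g \<Rightarrow> 'g) \<Rightarrow> ('g \<Rightarrow> 'g) \<Rightarrow> 'g set \<Rightarrow> bool" where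
  "max_abelian_in_p br \<theta> A \<longleftrightarrow> abelian_sub br A \<and> A \<subseteq> ppart \<theta> \<and>
     (\<forall>B. abelian_sub br B \<and> A \<subseteq> B \<and> B \<subseteq> ppart \<theta> \<longrightarrow> B = A)"

text \<open>Linear functionals on the subspace A are represented as functions on 'g
that are linear on A and vanish outside A (so that equality is meaningful).\<close>
definition dual_on :: "'g::euclidean_space set \<Rightarrow> ('g \<Rightarrow> real) set" where
  "dual_on A = {f. (\<forall>x\<in>A. \<forall>y\<in>A. f (x + y) = f x + f y) \<and>
      (\<forall>c. \<forall>x\<in>A. f (c *\<^sub>R x) = c * f x) \<and> (\<forall>x. x \<notin> A \<longrightarrow> f x = 0)}"

definition restricted_roots ::
  "('g::euclidean_space \<Rightarrow> 'g \<Rightarrow> 'g) \<Rightarrow> 'g set \<Rightarrow> ('g \<Rightarrow> real) set" where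
  "restricted_roots br A = {\<beta> \<in> dual_on A. (\<exists>h\<in>A. \<beta> h \<noteq> 0) \<and>
      (\<exists>v. v \<noteq> 0 \<and> (\<forall>h\<in>A. br h v = \<beta> h *\<^sub>R v))}"

definition simple_system ::
  "('g::euclidean_space \<Rightarrow> 'g \<Rightarrow> 'g) \<Rightarrow> 'g set \<Rightarrow> (nat \<Rightarrow> 'g \<Rightarrow> real) \<Rightarrow> nat \<Rightarrow> bool" where
  "simple_system br A \<alpha> n \<longleftrightarrow> n = dim A \<and>
     (\<forall>i\<in>{1..n}. \<alpha> i \<in> restricted_roots br A) \<and>
     (\<forall>c::nat \<Rightarrow> real. (\<forall>h\<in>A. (\<Sum>i=1..n. c i * \<alpha> i h) = 0) \<longrightarrow> (\<forall>i\<in>{1..n}. c i = 0)) \<and>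
     (\<forall>\<beta>\<in>restricted_roots br A. \<exists>k::nat \<Rightarrow> int.
         ((\<forall>i\<in>{1..n}. k i \<ge> 0) \<or> (\<forall>i\<in>{1..n}. k i \<le> 0)) \<and>
         (\<forall>h\<in>A. \<beta> h = (\<Sum>i=1..n. of_int (k i) * \<alpha> i h)))"

definition killing_dual ::
  "('g::euclidean_space \<Rightarrow> 'g \<Rightarrow> 'g) \<Rightarrow> 'g set \<Rightarrow> ('g \<Rightarrow> real) \<Rightarrow> 'g" where
  "killing_dual br A \<beta> = (THE t. t \<in> A \<and> (\<forall>h\<in>A. killing br t h = \<beta> h))"

definition root_inner ::
  "('g::euclidean_space \<Rightarrow> 'g \<Rightarrow> 'g) \<Rightarrow> 'g set \<Rightarrow> ('g \<Rightarrow> real) \<Rightarrow> ('g \<Rightarrow> real) \<Rightarrow> real" where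
  "root_inner br A \<beta> \<gamma> = killing br (killing_dual br A \<beta>) (killing_dual br A \<gamma>)"

definition cartan_int ::
  "('g::euclidean_space \<Rightarrow> 'g \<Rightarrow> 'g) \<Rightarrow> 'g set \<Rightarrow> ('g \<Rightarrow> real) \<Rightarrow> ('g \<Rightarrow> real) \<Rightarrow> real" where
  "cartan_int br A \<beta> \<gamma> = 2 * root_inner br A \<beta> \<gamma> / root_inner br A \<gamma> \<gamma>"

datatype rs_type = TA | TB | TC | TD | TE | TF | TG | TBC

definition rank_ok :: "rs_type \<Rightarrow> nat \<Rightarrow> bool" where
  "rank_ok T n = (case T of TA \<Rightarrow> n \<ge> 1 | TB \<Rightarrow> n \<ge> 2 | TC \<Rightarrow> n \<ge> 2 | TD \<Rightarrow> n \<ge> 4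
     | TE \<Rightarrow> n \<in> {6,7,8} | TF \<Rightarrow> n = 4 | TG \<Rightarrow> n = 2 | TBC \<Rightarrow> n \<ge> 1)"

text \<open>Edges of the Dynkin diagram (Bourbaki numbering).\<close>
definition dynkin_edge :: "rs_type \<Rightarrow> nat \<Rightarrow> nat \<Rightarrow> nat \<Rightarrow> bool" where
  "dynkin_edge T n i j = (case T of
      TD \<Rightarrow> (j = i + 1 \<and> i \<le> n - 2) \<or> (i = n - 2 \<and> j = n)
    | TE \<Rightarrow> (i = 1 \<and> j = 3) \<or> (i = 2 \<and> j = 4) \<or> (3 \<le> i \<and> j = i + 1 \<and> j \<le> n)
    | _ \<Rightarrow> j = i + 1)"

text \<open>Cartan matrix entry a_ij = <alpha_i, alpha_j-coroot> (for 1 \<le> i,j \<le> n).\<close>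
definition cartan_entry :: "rs_type \<Rightarrow> nat \<Rightarrow> nat \<Rightarrow> nat \<Rightarrow> int" where
  "cartan_entry T n i j =
     (if i = j then 2
      else if dynkin_edge T n i j \<or> dynkin_edge T n j i then
        (if (T = TB \<or> T = TBC) \<and> i = n - 1 \<and> j = n then -2
         else if T = TC \<and> i = n \<and> j = n - 1 then -2
         else if T = TF \<and> i = 2 \<and> j = 3 then -2
         else if T = TG \<and> i = 2 \<and> j = 1 then -3
         else -1)
      else 0)"

definition has_type ::
  "('g::euclidean_space \<Rightarrow> 'g \<Rightarrow> 'g) \<Rightarrow> 'g set \<Rightarrow> (nat \<Rightarrow> 'g \<Rightarrow> real) \<Rightarrow> nat \<Rightarrow> rs_type \<Rightarrow> bool" where
  "has_type br A \<alpha> n T \<longleftrightarrow> rank_ok T n \<and>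
     (\<forall>i\<in>{1..n}. \<forall>j\<in>{1..n}. cartan_int br A (\<alpha> i) (\<alpha> j) = of_int (cartan_entry T n i j)) \<and>
     (if T = TBC then (\<lambda>v. 2 * \<alpha> n v) \<in> restricted_roots br A
      else (\<forall>\<beta>\<in>restricted_roots br A. (\<lambda>v. 2 * \<beta> v) \<notin> restricted_roots br A))"

definition coweight ::
  "'g::euclidean_space set \<Rightarrow> (nat \<Rightarrow> 'g \<Rightarrow> real) \<Rightarrow> nat \<Rightarrow> nat \<Rightarrow> 'g" where
  "coweight A \<alpha> n j = (THE h. h \<in> A \<and> (\<forall>k\<in>{1..n}. \<alpha> k h = (if k = j then 1 else 0)))"

definition lin_spectrum :: "('g::euclidean_space \<Rightarrow> 'g) \<Rightarrow> real set" where
  "lin_spectrum f = {c. \<exists>v. v \<noteq> 0 \<and> f v = c *\<^sub>R v}"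

definition diagonalizable :: "('g::euclidean_space \<Rightarrow> 'g) \<Rightarrow> bool" where
  "diagonalizable f \<longleftrightarrow> (\<exists>B. independent B \<and> span B = UNIV \<and>
      (\<forall>v\<in>B. \<exists>c. f v = c *\<^sub>R v))"

definition euler_elem :: "('g::euclidean_space \<Rightarrow> 'g \<Rightarrow> 'g) \<Rightarrow> 'g \<Rightarrow> bool" where
  "euler_elem br x \<longleftrightarrow> x \<noteq> 0 \<and> diagonalizable (br x) \<and> lin_spectrum (br x) \<subseteq> {-1, 0, 1}"

definition lin_exp :: "('g::euclidean_space \<Rightarrow> 'g) \<Rightarrow> 'g \<Rightarrow> 'g" where
  "lin_exp f v = (\<Sum>k. (1 / fact k) *\<^sub>R (f ^^ k) v)"

text \<open>Inn(g): the group generated by the e^{ad y} (inverses are e^{ad(-y)}).\<close>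
inductive_set inner_auts :: "('g::euclidean_space \<Rightarrow> 'g \<Rightarrow> 'g) \<Rightarrow> ('g \<Rightarrow> 'g) set"
  for br where
  id_inn: "id \<in> inner_auts br"
| exp_inn: "\<phi> \<in> inner_auts br \<Longrightarrow> lin_exp (br y) \<circ> \<phi> \<in> inner_auts br"

definition inn_orbit :: "('g::euclidean_space \<Rightarrow> 'g \<Rightarrow> 'g) \<Rightarrow> 'g \<Rightarrow> 'g set" where
  "inn_orbit br x = {\<phi> x | \<phi>. \<phi> \<in> inner_auts br}"

definition symmetric_euler :: "('g::euclidean_space \<Rightarrow> 'g \<Rightarrow> 'g) \<Rightarrow> 'g \<Rightarrow> bool" where
  "symmetric_euler br x \<longleftrightarrow> euler_elem br x \<and> - x \<in> inn_orbit br x"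

definition euler_indices :: "rs_type \<Rightarrow> nat \<Rightarrow> nat set" where
  "euler_indices T n = (case T of TA \<Rightarrow> {1..n} | TB \<Rightarrow> {1} | TC \<Rightarrow> {n}
     | TD \<Rightarrow> {1, n - 1, n} | TE \<Rightarrow> (if n = 6 then {1, 6} else if n = 7 then {7} else {})
     | _ \<Rightarrow> {})"

definition symmetric_indices :: "rs_type \<Rightarrow> nat \<Rightarrow> nat set" where
  "symmetric_indices T n = (case T of
       TA \<Rightarrow> (if odd n then {(n + 1) div 2} else {})
     | TB \<Rightarrow> {1} | TC \<Rightarrow> {n}
     | TD \<Rightarrow> (if even n then {1, n - 1, n} else {1})
     | TE \<Rightarrow> (if n = 7 then {7} else {})
     | _ \<Rightarrow> {})"

end

theory Submission
  imports Defs
begin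

text \<open>
  Everything takes place for the inner product \<open>ip x y = - B(x, \<theta> y)\<close>, for which \<open>ad x\<close> is
  symmetric if \<open>x \<in> p\<close> and skew if \<open>x \<in> k\<close>. An element \<open>x \<noteq> 0\<close> is Euler iff \<open>(ad x)\<^sup>3 = ad x\<close>,
  so Euler elements form a closed set. One of minimal norm lies in \<open>p\<close>, and an Euler
  element of \<open>p\<close> closest to a strictly dominant element of \<open>A\<close> is a dominant element of \<open>A\<close>.
  Hence some Euler element exists iff a dominant one exists in \<open>A\<close>, and evaluation at a root
  whose coefficients are all positive shows that the latter is some \<open>h\<^sub>j\<close>.

  Simple reflections are restrictions of inner automorphisms. Applied to simple roots they produce
  a root with coefficient at least 2 at every \<open>j\<close> that is not listed. For a listed \<open>j\<close> the
  Weyl orbit of \<open>h\<^sub>j\<close> is minuscule; since every root is, in the reduced case, conjugate to a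
  simple one, all roots take values in \<open>{-1, 0, 1}\<close> on it. The orbit also shows that \<open>- h\<^sub>j\<close> is
  conjugate to \<open>h\<^sub>l\<close>, where \<open>l\<close> is the index opposite to \<open>j\<close>. It remains to see that distinct
  dominant Euler elements are not conjugate, which is the uniqueness of highest weights in an exterior
  power of the Lie algebra.
\<close>

section \<open>Exponentials of linear maps\<close>

text \<open>What forces the detour through exterior powers: \<open>\<theta>\<close> maps
  \<open>H j\<close> to \<open>- H j\<close>, and an inner automorphism carries the latter to the
  coweight of the opposite index. Two coweights with opposite indices therefore agree in every
  invariant of the full automorphism group, such as the Killing norm or the eigenvalue
  multiplicities of the adjoint operator. To separate them, an argument must exploit that inner
  automorphisms are products of exponentials: the vanishing of a functional on a cyclic module
  survives each exponential, because all Taylor coefficients vanish.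

  The subspace \<open>A\<close> need not be a Cartan subalgebra, and root spaces may have any
  dimension. The arguments therefore work with a single root vector, its image under
  \<open>\<theta>\<close>, and the joint diagonalization of \<open>A\<close>. Roots and points of
  \<open>A\<close> are handled through their integer coordinates, so that the Cartan matrix and the
  doubling condition are the only links to the tables of root systems, and the type-dependent part
  is pure integer combinatorics.\<close>

lemma linear_norm_bound:
  fixes f :: "'a::euclidean_space \<Rightarrow> 'b::euclidean_space"
  assumes "linear f" obtains K where "K \<ge> 0" "\<And>x. norm (f x) \<le> K * norm x"
  using linear_bounded_pos[OF assms] by (metis less_imp_le)

lemma funpow_norm_bound:
  fixes f :: "'a::euclidean_space \<Rightarrow> 'a"
  assumes "K \<ge> 0" "\<And>x. norm (f x) \<le> K * norm x"
  shows "norm ((f ^^ k) v) \<le> K ^ k * norm v"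
proof (induction k)
  case (Suc k)
  have "norm ((f ^^ Suc k) v) \<le> K * norm ((f ^^ k) v)" using assms(2) by simp
  also have "\<dots> \<le> K * (K ^ k * norm v)" using Suc assms(1) by (rule mult_left_mono)
  finally show ?case by simp
qed simp

lemma funpow_scaleR:
  fixes f :: "'a::real_vector \<Rightarrow> 'a"
  assumes "linear f" shows "((\<lambda>x. t *\<^sub>R f x) ^^ k) v = t ^ k *\<^sub>R (f ^^ k) v"
  by (induction k) (simp_all add: linear_cmul[OF assms])

lemma lin_exp_summable:
  fixes f :: "'a::euclidean_space \<Rightarrow> 'a"
  assumes "linear f" shows "summable (\<lambda>k. (t ^ k / fact k) *\<^sub>R (f ^^ k) v)"
proof -
  obtain K where K: "K \<ge> 0" "\<And>x. norm (f x) \<le> K * norm x" using linear_norm_bound[OF assms] by blast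
  have "summable (\<lambda>k. (inverse (fact k) * (\<bar>t\<bar> * K) ^ k) * norm v)"
    by (rule summable_mult2) (rule summable_exp)
  then show ?thesis
  proof (rule summable_comparison_test'[where N = 0])
    fix k :: nat
    have "norm ((t ^ k / fact k) *\<^sub>R (f ^^ k) v) = \<bar>t\<bar> ^ k / fact k * norm ((f ^^ k) v)"
      by (simp add: power_abs)
    also have "\<dots> \<le> \<bar>t\<bar> ^ k / fact k * (K ^ k * norm v)"
      by (intro mult_left_mono funpow_norm_bound K) simp
    finally show "norm ((t ^ k / fact k) *\<^sub>R (f ^^ k) v) \<le> inverse (fact k) * (\<bar>t\<bar> * K) ^ k * norm v"
      by (simp add: field_simps power_mult_distrib)
  qed
qed

lemma lin_exp_scale:
  fixes f :: "'a::euclidean_space \<Rightarrow> 'a"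
  assumes "linear f"
  shows "lin_exp (\<lambda>x. t *\<^sub>R f x) v = (\<Sum>k. (t ^ k / fact k) *\<^sub>R (f ^^ k) v)"
  unfolding lin_exp_def funpow_scaleR[OF assms] by simp

lemma lin_exp_zero: "linear f \<Longrightarrow> lin_exp (\<lambda>x. 0 *\<^sub>R f x) v = v"
proof -
  assume "linear f"
  have "(\<lambda>k. (0 ^ k / fact k) *\<^sub>R (f ^^ k) v) sums (\<Sum>k\<in>{0}. (0 ^ k / fact k) *\<^sub>R (f ^^ k) v)"
    by (rule sums_finite) auto
  then show ?thesis unfolding lin_exp_scale[OF \<open>linear f\<close>] by (simp add: sums_iff)
qed

text \<open>Every coordinate of the curve is a real power series that converges everywhere, so it
  may be differentiated termwise; the shift of the coefficients amounts to an application of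
  \<open>f\<close>.\<close>

lemma lin_exp_deriv:
  fixes f :: "'a::euclidean_space \<Rightarrow> 'a"
  assumes "linear f"
  shows "((\<lambda>t. lin_exp (\<lambda>x. t *\<^sub>R f x) v) has_vector_derivative
            f (lin_exp (\<lambda>x. t *\<^sub>R f x) v)) (at t)"
proof -
  let ?u = "\<lambda>t. \<Sum>k. (t ^ k / fact k) *\<^sub>R (f ^^ k) v"
  have bl: "bounded_linear f" using assms linear_conv_bounded_linear by blast
  have fu: "f (?u t) = (\<Sum>k. (t ^ k / fact k) *\<^sub>R (f ^^ Suc k) v)" for t
    using bounded_linear.suminf[OF bl lin_exp_summable[OF assms, of t v]]
    by (simp add: linear_cmul[OF assms])
  have sS: "summable (\<lambda>k. (t ^ k / fact k) *\<^sub>R (f ^^ Suc k) v)" for t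
    using bounded_linear.summable[OF bl lin_exp_summable[OF assms, of t v]]
    by (simp add: linear_cmul[OF assms])
  have comp: "((\<lambda>t. ?u t \<bullet> b) has_field_derivative (f (?u t) \<bullet> b)) (at t)" for b t
  proof -
    define c where "c k = ((f ^^ k) v \<bullet> b) / fact k" for k
    have ub: "?u s \<bullet> b = (\<Sum>k. c k * s ^ k)" for s
      unfolding c_def
      using bounded_linear.suminf[OF bounded_linear_inner_left lin_exp_summable[OF assms, of s v], of b]
      by (simp add: mult.commute)
    have sb: "summable (\<lambda>k. c k * s ^ k)" for s
      unfolding c_def
      using bounded_linear.summable[OF bounded_linear_inner_left lin_exp_summable[OF assms, of s v], of b]
      by (simp add: mult.commute)
    have d: "diffs c k = ((f ^^ Suc k) v \<bullet> b) / fact k" for k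
      unfolding diffs_def c_def by (simp del: of_nat_Suc)
    have "f (?u t) \<bullet> b = (\<Sum>k. (t ^ k / fact k) *\<^sub>R (f ^^ Suc k) v \<bullet> b)"
      unfolding fu by (rule bounded_linear.suminf[OF bounded_linear_inner_left[of b] sS[of t]])
    also have "\<dots> = (\<Sum>k. diffs c k * t ^ k)"
      by (simp add: d mult.commute)
    finally have "f (?u t) \<bullet> b = (\<Sum>k. diffs c k * t ^ k)" .
    moreover have "((\<lambda>x. \<Sum>k. c k * x ^ k) has_field_derivative (\<Sum>k. diffs c k * t ^ k)) (at t)"
      by (rule termdiffs_strong_converges_everywhere[OF sb])
    ultimately show ?thesis by (simp add: ub)
  qed
  have "(?u has_vector_derivative f (?u t)) (at t)"
    unfolding has_vector_derivative_def
  proof (rule has_derivative_componentwise_within[THEN iffD2], rule ballI)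
    fix b :: 'a assume "b \<in> Basis"
    show "((\<lambda>x. ?u x \<bullet> b) has_derivative (\<lambda>x. (x *\<^sub>R f (?u t)) \<bullet> b)) (at t)"
      by (rule has_derivative_eq_rhs[OF comp[of b t, unfolded has_field_derivative_def]])
        (simp add: fun_eq_iff mult.commute)
  qed
  then show ?thesis by (simp add: lin_exp_scale[OF assms])
qed

text \<open>Gronwall's argument: the weight \<open>exp (- 2 * K * t)\<close> makes the squared norm
  of a solution nonincreasing, and it starts at \<open>0\<close>.\<close>

lemma ode_zero:
  fixes f :: "'a::euclidean_space \<Rightarrow> 'a"
  assumes "linear f" and d: "\<And>t. (w has_vector_derivative f (w t)) (at t)" and "w 0 = 0"
  shows "w 1 = 0"
proof -
  obtain K where K: "K \<ge> 0" "\<And>x. norm (f x) \<le> K * norm x" using linear_norm_bound[OF assms(1)] by blast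
  define g where "g t = exp (- 2 * K * t) * (w t \<bullet> w t)" for t
  have "(g has_real_derivative exp (- 2 * K * t) * (2 * (w t \<bullet> f (w t)) - 2 * K * (w t \<bullet> w t))) (at t)" for t
  proof -
    have "((\<lambda>t. w t \<bullet> w t) has_real_derivative 2 * (w t \<bullet> f (w t))) (at t)"
      using has_derivative_inner[OF d[of t, unfolded has_vector_derivative_def] d[of t, unfolded has_vector_derivative_def]]
      unfolding has_field_derivative_def
      by (rule has_derivative_eq_rhs) (auto simp: inner_commute)
    then show ?thesis unfolding g_def[abs_def]
      by (auto intro!: derivative_eq_intros simp: algebra_simps)
  qed
  moreover have "exp (- 2 * K * t) * (2 * (w t \<bullet> f (w t)) - 2 * K * (w t \<bullet> w t)) \<le> 0" for t
  proof -
    have "w t \<bullet> f (w t) \<le> norm (w t) * norm (f (w t))" by (rule norm_cauchy_schwarz)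
    also have "\<dots> \<le> norm (w t) * (K * norm (w t))" by (intro mult_left_mono K) simp
    also have "\<dots> = K * (w t \<bullet> w t)" by (simp add: dot_square_norm power2_eq_square)
    finally show ?thesis by (simp add: mult_le_0_iff)
  qed
  ultimately have "g 1 \<le> g 0"
    by (intro DERIV_nonpos_imp_nonincreasing[of 0 1 g] exI conjI) simp_all
  then have "exp (- 2 * K) * (w 1 \<bullet> w 1) \<le> 0" by (simp add: g_def \<open>w 0 = 0\<close>)
  then have "w 1 \<bullet> w 1 \<le> 0" by (simp add: mult_le_0_iff)
  then show ?thesis by (metis inner_eq_zero_iff inner_ge_zero order_antisym)
qed

text \<open>The tool behind the later identities for exponentials: to identify
  \<open>lin_exp f v\<close>, exhibit a curve that starts at \<open>v\<close> and solves the
  differential equation, and read it off at time \<open>1\<close>.\<close>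

lemma lin_exp_unique:
  fixes f :: "'a::euclidean_space \<Rightarrow> 'a"
  assumes "linear f" and d: "\<And>t. (u has_vector_derivative f (u t)) (at t)"
  shows "u 1 = lin_exp f (u 0)"
proof -
  define w where "w t = u t - lin_exp (\<lambda>x. t *\<^sub>R f x) (u 0)" for t
  have "(w has_vector_derivative f (w t)) (at t)" for t
    unfolding w_def[abs_def] linear_diff[OF assms(1)]
    by (intro has_vector_derivative_diff d lin_exp_deriv assms(1))
  moreover have "w 0 = 0" by (simp add: w_def lin_exp_zero[OF assms(1)] del: scaleR_zero_left)
  ultimately have "w 1 = 0" by (rule ode_zero[OF assms(1)])
  then show ?thesis by (simp add: w_def)
qed

lemma linear_lin_exp:
  fixes f :: "'a::euclidean_space \<Rightarrow> 'a"
  assumes "linear f" shows "linear (lin_exp f)"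
proof
  fix x y :: 'a and r :: real
  let ?e = "\<lambda>t::real. lin_exp (\<lambda>x. t *\<^sub>R f x)"
  have "((\<lambda>t. ?e t x + ?e t y) has_vector_derivative f (?e t x + ?e t y)) (at t)" for t
    by (subst linear_add[OF assms]) (intro has_vector_derivative_add lin_exp_deriv assms)
  from lin_exp_unique[OF assms this]
  show "lin_exp f (x + y) = lin_exp f x + lin_exp f y"
    by (simp add: lin_exp_zero[OF assms] del: scaleR_zero_left)
  have "((\<lambda>t. r *\<^sub>R ?e t x) has_vector_derivative f (r *\<^sub>R ?e t x)) (at t)" for t
    by (subst linear_cmul[OF assms])
      (rule bounded_linear.has_vector_derivative[OF bounded_linear_scaleR_right lin_exp_deriv[OF assms]])
  from lin_exp_unique[OF assms this]
  show "lin_exp f (r *\<^sub>R x) = r *\<^sub>R lin_exp f x"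
    by (simp add: lin_exp_zero[OF assms] del: scaleR_zero_left)
qed

lemma lin_exp_inverse:
  fixes f :: "'a::euclidean_space \<Rightarrow> 'a"
  assumes "linear f" shows "lin_exp (\<lambda>x. - f x) (lin_exp f v) = v"
proof -
  have l: "linear (\<lambda>x. - f x)" using assms by (rule linear_compose_neg)
  \<comment> \<open>The flow run backwards: from \<open>lin_exp f v\<close> at time \<open>0\<close>
    to \<open>v\<close> at time \<open>1\<close>, with velocity \<open>- f\<close>.\<close>
  let ?u = "\<lambda>t::real. lin_exp (\<lambda>x. (1 - t) *\<^sub>R f x) v"
  have "(?u has_vector_derivative - f (?u t)) (at t)" for t :: real
  proof -
    have "((\<lambda>t. 1 - t) has_vector_derivative - 1) (at t)"
      by (auto intro!: derivative_eq_intros)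
    from vector_diff_chain_at[OF this lin_exp_deriv[OF assms]]
    show ?thesis by (simp add: o_def)
  qed
  from lin_exp_unique[OF l this]
  show ?thesis by (simp add: lin_exp_zero[OF assms] del: scaleR_zero_left)
qed

lemma bij_lin_exp:
  fixes f :: "'a::euclidean_space \<Rightarrow> 'a"
  assumes "linear f" shows "bij (lin_exp f)"
proof (rule bij_betw_byWitness[where f' = "lin_exp (\<lambda>x. - f x)"])
  show "\<forall>x\<in>UNIV. lin_exp (\<lambda>x. - f x) (lin_exp f x) = x"
    by (simp add: lin_exp_inverse[OF assms])
  show "\<forall>x\<in>UNIV. lin_exp f (lin_exp (\<lambda>x. - f x) x) = x"
    using lin_exp_inverse[OF linear_compose_neg[OF assms]] by simp
qed simp_all

text \<open>By the product rule, the bracket of the two curves solves the linear equation of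
  \<open>f\<close>. For \<open>f = br z\<close> the derivation property is the Jacobi
  identity.\<close>

lemma lin_exp_derivation:
  fixes br :: "'a::euclidean_space \<Rightarrow> 'a \<Rightarrow> 'a"
  assumes "linear f" "bilinear br" and der: "\<And>x y. f (br x y) = br (f x) y + br x (f y)"
  shows "lin_exp f (br x y) = br (lin_exp f x) (lin_exp f y)"
proof -
  let ?e = "\<lambda>t::real. lin_exp (\<lambda>x. t *\<^sub>R f x)"
  have bb: "bounded_bilinear br" using assms(2) bilinear_conv_bounded_bilinear by blast
  have "((\<lambda>t. br (?e t x) (?e t y)) has_vector_derivative f (br (?e t x) (?e t y))) (at t)" for t
    unfolding der
    using bounded_bilinear.has_vector_derivative[OF bb lin_exp_deriv[OF assms(1)] lin_exp_deriv[OF assms(1)]]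
    by (simp add: add.commute)
  from lin_exp_unique[OF assms(1) this]
  show ?thesis by (simp add: lin_exp_zero[OF assms(1)] del: scaleR_zero_left)
qed

section \<open>Alternating multilinear forms\<close>

text \<open>Forms live on infinite sequences of which only the first \<open>d\<close> entries are
  read. Generating them from products of linear functionals turns properties of forms into
  inductions with one substantial case.\<close>

inductive multilin :: "nat \<Rightarrow> ((nat \<Rightarrow> 'a::euclidean_space) \<Rightarrow> real) \<Rightarrow> bool" for d where
  multilin_prod: "(\<And>i. i < d \<Longrightarrow> linear (\<xi> i)) \<Longrightarrow> multilin d (\<lambda>x. \<Prod>i<d. \<xi> i (x i))"
| multilin_add: "multilin d G \<Longrightarrow> multilin d G' \<Longrightarrow> multilin d (\<lambda>x. G x + G' x)"
| multilin_scale: "multilin d G \<Longrightarrow> multilin d (\<lambda>x. c * G x)"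

lemma multilin_zero: "multilin d (\<lambda>x. 0)"
  using multilin_scale[OF multilin_prod[of d "\<lambda>_ _. 0"], of 0] by (simp add: linear_zero)

lemma multilin_sum: "(\<And>i. i \<in> S \<Longrightarrow> multilin d (G i)) \<Longrightarrow> multilin d (\<lambda>x. \<Sum>i\<in>S. G i x)"
  by (induction S rule: infinite_finite_induct) (auto intro: multilin_zero multilin_add)

text \<open>The infinitesimal action of \<open>f\<close> on forms, without the sign of the dual
  representation: the derivative at \<open>0\<close> of \<open>G\<close> when
  \<open>exp (t f)\<close> is applied to all arguments.\<close>

definition der :: "nat \<Rightarrow> ('a \<Rightarrow> 'a) \<Rightarrow> ((nat \<Rightarrow> 'a) \<Rightarrow> real) \<Rightarrow> (nat \<Rightarrow> 'a) \<Rightarrow> real" where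
  "der d f G x = (\<Sum>i<d. G (x(i := f (x i))))"

lemma der_add: "der d f (\<lambda>x. G x + G' x) = (\<lambda>x. der d f G x + der d f G' x)"
  by (simp add: der_def fun_eq_iff sum.distrib)

lemma der_scale: "der d f (\<lambda>x. c * G x) = (\<lambda>x. c * der d f G x)"
  by (simp add: der_def fun_eq_iff sum_distrib_left)

lemma prod_update:
  fixes d :: nat and \<xi> :: "nat \<Rightarrow> 'a \<Rightarrow> 'b::comm_monoid_mult"
  assumes "i < d"
  shows "(\<Prod>k<d. \<xi> k ((x(i := u)) k)) = \<xi> i u * (\<Prod>k\<in>{..<d} - {i}. \<xi> k (x k))"
proof -
  have "(\<Prod>k<d. \<xi> k ((x(i := u)) k)) = \<xi> i ((x(i := u)) i) * (\<Prod>k\<in>{..<d} - {i}. \<xi> k ((x(i := u)) k))"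
    using assms by (intro prod.remove) auto
  also have "(\<Prod>k\<in>{..<d} - {i}. \<xi> k ((x(i := u)) k)) = (\<Prod>k\<in>{..<d} - {i}. \<xi> k (x k))"
    by (intro prod.cong) auto
  finally show ?thesis by simp
qed

lemma multilin_der:
  assumes "multilin d G" "linear f" shows "multilin d (der d f G)"
  using assms(1)
proof induction
  case (multilin_prod \<xi>)
  have "der d f (\<lambda>x. \<Prod>i<d. \<xi> i (x i)) = (\<lambda>x. \<Sum>i<d. \<Prod>k<d. (\<xi>(i := \<xi> i \<circ> f)) k (x k))"
  proof
    fix x
    have "(\<Prod>k<d. \<xi> k ((x(i := f (x i))) k)) = (\<Prod>k<d. (\<xi>(i := \<xi> i \<circ> f)) k (x k))" for i
      by (intro prod.cong) auto
    then show "der d f (\<lambda>x. \<Prod>i<d. \<xi> i (x i)) x = (\<Sum>i<d. \<Prod>k<d. (\<xi>(i := \<xi> i \<circ> f)) k (x k))"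
      by (simp add: der_def)
  qed
  moreover have "multilin d (\<lambda>x. \<Sum>i<d. \<Prod>k<d. (\<xi>(i := \<xi> i \<circ> f)) k (x k))"
  proof (rule multilin_sum)
    fix i assume "i \<in> {..<d}"
    show "multilin d (\<lambda>x. \<Prod>k<d. (\<xi>(i := \<xi> i \<circ> f)) k (x k))"
    proof (rule multilin.multilin_prod)
      show "linear ((\<xi>(i := \<xi> i \<circ> f)) k)" if "k < d" for k
        using multilin_prod that linear_compose[OF assms(2) multilin_prod[OF that]] by (cases "k = i") (simp_all add: fun_upd_def)
    qed
  qed
  ultimately show ?case by simp
qed (simp_all only: der_add der_scale multilin_add multilin_scale)

lemma multilin_linear:
  assumes "multilin d G" "i < d" shows "linear (\<lambda>u. G (x(i := u)))"
  using assms(1)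
proof induction
  case (multilin_prod \<xi>)
  have "linear (\<xi> i)" using multilin_prod assms(2) .
  then show ?case
    unfolding prod_update[OF assms(2)]
    by (intro linearI) (simp_all add: linear_add linear_cmul algebra_simps)
next
  case (multilin_add G G')
  then show ?case by (intro linear_compose_add)
next
  case (multilin_scale G c)
  then show ?case using linear_compose_scale_right[OF multilin_scale.IH, of c] by (simp only: real_scaleR_def)
qed

lemma multilin_deriv:
  assumes "multilin d G"
    and x: "\<And>i. i < d \<Longrightarrow> ((\<lambda>t. x t i) has_vector_derivative f (x t i)) (at t)"
  shows "((\<lambda>t. G (x t)) has_real_derivative der d f G (x t)) (at t)"
  using assms(1)
proof induction
  case (multilin_prod \<xi>)
  have "((\<lambda>t. \<Prod>i<d. \<xi> i (x t i)) has_real_derivative (\<Sum>i<d. \<xi> i (f (x t i)) * (\<Prod>k\<in>{..<d} - {i}. \<xi> k (x t k)))) (at t)"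
  proof (rule has_field_derivative_prod)
    fix i assume "i \<in> {..<d}"
    then have "bounded_linear (\<xi> i)" "i < d" using multilin_prod linear_conv_bounded_linear by auto
    from bounded_linear.has_vector_derivative[OF this(1) x[OF this(2)]]
    show "((\<lambda>t. \<xi> i (x t i)) has_real_derivative \<xi> i (f (x t i))) (at t)"
      by (simp add: has_real_derivative_iff_has_vector_derivative)
  qed
  moreover have "der d f (\<lambda>x. \<Prod>i<d. \<xi> i (x i)) (x t) = (\<Sum>i<d. \<xi> i (f (x t i)) * (\<Prod>k\<in>{..<d} - {i}. \<xi> k (x t k)))"
    unfolding der_def by (intro sum.cong refl) (rule prod_update, simp)
  ultimately show ?case by simp
next
  case (multilin_add G G')
  then show ?case unfolding der_add by (intro DERIV_add)
next
  case (multilin_scale G c)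
  then show ?case unfolding der_scale by (intro DERIV_cmult)
qed

lemma multilin_bound:
  assumes "multilin d G"
  shows "\<exists>C\<ge>0. \<forall>x. \<bar>G x\<bar> \<le> C * (\<Prod>i<d. norm (x i))"
  using assms
proof induction
  case (multilin_prod \<xi>)
  have "\<exists>K\<ge>0. \<forall>u. \<bar>\<xi> i u\<bar> \<le> K * norm u" if "i < d" for i
    using linear_norm_bound[OF multilin_prod[OF that]] by (metis real_norm_def)
  then obtain K where K: "\<And>i. i < d \<Longrightarrow> K i \<ge> 0" "\<And>i u. i < d \<Longrightarrow> \<bar>\<xi> i u\<bar> \<le> K i * norm u" by metis
  show ?case
  proof (intro exI[of _ "\<Prod>i<d. K i"] conjI allI)
    show "0 \<le> (\<Prod>i<d. K i)" using K(1) by (intro prod_nonneg) auto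
    show "\<bar>\<Prod>i<d. \<xi> i (x i)\<bar> \<le> (\<Prod>i<d. K i) * (\<Prod>i<d. norm (x i))" for x
      unfolding abs_prod prod.distrib[symmetric] using K(2) by (intro prod_mono) auto
  qed
next
  case (multilin_add G G')
  then obtain C C' where C: "C \<ge> 0" "C' \<ge> 0" "\<And>x. \<bar>G x\<bar> \<le> C * (\<Prod>i<d. norm (x i))"
    "\<And>x. \<bar>G' x\<bar> \<le> C' * (\<Prod>i<d. norm (x i))" by blast
  have "\<bar>G x + G' x\<bar> \<le> (C + C') * (\<Prod>i<d. norm (x i))" for x
    using C(3)[of x] C(4)[of x] by (simp add: distrib_right)
  then show ?case using C(1,2) by (intro exI[of _ "C + C'"]) simp
next
  case (multilin_scale G c)
  then obtain C where C: "C \<ge> 0" "\<And>x. \<bar>G x\<bar> \<le> C * (\<Prod>i<d. norm (x i))" by blast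
  have "\<bar>c * G x\<bar> \<le> \<bar>c\<bar> * C * (\<Prod>i<d. norm (x i))" for x
    using mult_left_mono[OF C(2)[of x], of "\<bar>c\<bar>"] by (simp add: abs_mult mult.assoc)
  then show ?case using C(1) by (intro exI[of _ "\<bar>c\<bar> * C"]) simp
qed

text \<open>Each of the \<open>d\<close> summands costs one factor \<open>K\<close>. Hence
  \<open>k\<close> derivations cost at most \<open>(d * K) ^ k\<close>, which the factorial in a
  Taylor remainder outgrows.\<close>

lemma der_bound:
  assumes K: "K \<ge> 0" "\<And>u. norm (f u) \<le> K * norm u"
    and C: "C \<ge> 0" "\<And>x. \<bar>G x\<bar> \<le> C * (\<Prod>i<d. norm (x i))"
  shows "\<bar>der d f G x\<bar> \<le> (real d * K * C) * (\<Prod>i<d. norm (x i))"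
proof -
  have "\<bar>G (x(i := f (x i)))\<bar> \<le> C * (K * (\<Prod>i<d. norm (x i)))" if "i < d" for i
  proof -
    have "(\<Prod>k<d. norm ((x(i := f (x i))) k)) = norm (f (x i)) * (\<Prod>k\<in>{..<d} - {i}. norm (x k))"
      by (rule prod_update[OF that])
    also have "\<dots> \<le> (K * norm (x i)) * (\<Prod>k\<in>{..<d} - {i}. norm (x k))"
      by (intro mult_right_mono K prod_nonneg) auto
    also have "\<dots> = K * (\<Prod>k<d. norm (x k))"
      using that by (simp add: prod.remove[of "{..<d}" i])
    finally show ?thesis using C(2)[of "x(i := f (x i))"] mult_left_mono[OF _ C(1)] by (meson order_trans)
  qed
  then have "(\<Sum>i<d. \<bar>G (x(i := f (x i)))\<bar>) \<le> (\<Sum>i<d. C * (K * (\<Prod>i<d. norm (x i))))"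
    by (intro sum_mono) simp
  from order_trans[OF sum_abs this] show ?thesis unfolding der_def by (simp add: mult_ac)
qed

text \<open>Along the curve \<open>t \<mapsto> exp (t f) e\<close> the function \<open>G\<close> is analytic, and its Taylor coefficients
  at \<open>0\<close> are given by the iterated derivatives.\<close>
lemma multilin_exp_vanish:
  fixes f :: "'a::euclidean_space \<Rightarrow> 'a"
  assumes G: "multilin d G" and f: "linear f" and van: "\<And>k. (der d f ^^ k) G e = 0"
  shows "G (\<lambda>i. lin_exp f (e i)) = 0"
proof -
  define x where "x t i = lin_exp (\<lambda>u. t *\<^sub>R f u) (e i)" for t i
  have x0: "x 0 = e" unfolding x_def using lin_exp_zero[OF f] by blast
  have x1: "x 1 = (\<lambda>i. lin_exp f (e i))" by (simp add: x_def[abs_def])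
  have xd: "((\<lambda>t. x t i) has_vector_derivative f (x t i)) (at t)" for t i
    unfolding x_def by (rule lin_exp_deriv[OF f])
  have ml: "multilin d ((der d f ^^ k) G)" for k
    by (induction k) (simp_all add: G multilin_der[OF _ f])
  define g where "g k t = (der d f ^^ k) G (x t)" for k t
  have gd: "(g k has_real_derivative g (Suc k) t) (at t)" for k t
    unfolding g_def[abs_def] using multilin_deriv[where x = x and f = f and t = t, OF ml[of k] xd] by simp
  obtain K where K: "K \<ge> 0" "\<And>u. norm (f u) \<le> K * norm u" using linear_norm_bound[OF f] by blast
  obtain C where C: "C \<ge> 0" "\<And>x. \<bar>G x\<bar> \<le> C * (\<Prod>i<d. norm (x i))" using multilin_bound[OF G] by blast
  have bd: "\<bar>(der d f ^^ k) G y\<bar> \<le> ((real d * K) ^ k * C) * (\<Prod>i<d. norm (y i))" for k y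
  proof (induction k arbitrary: y)
    case (Suc k)
    have "(real d * K) ^ k * C \<ge> 0" using K C by simp
    from der_bound[where f = f and G = "(der d f ^^ k) G", OF K this Suc, of y] show ?case by (simp add: mult_ac)
  qed (use C in simp)
  have "continuous_on {0..1} (\<lambda>t. \<Prod>i<d. norm (x t i))"
    by (intro continuous_intros continuous_at_imp_continuous_on ballI has_vector_derivative_continuous[OF xd])
  then obtain R where R: "\<And>t. t \<in> {0..1} \<Longrightarrow> (\<Prod>i<d. norm (x t i)) \<le> R"
    using continuous_attains_sup[of "{0..1::real}"] by (metis atLeastAtMost_iff compact_Icc empty_iff order_refl zero_le_one)
  \<comment> \<open>As all Taylor coefficients at \<open>0\<close> vanish, Maclaurin's formula
    leaves only the remainder, for every order \<open>N\<close>.\<close>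
  have est: "\<bar>g 0 1\<bar> \<le> C * R * (inverse (fact N) * (real d * K) ^ N)" for N
  proof -
    obtain t where t: "0 < t" "t \<le> 1" "g 0 1 = (\<Sum>m<N. g m 0 / fact m * 1 ^ m) + g N t / fact N * 1 ^ N"
      using Maclaurin2[of 1 g "g 0" N] gd by auto
    have "g m 0 = 0" for m using van[of m] by (simp add: g_def x0)
    then have "\<bar>g 0 1\<bar> = \<bar>g N t\<bar> / fact N" using t(3) by simp
    also have "\<bar>g N t\<bar> \<le> ((real d * K) ^ N * C) * (\<Prod>i<d. norm (x t i))" unfolding g_def by (rule bd)
    also have "\<dots> \<le> ((real d * K) ^ N * C) * R" using R[of t] t K C by (intro mult_left_mono) auto
    finally show ?thesis by (simp add: field_simps)
  qed
  have "(\<lambda>N. C * R * (inverse (fact N) * (real d * K) ^ N)) \<longlonglongrightarrow> C * R * 0"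
    by (intro tendsto_mult_left summable_LIMSEQ_zero summable_exp)
  then have "\<bar>g 0 1\<bar> \<le> C * R * 0" by (rule LIMSEQ_le_const) (use est in blast)
  then show ?thesis by (simp add: g_def x1)
qed

text \<open>Substitutions in different slots commute, so only the terms with both operators in the
  same slot survive in the difference. The commutator has its factors exchanged because
  \<open>der\<close> composes in the opposite order to the maps.\<close>

lemma der_commute:
  assumes G: "multilin d G"
  shows "der d f (der d g G) x = der d g (der d f G) x + der d (\<lambda>u. g (f u) - f (g u)) G x"
proof -
  define S where "S i j = G ((x(i := f (x i)))(j := g (x j)))" for i j
  have 1: "der d f (der d g G) x = (\<Sum>i<d. G (x(i := g (f (x i)))) + (\<Sum>j\<in>{..<d} - {i}. S i j))"
    if "S = (\<lambda>i j. G ((x(i := f (x i)))(j := g (x j))))" for f g S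
    unfolding der_def
  proof (intro sum.cong refl)
    fix i assume "i \<in> {..<d}"
    then have "(\<Sum>j<d. G ((x(i := f (x i)))(j := g ((x(i := f (x i))) j))))
      = G ((x(i := f (x i)))(i := g ((x(i := f (x i))) i))) + (\<Sum>j\<in>{..<d} - {i}. G ((x(i := f (x i)))(j := g ((x(i := f (x i))) j))))"
      by (intro sum.remove) auto
    also have "(\<Sum>j\<in>{..<d} - {i}. G ((x(i := f (x i)))(j := g ((x(i := f (x i))) j)))) = (\<Sum>j\<in>{..<d} - {i}. S i j)"
      by (intro sum.cong) (auto simp: that)
    finally show "(\<Sum>j<d. G ((x(i := f (x i)))(j := g ((x(i := f (x i))) j))))
      = G (x(i := g (f (x i)))) + (\<Sum>j\<in>{..<d} - {i}. S i j)" by (simp only: fun_upd_same fun_upd_upd)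
  qed
  define S' where "S' i j = G ((x(i := g (x i)))(j := f (x j)))" for i j
  have S: "S = (\<lambda>i j. G ((x(i := f (x i)))(j := g (x j))))"
    and S': "S' = (\<lambda>i j. G ((x(i := g (x i)))(j := f (x j))))"
    by (intro ext, simp only: S_def S'_def)+
  have flip: "(\<Sum>i<d. \<Sum>j\<in>{..<d} - {i}. S i j) = (\<Sum>i<d. \<Sum>j\<in>{..<d} - {i}. S' i j)"
  proof -
    have *: "(\<Sum>j\<in>{..<d} - {i}. F j) = (\<Sum>j<d. if j = i then 0 else F j)" for i and F :: "nat \<Rightarrow> real"
      by (rule sum.mono_neutral_cong_left) auto
    have "(\<Sum>i<d. \<Sum>j\<in>{..<d} - {i}. S i j) = (\<Sum>j<d. \<Sum>i<d. if j = i then 0 else S i j)"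
      unfolding * by (rule sum.swap)
    also have "\<dots> = (\<Sum>i<d. \<Sum>j\<in>{..<d} - {i}. S' i j)"
      unfolding * by (intro sum.cong) (auto simp: S_def S'_def fun_upd_twist)
    finally show ?thesis .
  qed
  have "der d (\<lambda>u. g (f u) - f (g u)) G x = (\<Sum>i<d. G (x(i := g (f (x i)))) - G (x(i := f (g (x i)))))"
    unfolding der_def by (intro sum.cong refl linear_diff[OF multilin_linear[OF G]]) simp
  then show ?thesis
    unfolding 1[OF S] 1[OF S'] sum.distrib sum_subtractf flip by simp
qed

definition alternating :: "nat \<Rightarrow> ((nat \<Rightarrow> 'a) \<Rightarrow> real) \<Rightarrow> bool" where
  "alternating d G \<longleftrightarrow> (\<forall>x i j. i < d \<longrightarrow> j < d \<longrightarrow> i \<noteq> j \<longrightarrow> x i = x j \<longrightarrow> G x = 0)"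

lemma alternatingD: "alternating d G \<Longrightarrow> i < d \<Longrightarrow> j < d \<Longrightarrow> i \<noteq> j \<Longrightarrow> x i = x j \<Longrightarrow> G x = 0"
  unfolding alternating_def by blast

text \<open>If \<open>x i = x j\<close>, substitutions outside the slots \<open>i\<close> and
  \<open>j\<close> still leave equal arguments. The two remaining terms cancel, by polarization of
  \<open>G\<close> at \<open>x i + f (x i)\<close> in both slots.\<close>

lemma alternating_der:
  fixes f :: "'a::euclidean_space \<Rightarrow> 'a"
  assumes G: "multilin d G" "alternating d G"
  shows "alternating d (der d f G)"
  unfolding alternating_def
proof (intro allI impI)
  fix x :: "nat \<Rightarrow> 'a" and i j assume ij: "i < d" "j < d" "i \<noteq> j" "x i = x j"
  let ?u = "x i" and ?v = "f (x i)"
  have lin: "linear (\<lambda>u. G (y(k := u)))" if "k < d" for k y by (rule multilin_linear[OF G(1) that])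
  have add: "G (y(k := u + v)) = G (y(k := u)) + G (y(k := v))" if "k < d" for k y u v
    using linear_add[OF lin[OF that, of y]] .
  have z: "G ((x(i := u))(j := u)) = 0" for u
    by (rule alternatingD[OF G(2) ij(1,2,3)]) (use ij(3) in simp)
  have "G ((x(i := ?u + ?v))(j := w)) = G ((x(i := ?u))(j := w)) + G ((x(i := ?v))(j := w))" for w
    using add[OF ij(1), of "x(j := w)" ?u ?v] fun_upd_twist[OF ij(3)] by metis
  then have "G ((x(i := ?u + ?v))(j := ?u + ?v)) = G ((x(i := ?u))(j := ?u)) + G ((x(i := ?v))(j := ?u))
      + (G ((x(i := ?u))(j := ?v)) + G ((x(i := ?v))(j := ?v)))"
    by (simp only: add[OF ij(2)])
  then have sum0: "G ((x(i := ?v))(j := ?u)) + G ((x(i := ?u))(j := ?v)) = 0"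
    by (simp only: z)
  have "der d f G x = (\<Sum>k\<in>{i, j}. G (x(k := f (x k))))"
    unfolding der_def
  proof (rule sum.mono_neutral_right)
    show "\<forall>k\<in>{..<d} - {i, j}. G (x(k := f (x k))) = 0"
      using ij by (auto intro: alternatingD[OF G(2) ij(1,2,3)])
  qed (use ij in auto)
  also have "\<dots> = G (x(i := ?v)) + G (x(j := ?v))" using ij(3,4) by simp
  also have "\<dots> = 0" using sum0 ij(3,4) fun_upd_idem[of "x(i := ?v)" j ?u] fun_upd_idem[of x i ?u] by simp
  finally show "der d f G x = 0" .
qed

text \<open>The determinant of the matrix \<open>\<xi> i (x j)\<close>, that is, the wedge product
  of the functionals as an alternating form.\<close>

definition alt_det :: "nat \<Rightarrow> (nat \<Rightarrow> 'a \<Rightarrow> real) \<Rightarrow> (nat \<Rightarrow> 'a) \<Rightarrow> real" where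
  "alt_det d \<xi> x = (\<Sum>p | p permutes {..<d}. of_int (sign p) * (\<Prod>i<d. \<xi> (p i) (x i)))"

lemma multilin_alt_det:
  fixes \<xi> :: "nat \<Rightarrow> 'a::euclidean_space \<Rightarrow> real"
  assumes "\<And>i. i < d \<Longrightarrow> linear (\<xi> i)"
  shows "multilin d (alt_det d \<xi>)"
  unfolding alt_det_def[abs_def]
proof (intro multilin_sum multilin_scale multilin_prod assms)
  fix p i assume "p \<in> {p. p permutes {..<d}}" "i < d"
  then show "p i < d" using permutes_in_image[of p "{..<d}" i] by simp
qed

lemma sign_transpose_comp:
  fixes d :: nat
  assumes "p permutes {..<d}" "i < d" "j < d" "i \<noteq> j"
  shows "sign (p \<circ> Transposition.transpose i j) = - sign p" "sign (Transposition.transpose i j \<circ> p) = - sign p"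
proof -
  have "permutation p" using assms(1) by (rule permutes_imp_permutation[rotated]) simp
  moreover have "permutation (Transposition.transpose i j)" by (rule permutation_swap_id)
  ultimately show "sign (p \<circ> Transposition.transpose i j) = - sign p" "sign (Transposition.transpose i j \<circ> p) = - sign p"
    using assms(4) by (simp_all add: sign_compose sign_swap_id)
qed

lemma alternating_alt_det:
  fixes \<xi> :: "nat \<Rightarrow> 'a \<Rightarrow> real"
  shows "alternating d (alt_det d \<xi>)"
  unfolding alternating_def
proof (intro allI impI)
  fix x :: "nat \<Rightarrow> 'a" and i j assume ij: "i < d" "j < d" "i \<noteq> j" "x i = x j"
  let ?\<tau> = "Transposition.transpose i j"
  have \<tau>: "?\<tau> permutes {..<d}" using ij by (intro permutes_swap_id) auto
  have x: "x (?\<tau> k) = x k" for k using ij(4) by (auto simp: Transposition.transpose_def)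
  have "alt_det d \<xi> x = (\<Sum>p | p permutes {..<d}. of_int (sign (p \<circ> ?\<tau>)) * (\<Prod>k<d. \<xi> ((p \<circ> ?\<tau>) k) (x k)))"
    unfolding alt_det_def by (rule sum_permutations_compose_right[OF \<tau>])
  also have "\<dots> = (\<Sum>p | p permutes {..<d}. - (of_int (sign p) * (\<Prod>k<d. \<xi> (p k) (x k))))"
  proof (intro sum.cong refl)
    fix p assume "p \<in> {p. p permutes {..<d}}"
    then have s: "sign (p \<circ> ?\<tau>) = - sign p" using sign_transpose_comp ij by blast
    have "(\<Prod>k<d. \<xi> ((p \<circ> ?\<tau>) k) (x k)) = (\<Prod>k<d. \<xi> (p (?\<tau> k)) (x (?\<tau> k)))" by (simp add: x)
    also have "\<dots> = (\<Prod>k<d. \<xi> (p k) (x k))"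
      using prod.permute[OF \<tau>, of "\<lambda>k. \<xi> (p k) (x k)"] by (simp add: o_def)
    finally show "of_int (sign (p \<circ> ?\<tau>)) * (\<Prod>k<d. \<xi> ((p \<circ> ?\<tau>) k) (x k))
      = - (of_int (sign p) * (\<Prod>k<d. \<xi> (p k) (x k)))" by (simp add: s)
  qed
  also have "\<dots> = - alt_det d \<xi> x" by (simp add: alt_det_def sum_negf)
  finally show "alt_det d \<xi> x = 0" by simp
qed

lemma alt_det_equal_forms:
  assumes ij: "i < d" "j < d" "i \<noteq> j" "\<xi> i = \<xi> j" shows "alt_det d \<xi> x = 0"
proof -
  let ?\<tau> = "Transposition.transpose i j"
  have \<tau>: "?\<tau> permutes {..<d}" using ij by (intro permutes_swap_id) auto
  have \<xi>: "\<xi> (?\<tau> k) = \<xi> k" for k using ij(4) by (auto simp: Transposition.transpose_def)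
  have "alt_det d \<xi> x = (\<Sum>p | p permutes {..<d}. of_int (sign (?\<tau> \<circ> p)) * (\<Prod>k<d. \<xi> ((?\<tau> \<circ> p) k) (x k)))"
    unfolding alt_det_def by (rule setum_permutations_compose_left[OF \<tau>])
  also have "\<dots> = (\<Sum>p | p permutes {..<d}. - (of_int (sign p) * (\<Prod>k<d. \<xi> (p k) (x k))))"
    using sign_transpose_comp(2)[OF _ ij(1,2,3)] by (intro sum.cong refl) (simp add: \<xi>)
  also have "\<dots> = - alt_det d \<xi> x" by (simp add: alt_det_def sum_negf)
  finally show ?thesis by simp
qed

lemma alt_det_dual:
  assumes "\<And>i j. i < d \<Longrightarrow> j < d \<Longrightarrow> \<xi> i (x j) = (if i = j then 1 else 0)"
  shows "alt_det d \<xi> x = 1"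
proof -
  have "of_int (sign p) * (\<Prod>i<d. \<xi> (p i) (x i)) = 0" if p: "p permutes {..<d}" "p \<noteq> id" for p
  proof -
    obtain i where "p i \<noteq> i" using p(2) by (auto simp: fun_eq_iff)
    then have "i < d" "p i < d" using p(1) permutes_in_image[OF p(1), of i] by (auto simp: permutes_def)
    then have "\<xi> (p i) (x i) = 0" using assms \<open>p i \<noteq> i\<close> by simp
    then show ?thesis using \<open>i < d\<close> by (simp, blast intro: prod_zero)
  qed
  then have "alt_det d \<xi> x = (\<Sum>p\<in>{id}. of_int (sign p) * (\<Prod>i<d. \<xi> (p i) (x i)))"
    unfolding alt_det_def by (intro sum.mono_neutral_right) (auto simp: finite_permutations permutes_id)
  also have "\<dots> = 1" using assms by simp
  finally show ?thesis .
qed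

text \<open>A derivation acts on a top exterior power by the trace. Replacing one functional by
  another one of the list gives a determinant with two equal rows, so only the diagonal coefficients
  survive.\<close>

lemma alt_det_der:
  assumes c: "\<And>i u. i < d \<Longrightarrow> \<xi> i (f u) = (\<Sum>m<d. c i m * \<xi> m u)"
  shows "der d f (alt_det d \<xi>) x = (\<Sum>i<d. c i i) * alt_det d \<xi> x"
proof -
  define Q where "Q p j m = (\<Prod>k<d. (\<xi>(j := \<xi> m)) (p k) (x k))" for p j m
  have expand: "(\<Prod>k<d. \<xi> (p k) ((x(i := f (x i))) k)) = (\<Sum>m<d. c (p i) m * Q p (p i) m)"
    if p: "p permutes {..<d}" and i: "i < d" for p i
  proof -
    let ?R = "\<Prod>k\<in>{..<d} - {i}. \<xi> (p k) (x k)"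
    have pi: "p i < d" using permutes_in_image[OF p, of i] i by simp
    have inj: "p k = p i \<longleftrightarrow> k = i" for k using permutes_inj[OF p] by (auto dest: injD)
    have Q: "Q p (p i) m = \<xi> m (x i) * ?R" for m
    proof -
      have "Q p (p i) m = (\<xi>(p i := \<xi> m)) (p i) (x i) * (\<Prod>k\<in>{..<d} - {i}. (\<xi>(p i := \<xi> m)) (p k) (x k))"
        unfolding Q_def using i by (intro prod.remove) auto
      also have "(\<Prod>k\<in>{..<d} - {i}. (\<xi>(p i := \<xi> m)) (p k) (x k)) = ?R"
        by (intro prod.cong) (auto simp: inj)
      finally show ?thesis by simp
    qed
    have "(\<Prod>k<d. \<xi> (p k) ((x(i := f (x i))) k)) = \<xi> (p i) (f (x i)) * ?R"
      by (rule prod_update[OF i])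
    also have "\<dots> = (\<Sum>m<d. c (p i) m * Q p (p i) m)"
      by (simp add: c[OF pi] sum_distrib_right mult.assoc Q)
    finally show ?thesis .
  qed
  let ?S = "{p. p permutes {..<d}}"
  have "der d f (alt_det d \<xi>) x = (\<Sum>i<d. \<Sum>p\<in>?S. of_int (sign p) * (\<Sum>m<d. c (p i) m * Q p (p i) m))"
    unfolding der_def alt_det_def by (intro sum.cong refl) (simp only: expand mem_Collect_eq lessThan_iff)
  also have "\<dots> = (\<Sum>p\<in>?S. of_int (sign p) * (\<Sum>i<d. \<Sum>m<d. c (p i) m * Q p (p i) m))"
    unfolding sum_distrib_left by (rule sum.swap)
  also have "\<dots> = (\<Sum>p\<in>?S. of_int (sign p) * (\<Sum>j<d. \<Sum>m<d. c j m * Q p j m))"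
  proof (rule sum.cong[OF refl], rule arg_cong2[where f = "(*)", OF refl])
    fix p assume "p \<in> ?S"
    then have "p permutes {..<d}" by simp
    from sum.permute[OF this, of "\<lambda>j. \<Sum>m<d. c j m * Q p j m"]
    show "(\<Sum>i<d. \<Sum>m<d. c (p i) m * Q p (p i) m) = (\<Sum>j<d. \<Sum>m<d. c j m * Q p j m)"
      by (simp only: o_def)
  qed
  also have "\<dots> = (\<Sum>j<d. \<Sum>p\<in>?S. \<Sum>m<d. of_int (sign p) * (c j m * Q p j m))"
    unfolding sum_distrib_left by (rule sum.swap)
  also have "\<dots> = (\<Sum>j<d. \<Sum>m<d. \<Sum>p\<in>?S. of_int (sign p) * (c j m * Q p j m))"
    by (intro sum.cong refl sum.swap)
  also have "\<dots> = (\<Sum>j<d. \<Sum>m<d. c j m * alt_det d (\<xi>(j := \<xi> m)) x)"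
    unfolding alt_det_def sum_distrib_left Q_def by (simp only: mult.left_commute)
  also have "\<dots> = (\<Sum>j<d. c j j * alt_det d \<xi> x)"
  proof (intro sum.cong refl)
    fix j assume j: "j \<in> {..<d}"
    have "(\<Sum>m<d. c j m * alt_det d (\<xi>(j := \<xi> m)) x) = (\<Sum>m<d. if m = j then c j j * alt_det d \<xi> x else 0)"
      using j alt_det_equal_forms[of j d _ "\<xi>(j := \<xi> _)"] by (intro sum.cong) auto
    then show "(\<Sum>m<d. c j m * alt_det d (\<xi>(j := \<xi> m)) x) = c j j * alt_det d \<xi> x" using j by simp
  qed
  finally show ?thesis by (simp add: sum_distrib_right)
qed

section \<open>Symmetric operators\<close>

locale ip_space =
  fixes ip :: "'g::euclidean_space \<Rightarrow> 'g \<Rightarrow> real"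
  assumes ip_bilinear: "bilinear ip" and ip_sym: "ip x y = ip y x" and ip_pos: "x \<noteq> 0 \<Longrightarrow> ip x x > 0"
begin

lemmas ip_simps = bilinear_ladd[OF ip_bilinear] bilinear_radd[OF ip_bilinear]
  bilinear_lmul[OF ip_bilinear] bilinear_rmul[OF ip_bilinear]
  bilinear_lneg[OF ip_bilinear] bilinear_rneg[OF ip_bilinear]
  bilinear_lsub[OF ip_bilinear] bilinear_rsub[OF ip_bilinear]
  bilinear_lzero[OF ip_bilinear] bilinear_rzero[OF ip_bilinear]

lemma ip_bounded_bilinear: "bounded_bilinear ip"
  using ip_bilinear bilinear_conv_bounded_bilinear by blast

lemma ip_continuous: "continuous_on S f \<Longrightarrow> continuous_on S g \<Longrightarrow> continuous_on S (\<lambda>x. ip (f x) (g x))"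
  by (rule bounded_bilinear.continuous_on[OF ip_bounded_bilinear])

lemma ip_nonneg: "ip x x \<ge> 0"
  using ip_pos[of x] by (cases "x = 0") (auto simp: ip_simps)

lemma ip_eq_0: "ip x x = 0 \<longleftrightarrow> x = 0"
  using ip_pos[of x] by (cases "x = 0") (auto simp: ip_simps)

text \<open>The topology comes from the norm of the type and not from \<open>ip\<close>; this
  comparison turns bounds on \<open>ip\<close> into boundedness, hence compactness.\<close>

lemma ip_coercive: obtains c where "c > 0" "\<And>x. c * (norm x)\<^sup>2 \<le> ip x x"
proof -
  have "compact (sphere (0::'g) 1)" "sphere (0::'g) 1 \<noteq> {}" by auto
  then obtain s where s: "s \<in> sphere 0 1" "\<And>x. x \<in> sphere 0 1 \<Longrightarrow> ip s s \<le> ip x x"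
    using continuous_attains_inf[of "sphere (0::'g) 1" "\<lambda>x. ip x x"] ip_continuous[OF continuous_on_id continuous_on_id]
    by auto
  show thesis
  proof
    show "ip s s > 0" using s by (intro ip_pos) auto
    show "ip s s * (norm x)\<^sup>2 \<le> ip x x" for x
    proof (cases "x = 0")
      case False
      have "ip s s \<le> ip (x /\<^sub>R norm x) (x /\<^sub>R norm x)" using False by (intro s) auto
      then show ?thesis using False by (simp add: ip_simps field_simps power2_eq_square)
    qed (simp add: ip_simps)
  qed
qed

lemma ip_closest:
  assumes "closed C" "C \<noteq> {}"
  shows "\<exists>y\<in>C. \<forall>z\<in>C. ip (y - a) (y - a) \<le> ip (z - a) (z - a)"
proof -
  obtain c where c: "c > 0" "\<And>x. c * (norm x)\<^sup>2 \<le> ip x x" by (rule ip_coercive) blast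
  obtain z0 where z0: "z0 \<in> C" using assms by auto
  let ?D = "{z \<in> C. ip (z - a) (z - a) \<le> ip (z0 - a) (z0 - a)}"
  have "closed ?D"
    by (intro closed_Collect_conj[of "\<lambda>z. z \<in> C", simplified] assms closed_Collect_le ip_continuous continuous_intros)
  moreover have "bounded ?D"
  proof (rule boundedI)
    fix z assume "z \<in> ?D"
    then have "c * (norm (z - a))\<^sup>2 \<le> ip (z0 - a) (z0 - a)" using c(2)[of "z - a"] by simp
    then have "norm (z - a) \<le> sqrt (ip (z0 - a) (z0 - a) / c)"
      using c(1) by (intro real_le_rsqrt) (simp add: field_simps)
    then show "norm z \<le> norm a + sqrt (ip (z0 - a) (z0 - a) / c)"
      using norm_triangle_sub[of z a] by simp
  qed
  ultimately have "compact ?D" by (simp add: compact_eq_bounded_closed)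
  then obtain y where y: "y \<in> ?D" "\<And>z. z \<in> ?D \<Longrightarrow> ip (y - a) (y - a) \<le> ip (z - a) (z - a)"
    using continuous_attains_inf[of ?D "\<lambda>z. ip (z - a) (z - a)"] z0
    by (force intro!: ip_continuous continuous_intros)
  show ?thesis
  proof (intro bexI ballI)
    show "y \<in> C" using y by simp
    show "ip (y - a) (y - a) \<le> ip (z - a) (z - a)" if "z \<in> C" for z
      using y(1) y(2)[of z] that by (cases "z \<in> ?D") auto
  qed
qed

lemma ip_stationary:
  assumes d: "(u has_vector_derivative d) (at (0::real))"
    and min: "\<And>t. ip (u 0 - a) (u 0 - a) \<le> ip (u t - a) (u t - a)"
  shows "ip d (u 0 - a) = 0"
proof -
  have "((\<lambda>t. u t - a) has_vector_derivative d) (at 0)" using has_vector_derivative_diff[OF d has_vector_derivative_const[of a]] by simp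
  from bounded_bilinear.has_vector_derivative[OF ip_bounded_bilinear this this]
  have "((\<lambda>t. ip (u t - a) (u t - a)) has_real_derivative 2 * ip d (u 0 - a)) (at 0)"
    by (simp add: has_real_derivative_iff_has_vector_derivative ip_sym[of "u 0 - a" d])
  then have "2 * ip d (u 0 - a) = 0"
    by (rule DERIV_local_min[of _ _ _ 1]) (use min in auto)
  then show ?thesis by simp
qed

lemma ip_projection:
  assumes "subspace S"
  obtains e where "e \<in> S" "\<And>v. v \<in> S \<Longrightarrow> ip (x - e) v = 0"
proof -
  obtain e where e: "e \<in> S" "\<And>z. z \<in> S \<Longrightarrow> ip (e - x) (e - x) \<le> ip (z - x) (z - x)"
    using ip_closest[OF closed_subspace[OF assms], of x] subspace_0[OF assms] by blast
  show thesis
  proof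
    fix v assume "v \<in> S"
    have "ip v (e + (0::real) *\<^sub>R v - x) = 0"
    proof (rule ip_stationary[where u = "\<lambda>t. e + t *\<^sub>R v"])
      show "((\<lambda>t. e + t *\<^sub>R v) has_vector_derivative v) (at 0)"
        by (auto intro!: derivative_eq_intros)
      show "ip (e + 0 *\<^sub>R v - x) (e + 0 *\<^sub>R v - x) \<le> ip (e + t *\<^sub>R v - x) (e + t *\<^sub>R v - x)" for t
        using e(2)[of "e + t *\<^sub>R v"] e(1) \<open>v \<in> S\<close> assms by (simp add: subspace_add subspace_scale)
    qed
    then show "ip (x - e) v = 0" by (simp add: ip_sym[of _ v] ip_simps)
  qed (rule e)
qed

text \<open>A maximizer of the Rayleigh quotient is an eigenvector.\<close>
lemma sym_eigenvector:
  assumes S: "subspace S" "S \<noteq> {0}" and f: "linear f" "\<And>x. x \<in> S \<Longrightarrow> f x \<in> S"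
    and sym: "\<And>x y. x \<in> S \<Longrightarrow> y \<in> S \<Longrightarrow> ip (f x) y = ip x (f y)"
  obtains v c where "v \<in> S" "v \<noteq> 0" "f v = c *\<^sub>R v"
proof -
  obtain x0 where x0: "x0 \<in> S" "x0 \<noteq> 0" using S subspace_0 by blast
  let ?C = "S \<inter> sphere 0 1"
  have cf: "continuous_on T f" for T using f(1) linear_continuous_on linear_conv_bounded_linear by blast
  have "compact ?C" using closed_subspace[OF S(1)] by (intro closed_Int_compact) auto
  moreover have "x0 /\<^sub>R norm x0 \<in> ?C" using x0 S by (auto simp: subspace_scale)
  ultimately obtain v where v: "v \<in> ?C" "\<And>x. x \<in> ?C \<Longrightarrow> ip x (f x) / ip x x \<le> ip v (f v) / ip v v"
    using continuous_attains_sup[of ?C "\<lambda>x. ip x (f x) / ip x x"]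
    by (force intro!: continuous_intros ip_continuous cf simp: ip_eq_0)
  have vS: "v \<in> S" "v \<noteq> 0" using v by auto
  define m where "m = ip v (f v) / ip v v"
  have m: "ip x (f x) \<le> m * ip x x" if "x \<in> S" for x
  proof (cases "x = 0")
    case False
    have "ip (x /\<^sub>R norm x) (f (x /\<^sub>R norm x)) / ip (x /\<^sub>R norm x) (x /\<^sub>R norm x) \<le> m"
      unfolding m_def using that False S by (intro v) (auto simp: subspace_scale)
    then show ?thesis using False ip_pos[OF False]
      by (simp add: ip_simps linear_cmul[OF f(1)] field_simps)
  qed (simp add: ip_simps)
  define w where "w = m *\<^sub>R v - f v"
  have wS: "w \<in> S" unfolding w_def using vS f S by (auto intro!: subspace_diff subspace_scale)
  have mv: "ip v (f v) = m * ip v v" using ip_pos[OF vS(2)] by (simp add: m_def)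
  \<comment> \<open>Compares the maximizer \<open>v\<close> with \<open>v + t w\<close> for the
    residual \<open>w\<close>. The linear term in \<open>t\<close> is a multiple of
    \<open>ip w w\<close>, so nonnegativity for small negative \<open>t\<close> forces
    \<open>w = 0\<close>.\<close>
  have q: "0 \<le> 2 * t * ip w w + t\<^sup>2 * (m * ip w w - ip w (f w))" for t
  proof -
    have "0 \<le> m * ip (v + t *\<^sub>R w) (v + t *\<^sub>R w) - ip (v + t *\<^sub>R w) (f (v + t *\<^sub>R w))"
      using m[of "v + t *\<^sub>R w"] vS wS S by (simp add: subspace_add subspace_scale)
    also have "\<dots> = 2 * t * (m * ip v w - ip w (f v)) + t\<^sup>2 * (m * ip w w - ip w (f w))"
      using sym[OF vS(1) wS] mv ip_sym[of v w] ip_sym[of "f v" w]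
      by (simp add: ip_simps linear_add[OF f(1)] linear_cmul[OF f(1)] algebra_simps power2_eq_square)
    also have "m * ip v w - ip w (f v) = ip w w"
      by (simp add: w_def ip_simps ip_sym algebra_simps)
    finally show ?thesis .
  qed
  have "ip w w = 0"
  proof (rule ccontr)
    define Q where "Q = m * ip w w - ip w (f w)"
    assume "ip w w \<noteq> 0"
    then have pos: "ip w w > 0" using ip_nonneg[of w] by simp
    \<comment> \<open>Negative, and so small that the quadratic term cannot compensate for the
      linear one.\<close>
    define t where "t = - ip w w / (\<bar>Q\<bar> + 1)"
    have t: "t < 0" "\<bar>t\<bar> * \<bar>Q\<bar> \<le> ip w w" using pos by (auto simp: t_def field_simps)
    have "2 * t * ip w w + t\<^sup>2 * Q = \<bar>t\<bar> * (\<bar>t\<bar> * Q - 2 * ip w w)"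
      using t(1) by (simp add: algebra_simps power2_eq_square)
    also have "\<dots> < 0"
    proof -
      have "\<bar>t\<bar> * Q \<le> \<bar>t\<bar> * \<bar>Q\<bar>" by (intro mult_left_mono) auto
      then have "\<bar>t\<bar> * Q < 2 * ip w w" using t(2) pos by linarith
      then show ?thesis using t by (intro mult_pos_neg) auto
    qed
    finally show False using q[of t] by (simp add: Q_def)
  qed
  then have "f v = m *\<^sub>R v" by (simp add: ip_eq_0 w_def)
  then show thesis using vS that by blast
qed

text \<open>An operator of the family that is not scalar on \<open>S\<close> has an eigenspace in
  \<open>S\<close> of smaller dimension, which the commuting operators preserve; if all are scalar,
  any nonzero vector will do.\<close>

lemma sym_joint_eigenvector:
  assumes S: "subspace S" "S \<noteq> {0}"
    and lin: "\<And>f. f \<in> F \<Longrightarrow> linear f" and inv: "\<And>f x. f \<in> F \<Longrightarrow> x \<in> S \<Longrightarrow> f x \<in> S"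
    and sym: "\<And>f x y. f \<in> F \<Longrightarrow> ip (f x) y = ip x (f y)"
    and comm: "\<And>f g x. f \<in> F \<Longrightarrow> g \<in> F \<Longrightarrow> x \<in> S \<Longrightarrow> f (g x) = g (f x)"
  shows "\<exists>v\<in>S. v \<noteq> 0 \<and> (\<forall>f\<in>F. \<exists>c. f v = c *\<^sub>R v)"
  using assms
proof (induction "dim S" arbitrary: S rule: less_induct)
  case less
  show ?case
  proof (cases "\<forall>f\<in>F. \<exists>c. \<forall>v\<in>S. f v = c *\<^sub>R v")
    case True
    then show ?thesis using less.prems(1,2) subspace_0 by blast
  next
    case False
    then obtain f where f: "f \<in> F" "\<And>c. \<exists>v\<in>S. f v \<noteq> c *\<^sub>R v" by blast
    obtain v c where v: "v \<in> S" "v \<noteq> 0" "f v = c *\<^sub>R v"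
      using sym_eigenvector[OF less.prems(1,2) less.prems(3)[OF f(1)]] less.prems(4,5) f(1) by metis
    define E where "E = {x \<in> S. f x = c *\<^sub>R x}"
    have E: "subspace E" using less.prems(1) linear_add[OF less.prems(3)[OF f(1)]] linear_cmul[OF less.prems(3)[OF f(1)]]
        linear_0[OF less.prems(3)[OF f(1)]]
      by (auto simp: E_def subspace_def scaleR_add_right)
    have "E \<noteq> S" using f(2)[of c] by (auto simp: E_def)
    then have "E \<subset> S" by (auto simp: E_def)
    then have "dim E < dim S"
      using E less.prems(1) by (intro dim_psubset) (metis span_eq_iff)
    moreover have "E \<noteq> {0}" using v by (auto simp: E_def)
    moreover have "g x \<in> E" if "g \<in> F" "x \<in> E" for g x
      using that less.prems(4)[OF that(1)] less.prems(6)[OF f(1) that(1)] linear_cmul[OF less.prems(3)[OF that(1)]]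
      by (auto simp: E_def)
    ultimately have "\<exists>v\<in>E. v \<noteq> 0 \<and> (\<forall>f\<in>F. \<exists>c. f v = c *\<^sub>R v)"
      using less.prems by (intro less.hyps E) (auto simp: E_def)
    then show ?thesis by (auto simp: E_def)
  qed
qed

text \<open>By symmetry, the orthogonal complement of the joint eigenvectors in \<open>S\<close> is
  again invariant. If it were nonzero, it would contain a joint eigenvector orthogonal to
  itself.\<close>

lemma sym_joint_span:
  assumes S: "subspace S"
    and lin: "\<And>f. f \<in> F \<Longrightarrow> linear f" and inv: "\<And>f x. f \<in> F \<Longrightarrow> x \<in> S \<Longrightarrow> f x \<in> S"
    and sym: "\<And>f x y. f \<in> F \<Longrightarrow> ip (f x) y = ip x (f y)"
    and comm: "\<And>f g x. f \<in> F \<Longrightarrow> g \<in> F \<Longrightarrow> x \<in> S \<Longrightarrow> f (g x) = g (f x)"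
  shows "S \<subseteq> span {v \<in> S. \<forall>f\<in>F. \<exists>c. f v = c *\<^sub>R v}" (is "S \<subseteq> span ?E")
proof (rule ccontr)
  assume "\<not> S \<subseteq> span ?E"
  then obtain x where x: "x \<in> S" "x \<notin> span ?E" by blast
  obtain e where e: "e \<in> span ?E" "\<And>v. v \<in> span ?E \<Longrightarrow> ip (x - e) v = 0"
    using ip_projection[of "span ?E" x] by auto
  have eS: "e \<in> S" using e(1) span_minimal[of ?E S] S by auto
  let ?R = "{y \<in> S. \<forall>v\<in>?E. ip y v = 0}"
  have R: "subspace ?R" using S by (auto simp: subspace_def ip_simps)
  have "x - e \<in> ?R" using x eS e S by (auto intro: subspace_diff span_base)
  moreover have "x - e \<noteq> 0" using x e by auto
  ultimately have "?R \<noteq> {0}" by blast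
  moreover have "f y \<in> ?R" if "f \<in> F" "y \<in> ?R" for f y
  proof -
    have "ip (f y) v = 0" if v: "v \<in> ?E" for v
    proof -
      obtain c where "f v = c *\<^sub>R v" using v \<open>f \<in> F\<close> by blast
      then show ?thesis using \<open>y \<in> ?R\<close> v \<open>f \<in> F\<close> by (simp add: sym ip_simps)
    qed
    then show ?thesis using that inv by blast
  qed
  ultimately obtain v where v: "v \<in> ?R" "v \<noteq> 0" "\<forall>f\<in>F. \<exists>c. f v = c *\<^sub>R v"
    using sym_joint_eigenvector[OF R, of F] lin sym comm by auto
  then have "ip v v = 0" by auto
  then show False using v by (simp add: ip_eq_0)
qed

end

section \<open>Lie algebras with a Cartan involution\<close>

lemma ltrace_commute:
  fixes f g :: "'g::euclidean_space \<Rightarrow> 'g"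
  assumes "linear f" "linear g"
  shows "ltrace (f \<circ> g) = ltrace (g \<circ> f)"
proof -
  have *: "ltrace (f \<circ> g) = (\<Sum>b\<in>Basis. \<Sum>c\<in>Basis. (g b \<bullet> c) * (f c \<bullet> b))"
    if "linear f" for f g :: "'g \<Rightarrow> 'g"
    unfolding ltrace_def o_def
  proof (rule sum.cong[OF refl])
    fix b :: 'g
    have "f (g b) \<bullet> b = f (\<Sum>c\<in>Basis. (g b \<bullet> c) *\<^sub>R c) \<bullet> b" by (simp add: euclidean_representation)
    also have "\<dots> = (\<Sum>c\<in>Basis. (g b \<bullet> c) * (f c \<bullet> b))"
      by (simp add: linear_sum[OF that] linear_cmul[OF that] inner_sum_left)
    finally show "f (g b) \<bullet> b = (\<Sum>c\<in>Basis. (g b \<bullet> c) * (f c \<bullet> b))" .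
  qed
  show ?thesis
    unfolding *[OF assms(1)] *[OF assms(2)] by (subst sum.swap) (simp add: mult.commute)
qed

text \<open>The polynomial \<open>t^3 - t\<close> has the simple roots \<open>-1\<close>,
  \<open>0\<close>, \<open>1\<close>. The cubic identity replaces eigenbases by an equation that is
  easily transported by automorphisms and passes to limits.\<close>

lemma cube_iff_diagonalizable:
  fixes f :: "'g::euclidean_space \<Rightarrow> 'g"
  assumes f: "linear f"
  shows "diagonalizable f \<and> lin_spectrum f \<subseteq> {-1, 0, 1} \<longleftrightarrow> (\<forall>v. f (f (f v)) = f v)"
proof
  assume L: "diagonalizable f \<and> lin_spectrum f \<subseteq> {-1, 0, 1}"
  then obtain B where B: "independent B" "span B = UNIV" "\<forall>v\<in>B. \<exists>c. f v = c *\<^sub>R v"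
    unfolding diagonalizable_def by blast
  have lin: "linear (\<lambda>v. f (f (f v)))"
    using linear_compose[OF linear_compose[OF f f] f] by (simp add: o_def)
  have cube: "f (f (f v)) = f v" if vB: "v \<in> B" for v
  proof -
    obtain c where c: "f v = c *\<^sub>R v" using bspec[OF B(3) vB] by (rule exE)
    have "v \<noteq> 0" using vB B(1) dependent_zero by blast
    then have "c \<in> lin_spectrum f" using c unfolding lin_spectrum_def by blast
    then have "c \<in> {-1, 0, 1}" using L by blast
    then have "c * (c * c) = c" by auto
    then show ?thesis by (simp add: c linear_cmul[OF f])
  qed
  show "\<forall>v. f (f (f v)) = f v"
  proof
    fix v
    show "f (f (f v)) = f v"
      by (rule linear_eq_on_span[OF lin f cube]) (assumption, unfold B(2), rule UNIV_I)
  qed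
next
  assume R: "\<forall>v. f (f (f v)) = f v"
  let ?E = "{v. \<exists>c. f v = c *\<^sub>R v}"
  note fs = linear_add[OF f] linear_diff[OF f] linear_cmul[OF f]
  have "v \<in> span ?E" for v
  proof -
    have 1: "f (f v) + f v \<in> ?E" by (rule CollectI, rule exI[of _ 1]) (simp add: fs R)
    have 2: "f (f v) - f v \<in> ?E" by (rule CollectI, rule exI[of _ "-1"]) (simp add: fs R)
    have 3: "v - f (f v) \<in> ?E" by (rule CollectI, rule exI[of _ 0]) (simp add: fs R)
    \<comment> \<open>The Lagrange idempotents for the eigenvalues \<open>1\<close>,
      \<open>-1\<close> and \<open>0\<close>, applied to \<open>v\<close>.\<close>
    have "v = (1/2) *\<^sub>R (f (f v) + f v) + (1/2) *\<^sub>R (f (f v) - f v) + (v - f (f v))"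
      by (simp add: scaleR_add_right scaleR_diff_right flip: scaleR_add_left)
    also have "\<dots> \<in> span ?E" using 1 2 3 by (intro span_add span_scale span_base)
    finally show ?thesis .
  qed
  moreover obtain B where B: "B \<subseteq> ?E" "independent B" "?E \<subseteq> span B"
    using maximal_independent_subset by blast
  ultimately have "span B = UNIV" using span_minimal[OF B(3) subspace_span] by blast
  then have "diagonalizable f" unfolding diagonalizable_def using B by blast
  moreover have "c \<in> {-1, 0, 1}" if "v \<noteq> 0" "f v = c *\<^sub>R v" for c v
  proof -
    have "(c * c * c) *\<^sub>R v = c *\<^sub>R v" using R[rule_format, of v] that by (simp add: fs mult.assoc)
    then have "c * (c - 1) * (c + 1) = 0" using that(1) by (simp add: algebra_simps)
    then show ?thesis by auto
  qed
  ultimately show "diagonalizable f \<and> lin_spectrum f \<subseteq> {-1, 0, 1}"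
    by (auto simp: lin_spectrum_def)
qed

locale cartan_lie =
  fixes br :: "'g::euclidean_space \<Rightarrow> 'g \<Rightarrow> 'g" and \<theta> :: "'g \<Rightarrow> 'g"
  assumes lie: "lie_algebra br" and cartan: "cartan_involution br \<theta>"
begin

lemma br_bilinear: "bilinear br" using lie by (simp add: lie_algebra_def)

lemmas br_simps = bilinear_ladd[OF br_bilinear] bilinear_radd[OF br_bilinear]
  bilinear_lmul[OF br_bilinear] bilinear_rmul[OF br_bilinear]
  bilinear_lneg[OF br_bilinear] bilinear_rneg[OF br_bilinear]
  bilinear_lsub[OF br_bilinear] bilinear_rsub[OF br_bilinear]
  bilinear_lzero[OF br_bilinear] bilinear_rzero[OF br_bilinear]

lemma br_linear: "linear (br x)" using br_bilinear by (simp add: bilinear_def)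

lemma br_bounded_bilinear: "bounded_bilinear br"
  using br_bilinear bilinear_conv_bounded_bilinear by blast

lemma br_self: "br x x = 0" using lie by (simp add: lie_algebra_def)

lemma br_anti: "br y x = - br x y"
proof -
  have "br y x + br x y = 0"
    using br_self[of "x + y"] br_self[of x] br_self[of y] by (simp add: br_simps)
  then show ?thesis by (simp add: eq_neg_iff_add_eq_0)
qed

lemma br_jacobi: "br x (br y z) = br (br x y) z + br y (br x z)"
proof -
  have "br x (br y z) + br y (br z x) + br z (br x y) = 0" using lie by (simp add: lie_algebra_def)
  then show ?thesis unfolding br_anti[of z "br x y"] br_anti[of z x]
    by (simp add: br_simps algebra_simps)
qed

lemma \<theta>_linear: "linear \<theta>" and \<theta>_\<theta>: "\<theta> (\<theta> x) = x" and \<theta>_br: "\<theta> (br x y) = br (\<theta> x) (\<theta> y)"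
  using cartan by (auto simp: cartan_involution_def)

lemmas \<theta>_simps = linear_add[OF \<theta>_linear] linear_diff[OF \<theta>_linear] linear_cmul[OF \<theta>_linear]
  linear_neg[OF \<theta>_linear] linear_0[OF \<theta>_linear] \<theta>_\<theta> \<theta>_br

abbreviation B :: "'g \<Rightarrow> 'g \<Rightarrow> real" where "B \<equiv> killing br"

lemma killing_sym: "B x y = B y x"
  unfolding killing_def by (rule ltrace_commute) (rule br_linear)+

lemma killing_bilinear: "bilinear B"
proof -
  have "linear (\<lambda>y. B x y)" for x
    by (rule linearI)
      (simp_all add: killing_def ltrace_def br_simps inner_add_left sum.distrib sum_distrib_left)
  then show ?thesis using killing_sym by (simp add: bilinear_def)
qed

lemmas killing_simps = bilinear_ladd[OF killing_bilinear] bilinear_radd[OF killing_bilinear]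
  bilinear_lmul[OF killing_bilinear] bilinear_rmul[OF killing_bilinear]
  bilinear_lneg[OF killing_bilinear] bilinear_rneg[OF killing_bilinear]
  bilinear_lsub[OF killing_bilinear] bilinear_rsub[OF killing_bilinear]
  bilinear_lzero[OF killing_bilinear] bilinear_rzero[OF killing_bilinear]

lemma killing_invariant: "B (br x y) z = B x (br y z)"
proof -
  have tr: "ltrace (\<lambda>v. br x (br y (br z v))) = ltrace (\<lambda>v. br y (br z (br x v)))" for x y z
    using ltrace_commute[OF br_linear, of "br y \<circ> br z" x] linear_compose[OF br_linear br_linear]
    by (simp add: o_def)
  have *: "br (br x y) v = br x (br y v) - br y (br x v)" for x y v
    using br_jacobi[of x y v] by simp
  show ?thesis
    using tr[of y x z]
    by (simp add: killing_def ltrace_def o_def * br_simps inner_diff_left sum_subtractf)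
qed

section \<open>Automorphisms, and the inner product of the Cartan involution\<close>

definition lie_aut :: "('g \<Rightarrow> 'g) \<Rightarrow> bool" where
  "lie_aut \<phi> \<longleftrightarrow> linear \<phi> \<and> bij \<phi> \<and> (\<forall>x y. \<phi> (br x y) = br (\<phi> x) (\<phi> y))"

lemma lie_aut_\<theta>: "lie_aut \<theta>"
  unfolding lie_aut_def using \<theta>_linear \<theta>_br \<theta>_\<theta> by (auto intro!: o_bij[of \<theta>] simp: fun_eq_iff)

text \<open>Conjugation by \<open>\<phi>\<close> carries the adjoint operator of \<open>x\<close> to
  that of \<open>\<phi> x\<close>, and the trace is invariant under conjugation.\<close>

lemma killing_aut:
  assumes "lie_aut \<phi>" shows "B (\<phi> x) (\<phi> y) = B x y"
proof -
  have l: "linear \<phi>" "bij \<phi>" using assms by (auto simp: lie_aut_def)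
  obtain \<psi> where \<psi>: "linear \<psi>" "\<And>x. \<psi> (\<phi> x) = x"
    using linear_injective_left_inverse[OF l(1)] l(2) by (metis bij_is_inj comp_apply id_apply)
  have \<phi>\<psi>: "\<phi> (\<psi> v) = v" for v using \<psi>(2) l(2) by (metis bij_pointE)
  have "br (\<phi> x) v = \<phi> (br x (\<psi> v))" for x v using assms \<phi>\<psi> by (simp add: lie_aut_def)
  then have "B (\<phi> x) (\<phi> y) = ltrace ((\<phi> \<circ> (br x \<circ> br y)) \<circ> \<psi>)"
    by (simp add: killing_def o_def \<psi>(2))
  also have "\<dots> = ltrace (\<psi> \<circ> (\<phi> \<circ> (br x \<circ> br y)))"
    by (intro ltrace_commute linear_compose br_linear l \<psi>)
  also have "\<dots> = B x y" by (simp add: killing_def o_def \<psi>(2))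
  finally show ?thesis .
qed

lemma lie_aut_lin_exp: "lie_aut (lin_exp (br z))"
  unfolding lie_aut_def
  by (intro conjI allI linear_lin_exp bij_lin_exp lin_exp_derivation br_linear br_bilinear br_jacobi)

lemma lie_aut_inner: "\<phi> \<in> inner_auts br \<Longrightarrow> lie_aut \<phi>"
proof (induction rule: inner_auts.induct)
  case (exp_inn \<phi> y)
  then have "linear (lin_exp (br y) \<circ> \<phi>)" "bij (lin_exp (br y) \<circ> \<phi>)"
    using lie_aut_lin_exp[of y] unfolding lie_aut_def by (blast intro: linear_compose bij_comp)+
  then show ?case using exp_inn.IH lie_aut_lin_exp[of y] unfolding lie_aut_def by simp
qed (unfold lie_aut_def, intro conjI linear_id bij_id, simp)

lemma inner_auts_comp:
  "\<phi> \<in> inner_auts br \<Longrightarrow> \<psi> \<in> inner_auts br \<Longrightarrow> \<phi> \<circ> \<psi> \<in> inner_auts br"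
  by (induction rule: inner_auts.induct) (auto simp: comp_assoc intro: inner_auts.intros)

definition ip :: "'g \<Rightarrow> 'g \<Rightarrow> real" where "ip x y = - B x (\<theta> y)"

sublocale ip_space ip
proof
  show "bilinear ip"
    unfolding bilinear_def ip_def
    by (auto intro!: linearI simp: killing_simps \<theta>_simps)
  show "ip x y = ip y x" for x y
    using killing_aut[OF lie_aut_\<theta>, of "x" "\<theta> y"] by (simp add: ip_def \<theta>_\<theta> killing_sym)
  show "x \<noteq> 0 \<Longrightarrow> ip x x > 0" for x using cartan by (auto simp: ip_def cartan_involution_def)
qed

lemma ip_adjoint: "ip (br x u) w = - ip u (br (\<theta> x) w)"
  using killing_invariant[of u x "\<theta> w"] br_anti[of x u] by (simp add: ip_def \<theta>_simps killing_simps)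

lemma ip_p: "\<theta> y = - y \<Longrightarrow> ip x y = B x y"
  by (simp add: ip_def killing_simps)

lemma ad_p_symmetric: "\<theta> x = - x \<Longrightarrow> ip (br x u) w = ip u (br x w)"
  by (simp add: ip_adjoint br_simps ip_simps)

text \<open>The Killing form vanishes on central elements, whereas \<open>ip\<close> is definite.
  Thus the adjoint representation is faithful, and identities between elements may be checked on
  operators.\<close>

lemma centerless: assumes "\<And>v. br x v = 0" shows "x = 0"
proof -
  have "ip x x = 0" by (simp add: ip_def killing_def ltrace_def o_def assms)
  then show ?thesis by (simp add: ip_eq_0)
qed

section \<open>Euler elements: closedness and representatives in p\<close>

lemma euler_iff: "euler_elem br x \<longleftrightarrow> x \<noteq> 0 \<and> (\<forall>v. br x (br x (br x v)) = br x v)"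
  using cube_iff_diagonalizable[OF br_linear, of x] by (auto simp: euler_elem_def)

lemma euler_aut:
  assumes "lie_aut \<phi>" "euler_elem br x" shows "euler_elem br (\<phi> x)"
proof -
  have l: "linear \<phi>" "bij \<phi>" "\<And>x y. br (\<phi> x) (\<phi> y) = \<phi> (br x y)" using assms(1) by (auto simp: lie_aut_def)
  have "br (\<phi> x) (br (\<phi> x) (br (\<phi> x) v)) = br (\<phi> x) v" for v
  proof -
    obtain w where "v = \<phi> w" using l(2) by (metis bij_pointE)
    then show ?thesis using assms(2) by (simp add: l(3) euler_iff)
  qed
  moreover have "\<phi> x \<noteq> 0" using assms(2) l by (metis bij_is_inj euler_iff injD linear_0)
  ultimately show ?thesis by (simp add: euler_iff)
qed

text \<open>The cubic equation is a closed condition, but it also holds at \<open>0\<close>. Other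
  solutions stay away from \<open>0\<close>: the square of the adjoint operator fixes a nonzero
  vector \<open>u\<close>, which bounds the norm from below by \<open>1 / K\<close>.\<close>

lemma euler_closed: "closed {x. euler_elem br x}"
proof -
  obtain K where K: "K > 0" "\<And>x y. norm (br x y) \<le> norm x * norm y * K"
    using bounded_bilinear.pos_bounded[OF br_bounded_bilinear] by blast
  have *: "norm y \<ge> 1 / K" if "euler_elem br y" for y
  proof -
    have y: "y \<noteq> 0" "\<And>v. br y (br y (br y v)) = br y v" using that by (auto simp: euler_iff)
    obtain v where v: "br y v \<noteq> 0" using centerless y(1) by blast
    define u where "u = br y (br y v)"
    have "br y u = br y v" "br y (br y u) = u" by (simp_all add: u_def y(2))
    with v have u: "u \<noteq> 0" "br y (br y u) = u" by (auto simp: br_simps)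
    have "norm u \<le> norm y * norm (br y u) * K" using K(2)[of y "br y u"] u by simp
    also have "\<dots> \<le> norm y * (norm y * norm u * K) * K"
      using K by (intro mult_right_mono mult_left_mono) auto
    also have "\<dots> = (norm y * K)\<^sup>2 * norm u" by (simp add: power2_eq_square)
    finally have "1\<^sup>2 \<le> (norm y * K)\<^sup>2" using u(1) by simp
    then have "1 \<le> norm y * K" by (rule power2_le_imp_le) (use K in auto)
    then show ?thesis using K(1) by (simp add: field_simps)
  qed
  have "{x. euler_elem br x} = {x. norm x \<ge> 1 / K} \<inter> {x. \<forall>v. br x (br x (br x v)) = br x v}"
  proof (intro equalityI subsetI)
    fix x assume "x \<in> {x. norm x \<ge> 1 / K} \<inter> {x. \<forall>v. br x (br x (br x v)) = br x v}"
    moreover from this have "norm x > 0" using K(1) by (auto intro: less_le_trans[of 0 "1 / K"])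
    ultimately show "x \<in> {x. euler_elem br x}" by (auto simp: euler_iff)
  qed (use * in \<open>auto simp: euler_iff\<close>)
  moreover have "closed {x. \<forall>v. br x (br x (br x v)) = br x v}"
    by (intro closed_Collect_all closed_Collect_eq
        bounded_bilinear.continuous_on[OF br_bounded_bilinear] continuous_intros)
  moreover have "closed {x::'g. norm x \<ge> 1 / K}" by (intro closed_Collect_le continuous_intros)
  ultimately show ?thesis by auto
qed

lemma exp_curve:
  "lin_exp (br (t *\<^sub>R z)) = lin_exp (\<lambda>x. t *\<^sub>R br z x)"
  by (rule arg_cong[of _ _ lin_exp]) (simp add: br_simps fun_eq_iff)

lemma exp_curve_deriv:
  "((\<lambda>t. lin_exp (br (t *\<^sub>R z)) y) has_vector_derivative br z (lin_exp (br (t *\<^sub>R z)) y)) (at t)"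
  unfolding exp_curve by (rule lin_exp_deriv[OF br_linear])

lemma exp_curve_0: "lin_exp (br (0 *\<^sub>R z)) y = y"
  unfolding exp_curve by (rule lin_exp_zero[OF br_linear])

lemma exp_curve_stationary:
  assumes "\<And>t. ip (y - a) (y - a) \<le> ip (lin_exp (br (t *\<^sub>R z)) y - a) (lin_exp (br (t *\<^sub>R z)) y - a)"
  shows "ip (br z y) (y - a) = 0"
proof -
  have "ip (br z y) (lin_exp (br (0 *\<^sub>R z)) y - a) = 0"
  proof (rule ip_stationary[where u = "\<lambda>t. lin_exp (br (t *\<^sub>R z)) y"])
    show "((\<lambda>t. lin_exp (br (t *\<^sub>R z)) y) has_vector_derivative br z y) (at 0)"
      using exp_curve_deriv[of z y 0] by (simp only: exp_curve_0)
  qed (simp only: exp_curve_0 assms)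
  then show ?thesis by (simp only: exp_curve_0)
qed

lemma \<theta>_lin_exp: "\<theta> (lin_exp (br z) y) = lin_exp (br (\<theta> z)) (\<theta> y)"
proof -
  let ?u = "\<lambda>t::real. \<theta> (lin_exp (br (t *\<^sub>R z)) y)"
  have "(?u has_vector_derivative br (\<theta> z) (?u t)) (at t)" for t
    unfolding \<theta>_br[symmetric]
    using \<theta>_linear linear_conv_bounded_linear
    by (intro bounded_linear.has_vector_derivative[OF _ exp_curve_deriv]) auto
  from lin_exp_unique[OF br_linear this] show ?thesis
    by (simp add: exp_curve_0 del: scaleR_zero_left)
qed

text \<open>An Euler element of minimal norm commutes with its image under \<open>\<theta>\<close>, so its adjoint
  operator is normal with real spectrum, hence symmetric.\<close>
lemma euler_in_p:
  assumes "euler_elem br x"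
  obtains y where "euler_elem br y" "\<theta> y = - y"
proof -
  have "\<exists>y\<in>{x. euler_elem br x}. \<forall>z\<in>{x. euler_elem br x}. ip (y - 0) (y - 0) \<le> ip (z - 0) (z - 0)"
    using assms by (intro ip_closest euler_closed) auto
  then obtain y where "y \<in> {x. euler_elem br x}" "\<forall>z\<in>{x. euler_elem br x}. ip (y - 0) (y - 0) \<le> ip (z - 0) (z - 0)"
    by (rule bexE)
  then have y: "euler_elem br y" "\<And>z. euler_elem br z \<Longrightarrow> ip (y - 0) (y - 0) \<le> ip (z - 0) (z - 0)"
    by auto
  have "ip (br z y) (y - 0) = 0" for z
    by (rule exp_curve_stationary) (rule y(2)[OF euler_aut[OF lie_aut_lin_exp y(1)]])
  then have "ip (br z y) y = 0" for z by simp
  moreover have "ip (br z y) y = ip z (br (\<theta> y) y)" for z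
    using killing_invariant[of z y "\<theta> y"] by (simp add: ip_def \<theta>_simps)
  \<comment> \<open>The direction \<open>z\<close> is arbitrary, so it may be taken to be
    \<open>br (\<theta> y) y\<close>.\<close>
  ultimately have "ip (br (\<theta> y) y) (br (\<theta> y) y) = 0" by metis
  then have c: "br (\<theta> y) y = 0" by (simp add: ip_eq_0)
  have comm: "br y (br (\<theta> y) v) = br (\<theta> y) (br y v)" for v
    using br_jacobi[of "\<theta> y" y v] c by (simp add: br_simps)
  \<comment> \<open>For \<open>ip\<close>, the adjoint of \<open>br y\<close> is
    \<open>- br (\<theta> y)\<close>. A normal operator and its adjoint share eigenvectors, with the
    same eigenvalue as it is real: the squared norm of the difference expands to
    \<open>0\<close>.\<close>
  have eig: "- br (\<theta> y) v = a *\<^sub>R v" if v: "br y v = a *\<^sub>R v" for v a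
  proof -
    let ?g = "- br (\<theta> y) v"
    have 1: "ip ?g v = a * ip v v"
      using ip_adjoint[of y v v] ip_sym[of "br (\<theta> y) v" v] by (simp add: v ip_simps)
    have "ip ?g ?g = ip (br y ?g) v" using ip_adjoint[of y ?g v] by (simp add: ip_simps)
    also have "br y ?g = a *\<^sub>R ?g" using comm[of v] by (simp add: br_simps v)
    finally have 2: "ip ?g ?g = a * ip ?g v" by (simp add: ip_simps)
    have "ip (?g - a *\<^sub>R v) (?g - a *\<^sub>R v) = ip ?g ?g - 2 * a * ip ?g v + a * a * ip v v"
      using ip_sym[of v "br (\<theta> y) v"] by (simp add: ip_simps algebra_simps)
    also have "\<dots> = 0" unfolding 2 1 by simp
    finally show ?thesis by (simp add: ip_eq_0)
  qed
  obtain E where E: "span E = UNIV" "\<forall>v\<in>E. \<exists>a. br y v = a *\<^sub>R v"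
    using y(1) unfolding euler_elem_def diagonalizable_def by blast
  have hE: "- br (\<theta> y) x = br y x" if x: "x \<in> E" for x
  proof -
    obtain a where a: "br y x = a *\<^sub>R x" using bspec[OF E(2) x] by (rule exE)
    show ?thesis unfolding eig[OF a] a ..
  qed
  have h: "- br (\<theta> y) v = br y v" for v
    by (rule linear_eq_on_span[OF linear_compose_neg[OF br_linear] br_linear hE]) (assumption, unfold E(1), rule UNIV_I)
  have "br (y + \<theta> y) v = 0" for v
    by (simp add: br_simps flip: h)
  then have "y + \<theta> y = 0" by (rule centerless)
  then show thesis using that[of y] y(1) by (simp add: add_eq_0_iff)
qed

text \<open>The element \<open>z = br y a\<close> is fixed by \<open>\<theta>\<close>, so its flow
  keeps \<open>y\<close> among the competitors; stationarity in this direction says that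
  \<open>ip z z = 0\<close>.\<close>

lemma euler_closest_in_p:
  assumes "euler_elem br x" and a: "\<theta> a = - a"
  obtains y where "euler_elem br y" "\<theta> y = - y" "br y a = 0"
    "\<And>z. euler_elem br z \<Longrightarrow> \<theta> z = - z \<Longrightarrow> ip (y - a) (y - a) \<le> ip (z - a) (z - a)"
proof -
  let ?E = "{x. euler_elem br x} \<inter> {x. \<theta> x = - x}"
  have "continuous_on UNIV \<theta>" using \<theta>_linear linear_continuous_on linear_conv_bounded_linear by blast
  then have "closed ?E" by (intro closed_Int euler_closed closed_Collect_eq continuous_intros)
  moreover obtain x' where "euler_elem br x'" "\<theta> x' = - x'" by (rule euler_in_p[OF assms(1)])
  ultimately have "\<exists>y\<in>?E. \<forall>z\<in>?E. ip (y - a) (y - a) \<le> ip (z - a) (z - a)"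
    by (intro ip_closest) auto
  then obtain y where y: "y \<in> ?E" "\<forall>z\<in>?E. ip (y - a) (y - a) \<le> ip (z - a) (z - a)"
    by (rule bexE)
  define z where "z = br y a"
  have z: "\<theta> z = z" using y a by (simp add: z_def \<theta>_simps br_simps)
  have "ip (br z y) (y - a) = 0"
  proof (rule exp_curve_stationary)
    fix t :: real
    have "\<theta> (lin_exp (br (t *\<^sub>R z)) y) = - lin_exp (br (t *\<^sub>R z)) y"
      using y(1) by (simp add: \<theta>_lin_exp \<theta>_simps z linear_neg[OF linear_lin_exp[OF br_linear]])
    then show "ip (y - a) (y - a) \<le> ip (lin_exp (br (t *\<^sub>R z)) y - a) (lin_exp (br (t *\<^sub>R z)) y - a)"
      using y(1) by (intro y(2)[rule_format]) (simp add: euler_aut[OF lie_aut_lin_exp])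
  qed
  moreover have "ip (br z y) y = 0"
    using y(1) by (simp add: ip_p killing_invariant br_self killing_simps)
  moreover have "ip (br z y) a = - ip z z"
    using a z by (simp add: ip_p killing_invariant z_def[symmetric]) (simp add: ip_def)
  ultimately have "ip z z = 0" by (simp add: ip_simps)
  then have "z = 0" by (simp add: ip_eq_0)
  then show thesis using that[of y] y by (auto simp: z_def)
qed

section \<open>Iterated derivations of a form, as an action of the enveloping algebra\<close>

definition word :: "nat \<Rightarrow> 'g list \<Rightarrow> ((nat \<Rightarrow> 'g) \<Rightarrow> real) \<Rightarrow> (nat \<Rightarrow> 'g) \<Rightarrow> real" where
  "word d ys D = foldr (\<lambda>y. der d (br y)) ys D"

lemma word_Nil: "word d [] D = D" and word_Cons: "word d (y # ys) D = der d (br y) (word d ys D)"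
  and word_append: "word d (xs @ ys) D = word d xs (word d ys D)"
  by (simp_all add: word_def)

lemma word_add: "word d ys (\<lambda>x. G x + G' x) = (\<lambda>x. word d ys G x + word d ys G' x)"
  by (induction ys) (simp_all add: word_Nil word_Cons der_add)

lemma word_scale: "word d ys (\<lambda>x. c * G x) = (\<lambda>x. c * word d ys G x)"
  by (induction ys) (simp_all add: word_Nil word_Cons der_scale)

lemma word_multilin: "multilin d D \<Longrightarrow> multilin d (word d ys D)"
  by (induction ys) (simp_all add: word_Nil word_Cons multilin_der br_linear)

lemma word_alternating: "multilin d D \<Longrightarrow> alternating d D \<Longrightarrow> alternating d (word d ys D)"
  by (induction ys) (simp_all add: word_Nil word_Cons alternating_der word_multilin)

text \<open>The last letter of a word acts on \<open>D\<close> itself, and there \<open>v\<close> is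
  a scalar. Moving \<open>v\<close> to the end past a letter costs a word with a commutator in place
  of two letters, which is short enough for \<open>van\<close>.\<close>

lemma word_move:
  assumes D: "multilin d D" and v: "der d (br v) D = (\<lambda>x. c * D x)"
    and van: "\<And>ys. length ys = length xs + length zs \<Longrightarrow> word d ys D e = 0"
  shows "word d (xs @ v # zs) D e = 0"
  using van
proof (induction zs arbitrary: xs)
  case Nil
  then show ?case by (simp add: word_append word_Cons word_Nil v word_scale)
next
  case (Cons z zs)
  let ?X = "word d zs D"
  have "(\<lambda>u. br z (br v u) - br v (br z u)) = br (br z v)"
    by (rule ext) (simp add: br_jacobi[of z v])
  then have "der d (br v) (der d (br z) ?X)
      = (\<lambda>x. der d (br z) (der d (br v) ?X) x + der d (br (br z v)) ?X x)"
    using der_commute[OF word_multilin[OF D], of "br v" "br z" zs] by (simp add: fun_eq_iff)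
  then have "word d (xs @ v # z # zs) D e
      = word d ((xs @ [z]) @ v # zs) D e + word d (xs @ br z v # zs) D e"
    by (simp add: word_append word_Cons word_Nil word_add)
  also have "\<dots> = 0" using Cons.IH[of "xs @ [z]"] Cons.prems by simp
  finally show ?case .
qed

text \<open>The head of a word acts directly on the vectors \<open>e\<close>. Of its two parts,
  \<open>u\<close> preserves the vanishing at \<open>e\<close> of the shorter word, and
  \<open>v\<close> can be moved to \<open>D\<close>. This takes the place of a
  Poincare-Birkhoff-Witt factorization.\<close>

lemma words_vanish:
  assumes D: "multilin d D" "alternating d D" "D e = 0"
    and P: "\<And>u G. P u \<Longrightarrow> multilin d G \<Longrightarrow> alternating d G \<Longrightarrow> G e = 0 \<Longrightarrow> der d (br u) G e = 0"
    and Q: "\<And>v. Q v \<Longrightarrow> \<exists>c. der d (br v) D = (\<lambda>x. c * D x)"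
    and PQ: "\<And>y. \<exists>u v. y = u + v \<and> P u \<and> Q v"
  shows "word d ys D e = 0"
proof (induction "length ys" arbitrary: ys)
  case 0
  then show ?case by (simp add: word_Nil D)
next
  case (Suc m)
  then obtain y zs where ys: "ys = y # zs" "length zs = m" by (cases ys) auto
  obtain u v where uv: "y = u + v" "P u" "Q v" using PQ by blast
  let ?G = "word d zs D"
  have G: "multilin d ?G" "alternating d ?G" "?G e = 0"
    using D ys(2) Suc.hyps(1) by (auto intro: word_multilin word_alternating)
  have "der d (br y) ?G e = der d (br u) ?G e + der d (br v) ?G e"
    by (simp add: der_def uv(1) br_simps linear_add[OF multilin_linear[OF G(1)]] sum.distrib)
  moreover have "der d (br u) ?G e = 0" by (rule P[OF uv(2) G])
  moreover have "der d (br v) ?G e = 0"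
  proof -
    obtain c where "der d (br v) D = (\<lambda>x. c * D x)" using Q[OF uv(3)] by blast
    from word_move[OF D(1) this, of "[]" zs e] show ?thesis
      using Suc.hyps(1) ys(2) by (simp add: word_Cons)
  qed
  ultimately show ?case by (simp add: ys(1) word_Cons)
qed

text \<open>The Taylor coefficients of each new exponential are again words; for this reason the
  induction carries all words and not just \<open>D\<close>.\<close>

lemma words_vanish_inner:
  assumes "\<phi> \<in> inner_auts br" and D: "multilin d D" and van: "\<And>ys. word d ys D e = 0"
  shows "word d ys D (\<lambda>i. \<phi> (e i)) = 0"
  using assms(1)
proof (induction arbitrary: ys)
  case id_inn
  then show ?case using van by simp
next
  case (exp_inn \<phi> y)
  have "word d ys D (\<lambda>i. lin_exp (br y) (\<phi> (e i))) = 0"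
  proof (rule multilin_exp_vanish[OF word_multilin[OF D] br_linear])
    fix k
    have "(der d (br y) ^^ k) (word d ys D) = word d (replicate k y @ ys) D"
      by (induction k) (simp_all add: word_Cons)
    then show "(der d (br y) ^^ k) (word d ys D) (\<lambda>i. \<phi> (e i)) = 0" using exp_inn.IH by simp
  qed
  then show ?case by simp
qed

section \<open>Parabolic subalgebras of an Euler element\<close>

definition pos_proj :: "'g \<Rightarrow> 'g \<Rightarrow> 'g" where
  "pos_proj h x = (1/2) *\<^sub>R (br h (br h x) + br h x)"

lemma pos_proj_linear: "linear (pos_proj h)"
  by (rule linearI) (simp_all add: pos_proj_def br_simps algebra_simps)

lemma euler_cube: "euler_elem br h \<Longrightarrow> br h (br h (br h x)) = br h x"
  by (simp add: euler_iff)

lemma euler_eigenvalue_two: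
  assumes "euler_elem br h" "br h x = c *\<^sub>R x" "c = 2 \<or> c = -2" shows "x = 0"
proof -
  have "(c * (c * c)) *\<^sub>R x = c *\<^sub>R x" using euler_cube[OF assms(1), of x] by (simp add: assms(2) br_simps)
  then show ?thesis using assms(3) by (auto simp: scaleR_cancel_right)
qed

text \<open>For Euler \<open>h\<close> these elements include the parabolic subalgebra of the
  eigenvalues \<open>0\<close> and \<open>1\<close>, and \<open>preserves_nonpos\<close> includes
  the opposite one. Only their effect on the \<open>1\<close>-eigenspace and on the kernel of the
  projection matters in the exterior power.\<close>

definition preserves_pos :: "'g \<Rightarrow> 'g \<Rightarrow> bool" where
  "preserves_pos h u \<longleftrightarrow> (\<forall>w. br h w = w \<longrightarrow> br h (br u w) = br u w)"

definition preserves_nonpos :: "'g \<Rightarrow> 'g \<Rightarrow> bool" where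
  "preserves_nonpos h v \<longleftrightarrow> (\<forall>w. pos_proj h w = 0 \<longrightarrow> pos_proj h (br v w) = 0)"

text \<open>Eigenvalues add under the bracket, and \<open>2\<close> does not occur for an Euler
  element.\<close>

lemma preserves_posI:
  assumes "euler_elem br h" "br h u = c *\<^sub>R u" "c = 0 \<or> c = 1" shows "preserves_pos h u"
  unfolding preserves_pos_def
proof (intro allI impI)
  fix w assume w: "br h w = w"
  have *: "br h (br u w) = (c + 1) *\<^sub>R br u w"
    using br_jacobi[of h u w] assms(2) w by (simp add: br_simps scaleR_add_left)
  show "br h (br u w) = br u w"
  proof (cases "c = 0")
    case False
    then have "br u w = 0" using euler_eigenvalue_two[OF assms(1) *] assms(3) by simp
    then show ?thesis by (simp add: br_simps)
  qed (use * in simp)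
qed

lemma preserves_nonposI:
  assumes "euler_elem br h" "br h v = c *\<^sub>R v" "c = 0 \<or> c = -1" shows "preserves_nonpos h v"
  unfolding preserves_nonpos_def
proof (intro allI impI)
  fix w assume "pos_proj h w = 0"
  then have w: "br h (br h w) = - br h w" by (simp add: pos_proj_def eq_neg_iff_add_eq_0)
  have X: "br h (br v w) = c *\<^sub>R br v w + br v (br h w)"
    and Y: "br h (br v (br h w)) = c *\<^sub>R br v (br h w) - br v (br h w)"
    using br_jacobi[of h v] assms(2) w by (simp_all add: br_simps)
  show "pos_proj h (br v w) = 0"
  proof (cases "c = 0")
    case True
    then show ?thesis using X Y by (simp add: pos_proj_def)
  next
    case False
    then have c: "c = -1" using assms(3) by simp
    have "br h (br v (br h w)) = (-2) *\<^sub>R br v (br h w)" using Y by (simp add: c) (simp add: scaleR_2)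
    then have "br v (br h w) = 0" using euler_eigenvalue_two[OF assms(1)] by blast
    then show ?thesis using X by (simp add: pos_proj_def c br_simps)
  qed
qed

end

section \<open>Restricted roots\<close>

locale restricted = cartan_lie br \<theta> for br :: "'g::euclidean_space \<Rightarrow> 'g \<Rightarrow> 'g" and \<theta> +
  fixes A :: "'g set" and \<alpha> :: "nat \<Rightarrow> 'g \<Rightarrow> real" and n :: nat and a :: "nat \<Rightarrow> nat \<Rightarrow> int"
  assumes max_abelian: "max_abelian_in_p br \<theta> A"
    and simple_roots: "simple_system br A \<alpha> n"
    and cartan_matrix: "i \<in> {1..n} \<Longrightarrow> j \<in> {1..n} \<Longrightarrow> cartan_int br A (\<alpha> i) (\<alpha> j) = of_int (a i j)"
begin

lemma A_subspace: "subspace A" and A_comm: "x \<in> A \<Longrightarrow> y \<in> A \<Longrightarrow> br x y = 0"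
  and A_p: "x \<in> A \<Longrightarrow> \<theta> x = - x"
  using max_abelian by (auto simp: max_abelian_in_p_def abelian_sub_def ppart_def)

text \<open>The sum of \<open>A\<close> and the line through \<open>y\<close> is an abelian subspace
  of p that contains \<open>A\<close>, hence equals \<open>A\<close>.\<close>

lemma A_maximal:
  assumes y: "\<theta> y = - y" "\<And>h. h \<in> A \<Longrightarrow> br h y = 0"
  shows "y \<in> A"
proof -
  let ?C = "{h + c *\<^sub>R y | h c. h \<in> A}"
  have "span (insert y A) = ?C"
    unfolding span_insert span_eq_iff[THEN iffD2, OF A_subspace]
  proof (intro equalityI subsetI)
    fix x assume "x \<in> {x. \<exists>k. x - k *\<^sub>R y \<in> A}"
    then obtain k where "x - k *\<^sub>R y \<in> A" by blast
    then show "x \<in> ?C" by (intro CollectI exI[of _ "x - k *\<^sub>R y"] exI[of _ k]) simp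
  next
    fix x assume "x \<in> ?C"
    then obtain h k where "x = h + k *\<^sub>R y" "h \<in> A" by blast
    then show "x \<in> {x. \<exists>k. x - k *\<^sub>R y \<in> A}" by (intro CollectI exI[of _ k]) simp
  qed
  then have "subspace ?C" by (metis subspace_span)
  moreover have "br u v = 0" if "u \<in> ?C" "v \<in> ?C" for u v
  proof -
    obtain h c h' c' where uv: "u = h + c *\<^sub>R y" "v = h' + c' *\<^sub>R y" "h \<in> A" "h' \<in> A"
      using \<open>u \<in> ?C\<close> \<open>v \<in> ?C\<close> by blast
    then show ?thesis using br_anti[of h' y] by (simp add: br_simps A_comm y br_self)
  qed
  ultimately have "abelian_sub br ?C" by (simp add: abelian_sub_def)
  moreover have sub: "A \<subseteq> ?C"
  proof
    fix x assume "x \<in> A"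
    then show "x \<in> ?C" by (intro CollectI exI[of _ x] exI[of _ 0]) simp
  qed
  moreover have "?C \<subseteq> ppart \<theta>" by (auto simp: ppart_def \<theta>_simps A_p y)
  ultimately have "?C = A" using max_abelian unfolding max_abelian_in_p_def by blast
  moreover have "y \<in> ?C" using subspace_0[OF A_subspace] by (intro CollectI exI[of _ 0] exI[of _ 1]) simp
  ultimately show ?thesis by blast
qed

lemma n_dim: "n = dim A"
  and \<alpha>_root: "i \<in> {1..n} \<Longrightarrow> \<alpha> i \<in> restricted_roots br A"
  and \<alpha>_indep: "\<And>c::nat \<Rightarrow> real. \<lbrakk>\<And>h. h \<in> A \<Longrightarrow> (\<Sum>i=1..n. c i * \<alpha> i h) = 0; i \<in> {1..n}\<rbrakk> \<Longrightarrow> c i = 0"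
  using simple_roots unfolding simple_system_def by blast+

lemma \<alpha>_dual: "i \<in> {1..n} \<Longrightarrow> \<alpha> i \<in> dual_on A"
  using \<alpha>_root by (simp add: restricted_roots_def)

lemma \<alpha>_add: "i \<in> {1..n} \<Longrightarrow> x \<in> A \<Longrightarrow> y \<in> A \<Longrightarrow> \<alpha> i (x + y) = \<alpha> i x + \<alpha> i y"
  and \<alpha>_scale: "i \<in> {1..n} \<Longrightarrow> x \<in> A \<Longrightarrow> \<alpha> i (c *\<^sub>R x) = c * \<alpha> i x"
  using \<alpha>_dual by (auto simp: dual_on_def)

lemma \<alpha>_diff: "i \<in> {1..n} \<Longrightarrow> x \<in> A \<Longrightarrow> y \<in> A \<Longrightarrow> \<alpha> i (x - y) = \<alpha> i x - \<alpha> i y"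
  using \<alpha>_add[of i x "(-1) *\<^sub>R y"] \<alpha>_scale[of i y "-1"] subspace_scale[OF A_subspace, of y "-1"] by simp

lemma \<alpha>_zero: "i \<in> {1..n} \<Longrightarrow> \<alpha> i 0 = 0"
  using \<alpha>_scale[of i 0 0] subspace_0[OF A_subspace] by simp

lemma \<alpha>_sum:
  assumes "i \<in> {1..n}" "finite S" "\<And>j. j \<in> S \<Longrightarrow> y j \<in> A"
  shows "\<alpha> i (\<Sum>j\<in>S. y j) = (\<Sum>j\<in>S. \<alpha> i (y j))"
  using assms(2,3)
  by (induction S rule: finite_induct)
    (simp_all add: \<alpha>_zero[OF assms(1)] \<alpha>_add[OF assms(1)] subspace_sum[OF A_subspace])

section \<open>Roots as integer coefficient vectors\<close>

definition val :: "(nat \<Rightarrow> int) \<Rightarrow> 'g \<Rightarrow> real" where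
  "val k h = (\<Sum>i=1..n. of_int (k i) * \<alpha> i h)"

text \<open>Unlike in \<open>restricted_roots\<close>, the zero functional is allowed and the values
  of \<open>b\<close> outside \<open>A\<close> do not matter.\<close>

definition is_weight :: "('g \<Rightarrow> real) \<Rightarrow> bool" where
  "is_weight b \<longleftrightarrow> (\<exists>v. v \<noteq> 0 \<and> (\<forall>h\<in>A. br h v = b h *\<^sub>R v))"

definition is_root :: "(nat \<Rightarrow> int) \<Rightarrow> bool" where
  "is_root k \<longleftrightarrow> (\<exists>i\<in>{1..n}. k i \<noteq> 0) \<and> is_weight (val k)"

lemma is_weight_cong: "(\<And>h. h \<in> A \<Longrightarrow> b h = b' h) \<Longrightarrow> is_weight b \<longleftrightarrow> is_weight b'"
  by (simp add: is_weight_def)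

text \<open>A common eigenvector forces its eigenvalue to depend linearly on \<open>h\<close>; the
  cut-off outside \<open>A\<close> produces the normal form required by
  \<open>dual_on\<close>.\<close>

lemma is_weight_restricted_root:
  assumes "is_weight b" "h \<in> A" "b h \<noteq> 0"
  shows "(\<lambda>h. if h \<in> A then b h else 0) \<in> restricted_roots br A"
proof -
  obtain v where v: "v \<noteq> 0" "\<And>h. h \<in> A \<Longrightarrow> br h v = b h *\<^sub>R v"
    using assms(1) by (auto simp: is_weight_def)
  have "b (x + y) = b x + b y" if "x \<in> A" "y \<in> A" for x y
  proof -
    have "b (x + y) *\<^sub>R v = (b x + b y) *\<^sub>R v"
      using v(2)[of "x + y"] v(2)[of x] v(2)[of y] that A_subspace
      by (simp add: br_simps subspace_add scaleR_add_left)
    then show ?thesis using v(1) by (simp only: scaleR_cancel_right) simp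
  qed
  moreover have "b (c *\<^sub>R x) = c * b x" if "x \<in> A" for x c
  proof -
    have "b (c *\<^sub>R x) *\<^sub>R v = (c * b x) *\<^sub>R v"
      using v(2)[of "c *\<^sub>R x"] v(2)[of x] that A_subspace
      by (simp add: br_simps subspace_scale del: scaleR_cancel_right)
    then show ?thesis using v(1) by (simp only: scaleR_cancel_right) simp
  qed
  ultimately have "(\<lambda>h. if h \<in> A then b h else 0) \<in> dual_on A"
    using A_subspace by (auto simp: dual_on_def subspace_add subspace_scale)
  moreover have "\<forall>h\<in>A. br h v = (if h \<in> A then b h else 0) *\<^sub>R v" using v(2) by simp
  ultimately show ?thesis unfolding restricted_roots_def using assms(2,3) v(1) by auto
qed

lemma restricted_root_is_root:
  assumes "\<beta> \<in> restricted_roots br A"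
  obtains k where "is_root k" "\<And>h. h \<in> A \<Longrightarrow> \<beta> h = val k h"
    "(\<forall>i\<in>{1..n}. k i \<ge> 0) \<or> (\<forall>i\<in>{1..n}. k i \<le> 0)"
proof -
  obtain k :: "nat \<Rightarrow> int" where k: "(\<forall>i\<in>{1..n}. k i \<ge> 0) \<or> (\<forall>i\<in>{1..n}. k i \<le> 0)"
      "\<forall>h\<in>A. \<beta> h = (\<Sum>i=1..n. of_int (k i) * \<alpha> i h)"
    using simple_roots assms unfolding simple_system_def by blast
  obtain h v where hv: "h \<in> A" "\<beta> h \<noteq> 0" "v \<noteq> 0" "\<forall>h\<in>A. br h v = \<beta> h *\<^sub>R v"
    using assms by (auto simp: restricted_roots_def)
  have "\<exists>i\<in>{1..n}. k i \<noteq> 0"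
  proof (rule ccontr)
    assume "\<not> (\<exists>i\<in>{1..n}. k i \<noteq> 0)"
    then have "\<beta> h = 0" using k(2) hv(1) by simp
    then show False using hv(2) by simp
  qed
  moreover have "is_weight (val k)"
    unfolding is_weight_def val_def using hv(3,4) k(2) by (intro exI[of _ v]) simp
  ultimately have "is_root k" by (simp add: is_root_def)
  then show thesis using that k by (simp add: val_def)
qed

lemma val_unique:
  assumes "\<And>h. h \<in> A \<Longrightarrow> val k h = val k' h" "i \<in> {1..n}"
  shows "k i = k' i"
proof -
  have "real_of_int (k i) - real_of_int (k' i) = 0"
  proof (rule \<alpha>_indep[of "\<lambda>i. real_of_int (k i) - real_of_int (k' i)", OF _ assms(2)])
    fix h assume "h \<in> A"
    then show "(\<Sum>i=1..n. (real_of_int (k i) - real_of_int (k' i)) * \<alpha> i h) = 0"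
      using assms(1)[of h] by (simp add: val_def left_diff_distrib sum_subtractf)
  qed
  then show ?thesis by simp
qed

lemma weight_cases:
  assumes "is_weight b"
  obtains "\<And>h. h \<in> A \<Longrightarrow> b h = 0" | k where "is_root k" "\<And>h. h \<in> A \<Longrightarrow> b h = val k h"
proof (cases "\<forall>h\<in>A. b h = 0")
  case False
  then obtain h where "h \<in> A" "b h \<noteq> 0" by blast
  from restricted_root_is_root[OF is_weight_restricted_root[OF assms this]]
  obtain k where "is_root k" "\<And>h. h \<in> A \<Longrightarrow> (if h \<in> A then b h else 0) = val k h" by metis
  then show thesis using that(2)[of k] by simp
qed (use that in blast)

lemma root_nonzero:
  assumes "is_root k" obtains h where "h \<in> A" "val k h \<noteq> 0"
proof -
  obtain i where i: "i \<in> {1..n}" "k i \<noteq> 0" using assms by (auto simp: is_root_def)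
  have "\<not> (\<forall>h\<in>A. val k h = 0)"
  proof
    assume "\<forall>h\<in>A. val k h = 0"
    then have "k i = (\<lambda>_. 0) i" by (intro val_unique i) (simp add: val_def)
    then show False using i by simp
  qed
  then show thesis using that by blast
qed

lemma root_sign:
  assumes "is_root k" shows "(\<forall>i\<in>{1..n}. k i \<ge> 0) \<or> (\<forall>i\<in>{1..n}. k i \<le> 0)"
proof -
  obtain h where h: "h \<in> A" "val k h \<noteq> 0" using root_nonzero[OF assms] .
  have "is_weight (val k)" using assms by (simp add: is_root_def)
  from restricted_root_is_root[OF is_weight_restricted_root[OF this h]]
  obtain k' where k': "\<And>h. h \<in> A \<Longrightarrow> (if h \<in> A then val k h else 0) = val k' h"
    "(\<forall>i\<in>{1..n}. k' i \<ge> 0) \<or> (\<forall>i\<in>{1..n}. k' i \<le> 0)" by metis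
  have "k i = k' i" if "i \<in> {1..n}" for i
    using k'(1) that by (intro val_unique) simp_all
  then show ?thesis using k'(2) by simp
qed

lemma val_single: "i \<in> {1..n} \<Longrightarrow> val (\<lambda>l. if l = i then c else 0) h = of_int c * \<alpha> i h"
  by (simp add: val_def if_distrib[of of_int] if_distrib[of "\<lambda>x. x * _"] sum.delta cong: if_cong)

lemma simple_is_root:
  assumes "i \<in> {1..n}" shows "is_root (\<lambda>l. if l = i then 1 else 0)"
proof -
  have "is_weight (\<alpha> i)" using \<alpha>_root[OF assms] by (auto simp: restricted_roots_def is_weight_def)
  then have "is_weight (val (\<lambda>l. if l = i then 1 else 0))"
    using val_single[OF assms, of 1] by (subst is_weight_cong[of _ "\<alpha> i"]) auto
  then show ?thesis using assms by (auto simp: is_root_def)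
qed

lemma weight_\<theta>:
  assumes "h \<in> A" "br h v = c *\<^sub>R v" shows "br h (\<theta> v) = (- c) *\<^sub>R \<theta> v"
proof -
  have "br h (\<theta> v) = \<theta> (br (\<theta> h) v)" by (simp add: \<theta>_simps)
  then show ?thesis by (simp add: A_p[OF assms(1)] br_simps assms(2) \<theta>_simps)
qed

lemma root_neg: "is_root k \<Longrightarrow> is_root (\<lambda>i. - k i)"
proof -
  assume k: "is_root k"
  then obtain v where v: "v \<noteq> 0" "\<And>h. h \<in> A \<Longrightarrow> br h v = val k h *\<^sub>R v"
    by (auto simp: is_root_def is_weight_def)
  have "\<theta> v \<noteq> 0" using v(1) by (metis \<theta>_simps(5,6))
  moreover have "\<forall>h\<in>A. br h (\<theta> v) = val (\<lambda>i. - k i) h *\<^sub>R \<theta> v"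
    using weight_\<theta> v(2) by (simp add: val_def sum_negf)
  ultimately show "is_root (\<lambda>i. - k i)" using k by (auto simp: is_root_def is_weight_def)
qed

text \<open>The weights of \<open>v\<close> and \<open>\<theta> v\<close> cancel and
  \<open>\<theta>\<close> negates the bracket, so maximality of \<open>A\<close> applies. Invariance
  of the Killing form identifies the bracket as \<open>- ip v v\<close> times the vector dual to
  \<open>b\<close>.\<close>

lemma root_bracket:
  assumes v: "\<And>h. h \<in> A \<Longrightarrow> br h v = b h *\<^sub>R v"
  shows "br v (\<theta> v) \<in> A" "h \<in> A \<Longrightarrow> B (br v (\<theta> v)) h = - ip v v * b h"
proof -
  have *: "br h (\<theta> v) = - b h *\<^sub>R \<theta> v" if "h \<in> A" for h
    using weight_\<theta>[OF that v[OF that]] by simp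
  show "br v (\<theta> v) \<in> A"
  proof (rule A_maximal)
    show "\<theta> (br v (\<theta> v)) = - br v (\<theta> v)" using br_anti[of "\<theta> v" v] by (simp add: \<theta>_simps)
    show "br h (br v (\<theta> v)) = 0" if "h \<in> A" for h
      using br_jacobi[of h v "\<theta> v"] by (simp add: v[OF that] *[OF that] br_simps)
  qed
  assume h: "h \<in> A"
  have "B (br v (\<theta> v)) h = B v (br (\<theta> v) h)" by (rule killing_invariant)
  also have "br (\<theta> v) h = b h *\<^sub>R \<theta> v" using br_anti[of "\<theta> v" h] *[OF h] by simp
  finally show "B (br v (\<theta> v)) h = - ip v v * b h" by (simp add: killing_simps ip_def)
qed

lemma B_A_pos: "x \<in> A \<Longrightarrow> x \<noteq> 0 \<Longrightarrow> B x x > 0"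
  using ip_pos[of x] ip_p[OF A_p, of x x] by simp

lemma B_A_eqI:
  assumes "x \<in> A" "y \<in> A" "\<And>h. h \<in> A \<Longrightarrow> B x h = B y h" shows "x = y"
proof (rule ccontr)
  assume "x \<noteq> y"
  moreover have "x - y \<in> A" using assms A_subspace by (simp add: subspace_diff)
  ultimately have "B (x - y) (x - y) > 0" by (intro B_A_pos) auto
  then show False using assms(3)[OF \<open>x - y \<in> A\<close>] by (simp add: killing_simps)
qed

section \<open>Dual vectors of the simple roots, and coweights\<close>

definition dual_vec :: "nat \<Rightarrow> 'g" where "dual_vec i = killing_dual br A (\<alpha> i)"

text \<open>Existence is read off from a root vector through \<open>root_bracket\<close>, uniqueness
  from the definiteness of the Killing form on \<open>A\<close>.\<close>

lemma dual_vec: assumes "i \<in> {1..n}" shows "dual_vec i \<in> A" "h \<in> A \<Longrightarrow> B (dual_vec i) h = \<alpha> i h"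
proof -
  obtain v where v: "v \<noteq> 0" "\<And>h. h \<in> A \<Longrightarrow> br h v = \<alpha> i h *\<^sub>R v"
    using \<alpha>_root[OF assms] by (auto simp: restricted_roots_def)
  define t where "t = (- 1 / ip v v) *\<^sub>R br v (\<theta> v)"
  have "t \<in> A" using root_bracket(1)[OF v(2)] A_subspace by (simp add: t_def subspace_scale subspace_neg)
  moreover have "B t h = \<alpha> i h" if "h \<in> A" for h
    using root_bracket(2)[OF v(2) that] ip_pos[OF v(1)] by (simp add: t_def killing_simps)
  ultimately have "t \<in> A \<and> (\<forall>h\<in>A. B t h = \<alpha> i h)" by blast
  then have "dual_vec i \<in> A \<and> (\<forall>h\<in>A. B (dual_vec i) h = \<alpha> i h)"
    unfolding dual_vec_def killing_dual_def
    by (rule theI[of "\<lambda>t. t \<in> A \<and> (\<forall>h\<in>A. B t h = \<alpha> i h)"]) (auto intro: B_A_eqI simp: \<open>t \<in> A\<close> \<open>\<And>h. h \<in> A \<Longrightarrow> B t h = \<alpha> i h\<close>)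
  then show "dual_vec i \<in> A" "h \<in> A \<Longrightarrow> B (dual_vec i) h = \<alpha> i h" by auto
qed

lemma \<alpha>_T_pos: assumes i: "i \<in> {1..n}" shows "\<alpha> i (dual_vec i) > 0"
proof -
  have "dual_vec i \<noteq> 0"
  proof
    assume "dual_vec i = 0"
    then have "\<alpha> i h = 0" if "h \<in> A" for h using dual_vec(2)[OF i that] by (simp add: killing_simps)
    then show False using \<alpha>_root[OF i] by (auto simp: restricted_roots_def)
  qed
  then show ?thesis using B_A_pos[OF dual_vec(1)[OF i]] dual_vec[OF i] by simp
qed

lemma \<alpha>_T: assumes "i \<in> {1..n}" "j \<in> {1..n}" shows "2 * \<alpha> i (dual_vec j) / \<alpha> j (dual_vec j) = a i j"
  using cartan_matrix[OF assms] assms dual_vec[OF assms(1)] dual_vec[OF assms(2)]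
  by (simp add: cartan_int_def root_inner_def dual_vec_def[symmetric])

lemma a_diag: "i \<in> {1..n} \<Longrightarrow> a i i = 2"
  using \<alpha>_T[of i i] \<alpha>_T_pos[of i] by simp

lemma T_combination:
  assumes "(\<Sum>i=1..n. c i *\<^sub>R dual_vec i) = 0" "i \<in> {1..n}" shows "c i = 0"
proof (rule \<alpha>_indep[OF _ assms(2)])
  fix h assume h: "h \<in> A"
  have "(\<Sum>i=1..n. c i * \<alpha> i h) = B (\<Sum>i=1..n. c i *\<^sub>R dual_vec i) h"
    by (subst linear_sum[where f = "\<lambda>x. B x h"])
      (use killing_bilinear in \<open>auto simp: bilinear_def killing_simps dual_vec h intro!: sum.cong\<close>)
  then show "(\<Sum>i=1..n. c i * \<alpha> i h) = 0" using assms(1) by (simp add: killing_simps)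
qed

lemma T_span: "span (dual_vec ` {1..n}) = A"
proof -
  have inj: "inj_on dual_vec {1..n}"
  proof (rule inj_onI, rule ccontr)
    fix i j assume ij: "i \<in> {1..n}" "j \<in> {1..n}" "dual_vec i = dual_vec j" "i \<noteq> j"
    have "(\<Sum>l=1..n. ((if l = i then 1 else 0) + (if l = j then - 1 else 0)) *\<^sub>R dual_vec l) = dual_vec i - dual_vec j"
      using ij(1,2) by (simp add: scaleR_add_left sum.distrib if_distrib[of "\<lambda>x. x *\<^sub>R _"] sum.delta cong: if_cong)
    from T_combination[OF this[unfolded ij(3) diff_self] ij(1)] show False using ij(4) by simp
  qed
  have ind: "independent (dual_vec ` {1..n})"
  proof
    assume "dependent (dual_vec ` {1..n})"
    then obtain u where u: "\<exists>v\<in>dual_vec ` {1..n}. u v \<noteq> 0" "(\<Sum>v\<in>dual_vec ` {1..n}. u v *\<^sub>R v) = 0"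
      by (subst (asm) dependent_finite) auto
    then have "(\<Sum>i=1..n. u (dual_vec i) *\<^sub>R dual_vec i) = 0" unfolding sum.reindex[OF inj] by (simp only: o_def)
    then show False using T_combination[of "\<lambda>i. u (dual_vec i)"] u(1) by blast
  qed
  have sub: "dual_vec ` {1..n} \<subseteq> A" using dual_vec(1) by blast
  have "A \<subseteq> span (dual_vec ` {1..n})"
    by (rule card_ge_dim_independent[OF sub ind], unfold card_image[OF inj] n_dim[symmetric], simp)
  then show ?thesis using span_minimal[OF sub A_subspace] by blast
qed

lemma \<alpha>_all_zero:
  assumes h: "h \<in> A" "\<And>i. i \<in> {1..n} \<Longrightarrow> \<alpha> i h = 0" shows "h = 0"
proof -
  have "B x h = 0" if "x \<in> span (dual_vec ` {1..n})" for x
    using that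
  proof (induction rule: span_induct_alt)
    case (step c x y)
    then obtain i where "i \<in> {1..n}" "x = dual_vec i" by blast
    then show ?case using step dual_vec(2)[OF _ h(1)] h(2) by (simp add: killing_simps)
  qed (simp add: killing_simps)
  then have "B h h = 0" using h(1) T_span by blast
  then show ?thesis using B_A_pos[OF h(1)] by fastforce
qed

lemma A_eqI:
  assumes "h \<in> A" "h' \<in> A" "\<And>i. i \<in> {1..n} \<Longrightarrow> \<alpha> i h = \<alpha> i h'" shows "h = h'"
  using \<alpha>_all_zero[of "h - h'"] assms A_subspace by (simp add: subspace_diff \<alpha>_diff)

abbreviation H :: "nat \<Rightarrow> 'g" where "H j \<equiv> coweight A \<alpha> n j"

text \<open>The map \<open>\<Phi>\<close> takes \<open>h\<close> to the combination of dual vectors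
  with coefficients \<open>\<alpha> k h\<close>. It is injective on \<open>A\<close>, hence onto,
  and the preimage of \<open>dual_vec j\<close> is the coweight.\<close>

lemma H: assumes j: "j \<in> {1..n}" shows "H j \<in> A" "k \<in> {1..n} \<Longrightarrow> \<alpha> k (H j) = (if k = j then 1 else 0)"
proof -
  define \<Phi> where "\<Phi> h = (\<Sum>k=1..n. B (dual_vec k) h *\<^sub>R dual_vec k)" for h
  have lin: "linear \<Phi>"
    unfolding \<Phi>_def
    by (rule linearI) (simp_all add: killing_simps scaleR_add_left sum.distrib scaleR_sum_right)
  have "inj_on \<Phi> A"
  proof (rule inj_onI)
    fix x y assume xy: "x \<in> A" "y \<in> A" "\<Phi> x = \<Phi> y"
    have xyA: "x - y \<in> A" using xy A_subspace by (simp add: subspace_diff)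
    have "\<Phi> (x - y) = 0" using xy(3) linear_diff[OF lin] by simp
    then have "B (dual_vec i) (x - y) = 0" if "i \<in> {1..n}" for i
      unfolding \<Phi>_def using T_combination[of "\<lambda>k. B (dual_vec k) (x - y)", OF _ that] by blast
    then have "x - y = 0" by (intro \<alpha>_all_zero xyA) (use dual_vec(2)[OF _ xyA] in simp)
    then show "x = y" by simp
  qed
  then have "dim (\<Phi> ` A) = dim A"
    by (intro dim_image_eq lin) (simp add: span_eq_iff[THEN iffD2, OF A_subspace])
  moreover have "\<Phi> ` A \<subseteq> A" using A_subspace dual_vec(1) by (auto simp: \<Phi>_def intro!: subspace_sum subspace_scale)
  ultimately have "\<Phi> ` A = A"
    using subspace_dim_equal[of "\<Phi> ` A" A] linear_subspace_image[OF lin A_subspace] A_subspace by simp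
  then obtain h where h: "h \<in> A" "\<Phi> h = dual_vec j" using dual_vec(1)[OF j] by (metis imageE)
  have "\<alpha> k h = (if k = j then 1 else 0)" if k: "k \<in> {1..n}" for k
  proof -
    have "(\<Sum>k=1..n. (\<alpha> k h - (if k = j then 1 else 0)) *\<^sub>R dual_vec k) = \<Phi> h - dual_vec j"
      using j by (simp add: \<Phi>_def dual_vec(2) h(1) scaleR_diff_left sum_subtractf
          if_distrib[of "\<lambda>x. x *\<^sub>R _"] sum.delta cong: if_cong)
    then show ?thesis using T_combination[OF _ k] h(2) by fastforce
  qed
  then have "h \<in> A \<and> (\<forall>k\<in>{1..n}. \<alpha> k h = (if k = j then 1 else 0))" using h(1) by blast
  then have "H j \<in> A \<and> (\<forall>k\<in>{1..n}. \<alpha> k (H j) = (if k = j then 1 else 0))"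
    unfolding coweight_def by (rule theI) (auto intro!: A_eqI simp: h(1) \<open>\<And>k. k \<in> {1..n} \<Longrightarrow> \<alpha> k h = (if k = j then 1 else 0)\<close>)
  then show "H j \<in> A" "k \<in> {1..n} \<Longrightarrow> \<alpha> k (H j) = (if k = j then 1 else 0)" by auto
qed

lemma H_eqI:
  assumes "j \<in> {1..n}" "h \<in> A" "\<And>k. k \<in> {1..n} \<Longrightarrow> \<alpha> k h = (if k = j then 1 else 0)"
  shows "h = H j"
  by (rule A_eqI) (use assms H in auto)

definition pt :: "(nat \<Rightarrow> real) \<Rightarrow> 'g" where "pt x = (\<Sum>j=1..n. x j *\<^sub>R H j)"

lemma pt: "pt x \<in> A" "k \<in> {1..n} \<Longrightarrow> \<alpha> k (pt x) = x k"
proof -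
  have mem: "x j *\<^sub>R H j \<in> A" if "j \<in> {1..n}" for j using H(1)[OF that] A_subspace by (simp add: subspace_scale)
  then show "pt x \<in> A" using A_subspace by (auto simp: pt_def intro: subspace_sum)
  assume k: "k \<in> {1..n}"
  have "\<alpha> k (pt x) = (\<Sum>j=1..n. \<alpha> k (x j *\<^sub>R H j))"
    unfolding pt_def by (rule \<alpha>_sum[OF k]) (simp_all only: mem finite_atLeastAtMost)
  also have "\<dots> = (\<Sum>j=1..n. if k = j then x j else 0)"
    by (rule sum.cong) (simp_all add: \<alpha>_scale[OF k] H k del: atLeastAtMost_iff One_nat_def)
  finally have "\<alpha> k (pt x) = (\<Sum>j=1..n. if k = j then x j else 0)" .
  then show "\<alpha> k (pt x) = x k" using k by (simp add: sum.delta)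
qed

section \<open>Simple reflections and their action on roots\<close>

definition simple_refl :: "nat \<Rightarrow> 'g \<Rightarrow> 'g" where
  "simple_refl i h = h - (2 * \<alpha> i h / \<alpha> i (dual_vec i)) *\<^sub>R dual_vec i"

lemma refl_A: "i \<in> {1..n} \<Longrightarrow> h \<in> A \<Longrightarrow> simple_refl i h \<in> A"
  using dual_vec(1) A_subspace by (simp add: simple_refl_def subspace_diff subspace_scale)

lemma \<alpha>_refl:
  assumes "k \<in> {1..n}" "i \<in> {1..n}" "h \<in> A"
  shows "\<alpha> k (simple_refl i h) = \<alpha> k h - \<alpha> i h * a k i"
proof -
  have t: "dual_vec i \<in> A" "(2 * \<alpha> i h / \<alpha> i (dual_vec i)) *\<^sub>R dual_vec i \<in> A"
    using dual_vec(1) assms A_subspace by (simp_all add: subspace_scale)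
  show ?thesis
    unfolding simple_refl_def \<alpha>_diff[OF assms(1,3) t(2)] \<alpha>_scale[OF assms(1) t(1)] \<alpha>_T[OF assms(1,2), symmetric]
    by simp
qed

lemma refl_refl: "i \<in> {1..n} \<Longrightarrow> h \<in> A \<Longrightarrow> simple_refl i (simple_refl i h) = h"
  by (rule A_eqI) (simp_all add: refl_A \<alpha>_refl a_diag del: atLeastAtMost_iff One_nat_def)

lemma B_refl:
  assumes "i \<in> {1..n}" "h \<in> A" "b \<in> A"
  shows "B (simple_refl i h) b = B h b - 2 * \<alpha> i h / \<alpha> i (dual_vec i) * \<alpha> i b"
  using dual_vec[OF assms(1)] assms by (simp add: simple_refl_def killing_simps)

text \<open>With \<open>e\<close> a root vector, \<open>ad (e + \<theta> e)\<close> rotates the plane spanned by \<open>dual_vec i\<close> and \<open>e - \<theta> e\<close>;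
  the reflection is the rotation by the angle \<open>\<pi>\<close>.\<close>
lemma refl_inner:
  assumes i: "i \<in> {1..n}"
  obtains \<phi> where "\<phi> \<in> inner_auts br" "\<And>h. h \<in> A \<Longrightarrow> \<phi> h = simple_refl i h"
proof -
  obtain e where e: "e \<noteq> 0" "\<And>h. h \<in> A \<Longrightarrow> br h e = \<alpha> i h *\<^sub>R e"
    using \<alpha>_root[OF i] by (auto simp: restricted_roots_def)
  define s where "s = ip e e"
  have s: "s > 0" using ip_pos[OF e(1)] by (simp add: s_def)
  have e\<theta>: "br e (\<theta> e) = - (s *\<^sub>R dual_vec i)"
  proof (rule B_A_eqI)
    show "- (s *\<^sub>R dual_vec i) \<in> A" using dual_vec(1)[OF i] A_subspace by (simp add: subspace_scale subspace_neg)
  qed (use root_bracket[OF e(2)] dual_vec[OF i] in \<open>simp_all add: killing_simps s_def\<close>)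
  define z where "z = e + \<theta> e"
  define w where "w = e - \<theta> e"
  have zh: "br z h = - \<alpha> i h *\<^sub>R w" if "h \<in> A" for h
    using br_anti[of e h] br_anti[of "\<theta> e" h] e(2)[OF that] weight_\<theta>[OF that e(2)[OF that]]
    by (simp add: z_def w_def br_simps scaleR_diff_right)
  have zw: "br z w = (2 * s) *\<^sub>R dual_vec i"
    using br_anti[of "\<theta> e" e] e\<theta> by (simp add: z_def w_def br_simps br_self flip: scaleR_2)
  define r where "r = \<alpha> i (dual_vec i)"
  have r: "r > 0" using \<alpha>_T_pos[OF i] by (simp add: r_def)
  \<comment> \<open>On the plane, \<open>br z\<close> maps \<open>dual_vec i\<close> to
    \<open>- r\<close> times \<open>w\<close>, and \<open>w\<close> to \<open>2 * s\<close> times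
    \<open>dual_vec i\<close>. Its square is \<open>- 2 * s * r\<close>, so \<open>\<omega>\<close>
    is the angular frequency, and \<open>c\<close> makes time \<open>1\<close> half a turn.\<close>
  define \<omega> where "\<omega> = sqrt (2 * s * r)"
  have \<omega>: "\<omega> > 0" "\<omega> * \<omega> = 2 * s * r" using s r by (auto simp: \<omega>_def)
  define c where "c = pi / \<omega>"
  have c\<omega>: "c * \<omega> = pi" using \<omega>(1) by (simp add: c_def)
  define \<phi> where "\<phi> = lin_exp (br (c *\<^sub>R z))"
  have "\<phi> h = simple_refl i h" if h: "h \<in> A" for h
  proof -
    define q where "q = \<alpha> i h / r"
    have qr: "\<alpha> i h = q * r" using r by (simp add: q_def)
    define m where "m = q * \<omega> / (2 * s)"
    have ms: "2 * s * m = q * \<omega>" using s by (simp add: m_def)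
    \<comment> \<open>The part of \<open>h\<close> along \<open>dual_vec i\<close>, with coefficient
      \<open>q\<close>, turns by the angle \<open>pi * t\<close>, the rest stays fixed;
      \<open>m\<close> is the amplitude along \<open>w\<close> that matches the velocities.\<close>
    let ?u = "\<lambda>t. h + (q * (cos (pi * t) - 1)) *\<^sub>R dual_vec i - (m * sin (pi * t)) *\<^sub>R w"
    have "(?u has_vector_derivative br (c *\<^sub>R z) (?u t)) (at t)" for t
    proof -
      have "(?u has_vector_derivative (- q * pi * sin (pi * t)) *\<^sub>R dual_vec i - (m * pi * cos (pi * t)) *\<^sub>R w) (at t)"
        by (auto intro!: derivative_eq_intros simp: algebra_simps)
      moreover have "br (c *\<^sub>R z) (?u t)
        = (- (2 * s * m) * c * sin (pi * t)) *\<^sub>R dual_vec i - (c * q * r * cos (pi * t)) *\<^sub>R w"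
        by (simp add: br_simps zh[OF h] zh[OF dual_vec(1)[OF i]] zw qr r_def[symmetric] algebra_simps)
      moreover have "c * q * r = m * pi"
      proof -
        have "m * pi = q * c * (\<omega> * \<omega>) / (2 * s)" unfolding c\<omega>[symmetric] by (simp add: m_def)
        then show ?thesis using s unfolding \<omega>(2) by simp
      qed
      moreover have "2 * s * m * c = q * pi" unfolding ms c\<omega>[symmetric] by simp
      ultimately show ?thesis by simp
    qed
    from lin_exp_unique[OF br_linear this]
    have "\<phi> h = h + (- 2 * q) *\<^sub>R dual_vec i" by (simp add: \<phi>_def mult.commute)
    then show ?thesis by (simp add: simple_refl_def q_def r_def)
  qed
  moreover have "\<phi> \<in> inner_auts br"
    using inner_auts.exp_inn[OF inner_auts.id_inn, where y = "c *\<^sub>R z" and br = br] by (simp add: \<phi>_def)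
  ultimately show thesis using that by blast
qed

text \<open>The simple reflection in root coordinates: the subtracted sum is the pairing of the root
  with the coroot of \<open>\<alpha> i\<close>.\<close>

definition srefl :: "nat \<Rightarrow> (nat \<Rightarrow> int) \<Rightarrow> nat \<Rightarrow> int" where
  "srefl i k = k(i := k i - (\<Sum>l=1..n. k l * a l i))"

lemma val_refl:
  assumes i: "i \<in> {1..n}" and h: "h \<in> A"
  shows "val k (simple_refl i h) = val (srefl i k) h"
proof -
  have "val k (simple_refl i h) = (\<Sum>l=1..n. of_int (k l) * \<alpha> l h) - (\<Sum>l=1..n. of_int (k l * a l i)) * \<alpha> i h"
    unfolding val_def sum_distrib_right sum_subtractf[symmetric]
    by (intro sum.cong refl) (simp add: \<alpha>_refl[OF _ i h] algebra_simps)
  also have "(\<Sum>l=1..n. of_int (k l) * \<alpha> l h) = of_int (k i) * \<alpha> i h + (\<Sum>l\<in>{1..n} - {i}. of_int (k l) * \<alpha> l h)"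
    using i by (intro sum.remove) auto
  also have "(\<Sum>l\<in>{1..n} - {i}. of_int (k l) * \<alpha> l h) = (\<Sum>l\<in>{1..n} - {i}. of_int (srefl i k l) * \<alpha> l h)"
    by (intro sum.cong) (auto simp: srefl_def)
  also have "of_int (k i) * \<alpha> i h + (\<Sum>l\<in>{1..n} - {i}. of_int (srefl i k l) * \<alpha> l h)
      - (\<Sum>l=1..n. of_int (k l * a l i)) * \<alpha> i h
     = of_int (srefl i k i) * \<alpha> i h + (\<Sum>l\<in>{1..n} - {i}. of_int (srefl i k l) * \<alpha> l h)"
    by (simp add: srefl_def left_diff_distrib)
  also have "\<dots> = val (srefl i k) h"
    unfolding val_def using i by (intro sum.remove[symmetric]) auto
  finally show ?thesis .
qed

text \<open>An inner automorphism that restricts to the reflection on \<open>A\<close> carries root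
  vectors of \<open>k\<close> to root vectors of the reflected root.\<close>

lemma root_refl:
  assumes i: "i \<in> {1..n}" and k: "is_root k" shows "is_root (srefl i k)"
proof -
  obtain \<phi> where \<phi>: "\<phi> \<in> inner_auts br" "\<And>h. h \<in> A \<Longrightarrow> \<phi> h = simple_refl i h"
    using refl_inner[OF i] by blast
  have aut: "linear \<phi>" "inj \<phi>" "\<And>x y. \<phi> (br x y) = br (\<phi> x) (\<phi> y)"
    using lie_aut_inner[OF \<phi>(1)] by (auto simp: lie_aut_def bij_is_inj)
  obtain v where v: "v \<noteq> 0" "\<And>h. h \<in> A \<Longrightarrow> br h v = val k h *\<^sub>R v"
    using k by (auto simp: is_root_def is_weight_def)
  have "br h (\<phi> v) = val (srefl i k) h *\<^sub>R \<phi> v" if h: "h \<in> A" for h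
  proof -
    have "br h (\<phi> v) = \<phi> (br (simple_refl i h) v)"
      by (simp add: aut(3) \<phi>(2)[OF refl_A[OF i h]] refl_refl[OF i h])
    then show ?thesis
      by (simp add: v(2)[OF refl_A[OF i h]] val_refl[OF i h] linear_cmul[OF aut(1)])
  qed
  moreover have "\<phi> v \<noteq> 0" using v(1) aut(1,2) by (metis injD linear_0)
  ultimately have w: "is_weight (val (srefl i k))" by (auto simp: is_weight_def)
  have "\<exists>l\<in>{1..n}. srefl i k l \<noteq> 0"
  proof (rule ccontr)
    assume "\<not> (\<exists>l\<in>{1..n}. srefl i k l \<noteq> 0)"
    then have z: "val (srefl i k) h = 0" for h by (simp add: val_def)
    obtain h where h: "h \<in> A" "val k h \<noteq> 0" using root_nonzero[OF k] .
    then show False using z[of "simple_refl i h"] val_refl[OF i refl_A[OF i h(1)], of k] by (simp add: refl_refl[OF i h(1)])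
  qed
  then show ?thesis using w by (simp add: is_root_def)
qed

text \<open>The sl2 argument by definiteness: if \<open>br (\<theta> e)\<close> killed
  \<open>v\<close>, the Jacobi identity would make \<open>ip (br e v) (br e v)\<close> negative. So
  the lowering operator yields a new weight vector.\<close>

lemma weight_lower:
  assumes i: "i \<in> {1..n}" and b: "is_weight b" "b (dual_vec i) > 0"
  shows "is_weight (\<lambda>h. b h - \<alpha> i h)"
proof -
  obtain e where e: "e \<noteq> 0" "\<And>h. h \<in> A \<Longrightarrow> br h e = \<alpha> i h *\<^sub>R e"
    using \<alpha>_root[OF i] by (auto simp: restricted_roots_def)
  obtain v where v: "v \<noteq> 0" "\<And>h. h \<in> A \<Longrightarrow> br h v = b h *\<^sub>R v"
    using b by (auto simp: is_weight_def)
  let ?w = "br (\<theta> e) v"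
  have "?w \<noteq> 0"
  proof
    assume w0: "?w = 0"
    have "br e (\<theta> e) = - (ip e e *\<^sub>R dual_vec i)"
    proof (rule B_A_eqI)
      show "- (ip e e *\<^sub>R dual_vec i) \<in> A" using dual_vec(1)[OF i] A_subspace by (simp add: subspace_scale subspace_neg)
    qed (use root_bracket[OF e(2)] dual_vec[OF i] in \<open>simp_all add: killing_simps\<close>)
    then have "br (\<theta> e) (br e v) = (ip e e * b (dual_vec i)) *\<^sub>R v"
      using br_jacobi[of "\<theta> e" e v] br_anti[of "\<theta> e" e] w0 v(2)[OF dual_vec(1)[OF i]] by (simp add: br_simps)
    then have "ip (br e v) (br e v) = - (ip e e * b (dual_vec i) * ip v v)"
      by (simp add: ip_adjoint ip_simps)
    moreover have "ip e e * b (dual_vec i) * ip v v > 0" using e(1) v(1) b(2) by (simp add: ip_pos)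
    ultimately show False using ip_nonneg[of "br e v"] by linarith
  qed
  moreover have "br h ?w = (b h - \<alpha> i h) *\<^sub>R ?w" if h: "h \<in> A" for h
    using br_jacobi[of h "\<theta> e" v] weight_\<theta>[OF h e(2)[OF h]] v(2)[OF h]
    by (simp add: br_simps scaleR_diff_left)
  ultimately show ?thesis by (auto simp: is_weight_def)
qed

text \<open>Subtracting \<open>\<alpha> i\<close> repeatedly ends at its double. Excluding doubles
  therefore excludes all higher multiples.\<close>

lemma weight_multiple:
  assumes i: "i \<in> {1..n}" and "m \<ge> 2" "is_weight (\<lambda>h. real m * \<alpha> i h)"
  shows "is_weight (\<lambda>h. 2 * \<alpha> i h)"
  using assms(2,3)
proof (induction m rule: nat_induct_at_least)
  case (Suc m)
  have "is_weight (\<lambda>h. real (Suc m) * \<alpha> i h - \<alpha> i h)"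
    by (rule weight_lower[OF i Suc.prems]) (simp add: \<alpha>_T_pos[OF i])
  then show ?case by (intro Suc.IH) (simp add: algebra_simps)
qed simp

section \<open>Integral points of \<open>A\<close> and sets stable under reflections\<close>

definition ptz :: "(nat \<Rightarrow> int) \<Rightarrow> 'g" where "ptz x = pt (\<lambda>i. of_int (x i))"

lemma ptz: "ptz x \<in> A" "k \<in> {1..n} \<Longrightarrow> \<alpha> k (ptz x) = of_int (x k)"
  unfolding ptz_def by (rule pt)+

lemma ptz_eqI: "h \<in> A \<Longrightarrow> (\<And>k. k \<in> {1..n} \<Longrightarrow> \<alpha> k h = of_int (x k)) \<Longrightarrow> h = ptz x"
  by (rule A_eqI) (simp_all only: ptz)

lemma ptz_refl:
  assumes i: "i \<in> {1..n}" and y: "\<And>k. k \<in> {1..n} \<Longrightarrow> y k = x k - x i * a k i"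
  shows "simple_refl i (ptz x) = ptz y"
  by (rule ptz_eqI) (simp_all only: refl_A[OF i ptz(1)] \<alpha>_refl[OF _ i ptz(1)] ptz i y of_int_diff of_int_mult)

lemma val_ptz: "val k (ptz x) = of_int (\<Sum>i=1..n. k i * x i)"
  by (simp add: val_def ptz(2) del: One_nat_def)

text \<open>The vector \<open>t\<close> dual to the root has positive norm \<open>val k t\<close>,
  so a simple root with positive coefficient is positive on \<open>t\<close>. Reflecting in it
  lowers the height.\<close>

lemma positive_descent:
  assumes k: "is_root k" "\<And>i. i \<in> {1..n} \<Longrightarrow> k i \<ge> 0"
  obtains i where "i \<in> {1..n}" "k i > 0" "(\<Sum>l=1..n. k l * a l i) > 0"
proof -
  define t where "t = (\<Sum>i=1..n. of_int (k i) *\<^sub>R dual_vec i)"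
  have tA: "t \<in> A" unfolding t_def using dual_vec(1) A_subspace by (intro subspace_sum subspace_scale) auto
  have Bt: "B t h = val k h" if "h \<in> A" for h
    unfolding t_def val_def
    by (subst linear_sum[where f = "\<lambda>x. B x h"])
      (use killing_bilinear that in \<open>auto simp: bilinear_def killing_simps dual_vec intro!: sum.cong\<close>)
  obtain h where "h \<in> A" "val k h \<noteq> 0" using root_nonzero[OF k(1)] .
  then have "t \<noteq> 0" using Bt[of h] by (auto simp: killing_simps)
  then have "val k t > 0" using B_A_pos[OF tA] Bt[OF tA] by simp
  then obtain i where i: "i \<in> {1..n}" "of_int (k i) * \<alpha> i t > 0"
    unfolding val_def using sum_nonpos[of "{1..n}" "\<lambda>i. of_int (k i) * \<alpha> i t"] by (meson not_le)
  have ki: "k i > 0" "\<alpha> i t > 0" using k(2)[OF i(1)] i(2) by (auto simp: zero_less_mult_iff)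
  have "\<alpha> i t = B t (dual_vec i)" using dual_vec[OF i(1)] tA killing_sym by simp
  also have "\<dots> = val k (dual_vec i)" by (rule Bt[OF dual_vec(1)[OF i(1)]])
  also have "\<dots> = of_int (\<Sum>l=1..n. k l * a l i) * (\<alpha> i (dual_vec i) / 2)"
    unfolding val_def of_int_sum sum_distrib_right
    using \<alpha>_T_pos[OF i(1)] by (intro sum.cong) (auto simp: \<alpha>_T[OF _ i(1), symmetric] field_simps)
  finally have "0 < of_int (\<Sum>l=1..n. k l * a l i) * (\<alpha> i (dual_vec i) / 2)" using ki(2) by simp
  then have "0 < real_of_int (\<Sum>l=1..n. k l * a l i)"
    using \<alpha>_T_pos[OF i(1)] by (simp only: zero_less_mult_iff) auto
  then show thesis using that[OF i(1) ki(1)] by (simp only: of_int_0_less_iff)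
qed

text \<open>Abstracted from a minuscule Weyl orbit, so that the Weyl group itself need not be
  formed; points are compared on \<open>{1..n}\<close> only.\<close>

definition stable :: "(nat \<Rightarrow> int) set \<Rightarrow> bool" where
  "stable W \<longleftrightarrow> (\<forall>x\<in>W. \<forall>i\<in>{1..n}. x i \<in> {-1, 0, 1}
      \<and> (\<exists>y\<in>W. \<forall>k\<in>{1..n}. y k = x k - x i * a k i))"

lemma stable_entry: "stable W \<Longrightarrow> x \<in> W \<Longrightarrow> i \<in> {1..n} \<Longrightarrow> x i \<in> {-1, 0, 1}"
  unfolding stable_def by blast

lemma stable_step:
  assumes "stable W" "x \<in> W" "i \<in> {1..n}"
  shows "\<exists>y\<in>W. \<forall>k\<in>{1..n}. y k = x k - x i * a k i"
  using bspec[OF bspec[OF assms(1)[unfolded stable_def] assms(2)] assms(3)] by (rule conjunct2)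

text \<open>Induction on the height: reflecting root and point together keeps their pairing, and
  \<open>positive_descent\<close> lowers the root until it is simple, where the entries of the point
  bound the value.\<close>

lemma stable_bound_pos:
  assumes red: "\<And>i. i \<in> {1..n} \<Longrightarrow> \<not> is_weight (\<lambda>h. 2 * \<alpha> i h)" and W: "stable W"
  assumes "x \<in> W" "is_root k" "\<And>i. i \<in> {1..n} \<Longrightarrow> k i \<ge> 0"
  shows "(\<Sum>i=1..n. k i * x i) \<in> {-1, 0, 1}"
  using assms(3-)
proof (induction "nat (\<Sum>i=1..n. k i)" arbitrary: k x rule: less_induct)
  case less
  obtain i where i: "i \<in> {1..n}" "k i > 0" "(\<Sum>l=1..n. k l * a l i) > 0"
    using positive_descent[OF less.prems(2,3)] .
  show ?case
  proof (cases "\<exists>l\<in>{1..n}. l \<noteq> i \<and> k l \<noteq> 0")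
    case True
    \<comment> \<open>A reflection changes only the coefficient \<open>i\<close>, so a further
      positive coefficient \<open>l\<close> keeps the reflected root positive.\<close>
    then obtain l where l: "l \<in> {1..n}" "l \<noteq> i" "k l > 0" using less.prems(3) by force
    let ?k = "srefl i k"
    have rk: "is_root ?k" by (rule root_refl[OF i(1) less.prems(2)])
    have "?k l > 0" using l by (simp add: srefl_def)
    then have pos: "\<And>j. j \<in> {1..n} \<Longrightarrow> ?k j \<ge> 0" using root_sign[OF rk] l(1) by force
    have "(\<Sum>j=1..n. ?k j) = (\<Sum>j=1..n. k j) - (\<Sum>l=1..n. k l * a l i)"
      using i(1) by (simp add: srefl_def sum.remove[of "{1..n}" i] del: One_nat_def)
    moreover have "(\<Sum>j=1..n. ?k j) \<ge> 0" by (intro sum_nonneg pos)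
    ultimately have dec: "nat (\<Sum>j=1..n. ?k j) < nat (\<Sum>j=1..n. k j)" using i(3) by linarith
    obtain y where y: "y \<in> W" "\<forall>j\<in>{1..n}. y j = x j - x i * a j i"
      using stable_step[OF W less.prems(1) i(1)] by (rule bexE)
    have "real_of_int (\<Sum>j=1..n. k j * x j) = val k (simple_refl i (simple_refl i (ptz x)))"
      by (simp only: refl_refl[OF i(1) ptz(1)] val_ptz)
    also have "\<dots> = val ?k (ptz y)"
      by (simp only: ptz_refl[OF i(1) bspec[OF y(2)]] val_refl[OF i(1) ptz(1)])
    also have "\<dots> = real_of_int (\<Sum>j=1..n. ?k j * y j)" by (rule val_ptz)
    finally have "(\<Sum>j=1..n. k j * x j) = (\<Sum>j=1..n. ?k j * y j)" by linarith
    then show ?thesis using less.hyps[OF dec y(1) rk pos] by simp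
  next
    case False
    have vk: "val k h = of_int (k i) * \<alpha> i h" for h
      unfolding val_single[OF i(1), symmetric] val_def using False by (intro sum.cong) auto
    have "k i = 1"
    proof (rule ccontr)
      assume "k i \<noteq> 1"
      then have 2: "nat (k i) \<ge> 2" using i(2) by linarith
      have "is_weight (\<lambda>h. real (nat (k i)) * \<alpha> i h)"
        using less.prems(2) i(2) by (simp add: is_root_def vk[abs_def])
      from weight_multiple[OF i(1) 2 this] show False using red[OF i(1)] by blast
    qed
    moreover have "(\<Sum>j=1..n. k j * x j) = (\<Sum>j=1..n. if j = i then k i * x i else 0)"
      using False by (intro sum.cong) auto
    ultimately have "(\<Sum>j=1..n. k j * x j) = x i" using i(1) by (simp add: sum.delta)
    then show ?thesis using stable_entry[OF W less.prems(1) i(1)] by simp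
  qed
qed

lemma stable_bound:
  assumes red: "\<And>i. i \<in> {1..n} \<Longrightarrow> \<not> is_weight (\<lambda>h. 2 * \<alpha> i h)" and W: "stable W"
  assumes x: "x \<in> W" and k: "is_root k"
  shows "val k (ptz x) \<in> {-1, 0, 1}"
proof -
  have "(\<Sum>i=1..n. k i * x i) \<in> {-1, 0, 1}"
  proof (cases "\<forall>i\<in>{1..n}. k i \<ge> 0")
    case True
    then show ?thesis using stable_bound_pos[OF red W x k] by blast
  next
    case False
    then have "\<forall>i\<in>{1..n}. - k i \<ge> 0" using root_sign[OF k] by auto
    then have "(\<Sum>i=1..n. - k i * x i) \<in> {-1, 0, 1}"
      using stable_bound_pos[OF red W x root_neg[OF k]] by blast
    then show ?thesis by (auto simp: sum_negf)
  qed
  moreover have "s \<in> {-1, 0, 1} \<Longrightarrow> real_of_int s \<in> {-1, 0, 1}" for s by auto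
  ultimately show ?thesis by (simp only: val_ptz)
qed

section \<open>Weight decomposition and dominant representatives\<close>

lemma joint_weight:
  assumes "v \<noteq> 0" "\<forall>h\<in>A. \<exists>c. br h v = c *\<^sub>R v"
  obtains "\<And>h. h \<in> A \<Longrightarrow> br h v = 0" | k where "is_root k" "\<And>h. h \<in> A \<Longrightarrow> br h v = val k h *\<^sub>R v"
proof -
  obtain b where b: "\<forall>h\<in>A. br h v = b h *\<^sub>R v" using bchoice[OF assms(2)] by blast
  then have "is_weight b" using assms(1) by (auto simp: is_weight_def)
  then show thesis by (rule weight_cases) (use b that in auto)
qed

text \<open>Admitting an invariant subspace \<open>S\<close> allows the decomposition to be applied
  to the centralizer of an element of \<open>A\<close>.\<close>

lemma A_span:
  assumes "subspace S" "\<And>h x. h \<in> A \<Longrightarrow> x \<in> S \<Longrightarrow> br h x \<in> S"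
  shows "S \<subseteq> span {v \<in> S. \<forall>h\<in>A. \<exists>c. br h v = c *\<^sub>R v}"
proof -
  have "S \<subseteq> span {v \<in> S. \<forall>f\<in>br ` A. \<exists>c. f v = c *\<^sub>R v}"
  proof (rule sym_joint_span[OF assms(1)])
    show "ip (f x) y = ip x (f y)" if "f \<in> br ` A" for f x y
      using that ad_p_symmetric[OF A_p] by auto
    show "f (g x) = g (f x)" if "f \<in> br ` A" "g \<in> br ` A" for f g x
    proof -
      obtain h h' where "h \<in> A" "h' \<in> A" "f = br h" "g = br h'" using \<open>f \<in> br ` A\<close> \<open>g \<in> br ` A\<close> by blast
      then show ?thesis using br_jacobi[of h h' x] A_comm[of h h'] by (simp add: br_simps)
    qed
  qed (use assms br_linear in auto)
  then show ?thesis by simp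
qed

text \<open>The joint eigenvectors of \<open>A\<close> span the Lie algebra, so the cubic identity
  reduces to the values of the roots on \<open>h\<close>.\<close>

lemma euler_A_iff:
  assumes h: "h \<in> A"
  shows "euler_elem br h \<longleftrightarrow> h \<noteq> 0 \<and> (\<forall>k. is_root k \<longrightarrow> val k h \<in> {-1, 0, 1})"
proof (intro iffI conjI allI impI)
  fix k assume e: "euler_elem br h" and k: "is_root k"
  obtain v where v: "v \<noteq> 0" "br h v = val k h *\<^sub>R v"
    using k h by (auto simp: is_root_def is_weight_def)
  then have "val k h \<in> lin_spectrum (br h)" by (auto simp: lin_spectrum_def)
  then show "val k h \<in> {-1, 0, 1}" using e unfolding euler_elem_def by blast
next
  assume R: "h \<noteq> 0 \<and> (\<forall>k. is_root k \<longrightarrow> val k h \<in> {-1, 0, 1})"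
  let ?E = "{v \<in> UNIV. \<forall>h\<in>A. \<exists>c. br h v = c *\<^sub>R v}"
  have lin: "linear (\<lambda>v. br h (br h (br h v)))"
    using linear_compose[OF linear_compose[OF br_linear br_linear] br_linear] by (simp add: o_def)
  have "br h (br h (br h v)) = br h v" if "v \<in> ?E" for v
  proof (cases "v = 0")
    case False
    have jw: "\<forall>h\<in>A. \<exists>c. br h v = c *\<^sub>R v" using that by simp
    from False jw show ?thesis
    proof (cases rule: joint_weight)
      case 1
      then show ?thesis by (simp add: h br_simps)
    next
      case (2 k)
      define c where "c = val k h"
      have "c \<in> {-1, 0, 1}" using R 2(1) by (simp add: c_def)
      then have "c * (c * c) = c" by auto
      then show ?thesis by (simp add: 2(2)[OF h] br_simps c_def[symmetric])
    qed
  qed (simp add: br_simps)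
  then have "br h (br h (br h v)) = br h v" for v
    using linear_eq_on_span[OF lin br_linear, of ?E h v] A_span[OF subspace_UNIV] by auto
  then show "euler_elem br h" using R by (simp add: euler_iff)
qed (simp add: euler_iff)

text \<open>What commutes with a regular \<open>r\<close> commutes with all of \<open>A\<close>, so
  the closest point lies in \<open>A\<close> by maximality. If a simple root were negative on it,
  its reflection would be closer to \<open>r\<close>.\<close>

lemma euler_dominant:
  assumes "euler_elem br x"
  obtains h where "h \<in> A" "euler_elem br h" "\<And>i. i \<in> {1..n} \<Longrightarrow> \<alpha> i h \<ge> 0"
proof -
  define r where "r = pt (\<lambda>_. 1)"
  have r: "r \<in> A" "\<And>i. i \<in> {1..n} \<Longrightarrow> \<alpha> i r = 1" using pt by (auto simp: r_def)
  obtain y where y: "euler_elem br y" "\<theta> y = - y" "br y r = 0"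
    and min: "\<And>z. euler_elem br z \<Longrightarrow> \<theta> z = - z \<Longrightarrow> ip (y - r) (y - r) \<le> ip (z - r) (z - r)"
    using euler_closest_in_p[OF assms A_p[OF r(1)]] by blast
  let ?S = "{v. br r v = 0}"
  have S: "subspace ?S" by (auto simp: subspace_def br_simps)
  have inv: "br h v \<in> ?S" if "h \<in> A" "v \<in> ?S" for h v
    using br_jacobi[of r h v] A_comm[OF r(1) that(1)] that by (simp add: br_simps)
  have yA: "y \<in> A"
  proof (rule A_maximal[OF y(2)])
    fix h assume h: "h \<in> A"
    have "br h v = 0" if v: "v \<in> ?S" "\<forall>h\<in>A. \<exists>c. br h v = c *\<^sub>R v" for v
    proof (cases "v = 0")
      case False
      from False v(2) show ?thesis
      proof (cases rule: joint_weight)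
        case (2 k)
        \<comment> \<open>On \<open>r\<close> a root takes its height as value, which is nonzero
          because the coefficients have one sign.\<close>
        have "val k r = of_int (\<Sum>i=1..n. k i)" by (simp add: val_def r(2) del: One_nat_def)
        moreover have "(\<Sum>i=1..n. k i) \<noteq> 0"
        proof
          assume s: "(\<Sum>i=1..n. k i) = 0"
          have "\<forall>i\<in>{1..n}. k i = 0"
          proof (cases "\<forall>i\<in>{1..n}. k i \<ge> 0")
            case True
            then show ?thesis using s sum_nonneg_eq_0_iff[of "{1..n}" k] by simp
          next
            case False
            then have "\<forall>i\<in>{1..n}. k i \<le> 0" using root_sign[OF 2(1)] by auto
            then show ?thesis using s sum_nonneg_eq_0_iff[of "{1..n}" "\<lambda>i. - k i"] by (simp add: sum_negf)
          qed
          then show False using 2(1) by (simp add: is_root_def)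
        qed
        ultimately have "val k r \<noteq> 0" by linarith
        then show ?thesis using 2(2)[OF r(1)] v(1) False by simp
      qed (use h in blast)
    qed (simp add: br_simps)
    then have "br h v = 0" if "v \<in> span {v \<in> ?S. \<forall>h\<in>A. \<exists>c. br h v = c *\<^sub>R v}" for v
      using linear_eq_0_on_span[OF br_linear _ that] by blast
    moreover have "y \<in> ?S" using y(3) br_anti[of r y] by simp
    ultimately show "br h y = 0" using A_span[OF S inv] by blast
  qed
  have "\<alpha> i y \<ge> 0" if i: "i \<in> {1..n}" for i
  proof -
    obtain \<phi> where \<phi>: "\<phi> \<in> inner_auts br" "\<And>h. h \<in> A \<Longrightarrow> \<phi> h = simple_refl i h"
      using refl_inner[OF i] by blast
    let ?z = "simple_refl i y"
    have z: "euler_elem br ?z" "?z \<in> A"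
      using euler_aut[OF lie_aut_inner[OF \<phi>(1)] y(1)] \<phi>(2)[OF yA] refl_A[OF i yA] by simp_all
    have "B ?z ?z = B y y" using killing_aut[OF lie_aut_inner[OF \<phi>(1)], of y y] \<phi>(2)[OF yA] by simp
    moreover have "ip (u - r) (u - r) = B u u - 2 * B u r + B r r" if "u \<in> A" for u
      using that r(1) A_subspace killing_sym[of r u]
      by (simp add: ip_p[OF A_p] subspace_diff killing_simps)
    ultimately have "B ?z r \<le> B y r" using min[OF z(1) A_p[OF z(2)]] z(2) yA by simp
    then have "2 * \<alpha> i y / \<alpha> i (dual_vec i) \<ge> 0" using B_refl[OF i yA r(1)] r(2)[OF i] by simp
    then show ?thesis using \<alpha>_T_pos[OF i] by (simp add: zero_le_divide_iff)
  qed
  then show thesis using that yA y(1) by blast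
qed

text \<open>Among the finitely many points of \<open>W\<close> conjugate to \<open>ptz x\<close>,
  one with the largest pairing with the dominant \<open>r\<close> cannot be improved by a simple
  reflection.\<close>

lemma stable_dominant:
  assumes W: "stable W" and x: "x \<in> W"
  obtains \<phi> y where "\<phi> \<in> inner_auts br" "y \<in> W" "\<phi> (ptz x) = ptz y" "\<And>i. i \<in> {1..n} \<Longrightarrow> y i \<ge> 0"
proof -
  define r where "r = pt (\<lambda>_. 1)"
  have r: "r \<in> A" "\<And>i. i \<in> {1..n} \<Longrightarrow> \<alpha> i r = 1" using pt by (auto simp: r_def)
  define Z where "Z = {ptz y | y. y \<in> W \<and> (\<exists>\<phi>\<in>inner_auts br. \<phi> (ptz x) = ptz y)}"
  have "Z \<subseteq> ptz ` ({1..n} \<rightarrow>\<^sub>E {-1, 0, 1})"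
  proof
    fix z assume "z \<in> Z"
    then obtain y where y: "z = ptz y" "y \<in> W" by (auto simp: Z_def)
    \<comment> \<open>Members of \<open>W\<close> may differ outside \<open>{1..n}\<close>;
      restricted to these indices, they form a finite set.\<close>
    have "z = ptz (restrict y {1..n})" by (rule ptz_eqI) (simp_all only: y ptz restrict_apply if_True)
    moreover have "restrict y {1..n} \<in> {1..n} \<rightarrow>\<^sub>E {-1, 0, 1}" using stable_entry[OF W y(2)] by (simp add: PiE_def Pi_def)
    ultimately show "z \<in> ptz ` ({1..n} \<rightarrow>\<^sub>E {-1, 0, 1})" by blast
  qed
  then have fin: "finite ((\<lambda>z. B z r) ` Z)"
    by (intro finite_imageI) (rule finite_subset, simp, intro finite_imageI finite_PiE, auto)
  have "ptz x \<in> Z" unfolding Z_def using x inner_auts.id_inn[of br] by (auto intro!: exI[of _ x] bexI[of _ id])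
  then have "Max ((\<lambda>z. B z r) ` Z) \<in> (\<lambda>z. B z r) ` Z" by (intro Max_in fin) blast
  then obtain z where zM: "Max ((\<lambda>z. B z r) ` Z) = B z r" "z \<in> Z" by (rule imageE)
  have z: "z \<in> Z" "B z' r \<le> B z r" if "z' \<in> Z" for z'
    using Max_ge[OF fin imageI[OF that]] zM by simp_all
  obtain y \<phi> where y: "z = ptz y" "y \<in> W" and \<phi>: "\<phi> \<in> inner_auts br" "\<phi> (ptz x) = ptz y"
    using zM(2) by (auto simp: Z_def)
  have "y i \<ge> 0" if i: "i \<in> {1..n}" for i
  proof -
    obtain \<psi> where \<psi>: "\<psi> \<in> inner_auts br" "\<And>h. h \<in> A \<Longrightarrow> \<psi> h = simple_refl i h"
      using refl_inner[OF i] by blast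
    obtain y' where y': "y' \<in> W" "\<forall>k\<in>{1..n}. y' k = y k - y i * a k i"
      using stable_step[OF W y(2) i] by (rule bexE)
    have eq: "(\<psi> \<circ> \<phi>) (ptz x) = ptz y'" using \<psi>(2)[OF ptz(1), of y] ptz_refl[OF i bspec[OF y'(2)]] \<phi>(2) by simp
    then have "ptz y' \<in> Z" unfolding Z_def using y'(1) inner_auts_comp[OF \<psi>(1) \<phi>(1)] by blast
    then have "B (simple_refl i (ptz y)) r \<le> B (ptz y) r" using z(2) y(1) ptz_refl[OF i bspec[OF y'(2)]] by simp
    then have "2 * \<alpha> i (ptz y) / \<alpha> i (dual_vec i) \<ge> 0" using B_refl[OF i ptz(1) r(1)] r(2)[OF i] by simp
    then show ?thesis using \<alpha>_T_pos[OF i] ptz(2)[OF i] by (simp add: zero_le_divide_iff)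
  qed
  then show thesis using that \<phi> y by blast
qed

text \<open>On a positive root \<open>h\<close> is nonnegative, on a negative one \<open>h'\<close>
  is nonpositive. So each root vector lies in the parabolic subalgebra of \<open>h\<close> or in the
  opposite one of \<open>h'\<close>, and weight \<open>0\<close> causes no trouble.\<close>

lemma parabolic_sum:
  assumes h: "h \<in> A" "euler_elem br h" "\<And>i. i \<in> {1..n} \<Longrightarrow> \<alpha> i h \<ge> 0"
    and h': "h' \<in> A" "euler_elem br h'" "\<And>i. i \<in> {1..n} \<Longrightarrow> \<alpha> i h' \<ge> 0"
  shows "\<exists>u v. y = u + v \<and> preserves_pos h u \<and> preserves_nonpos h' v"
proof -
  let ?U = "{u. preserves_pos h u}" and ?V = "{v. preserves_nonpos h' v}"
  have U: "subspace ?U" by (auto simp: subspace_def preserves_pos_def br_simps)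
  have V: "subspace ?V"
    by (auto simp: subspace_def preserves_nonpos_def br_simps linear_add[OF pos_proj_linear]
        linear_cmul[OF pos_proj_linear] linear_0[OF pos_proj_linear])
  let ?S = "{u + v | u v. u \<in> ?U \<and> v \<in> ?V}"
  have S: "subspace ?S" by (rule subspace_sums[OF U V])
  have "x \<in> ?S" if "\<forall>h\<in>A. \<exists>c. br h x = c *\<^sub>R x" for x
  proof (cases "x = 0")
    case True
    then show ?thesis using subspace_0[OF S] by simp
  next
    case False
    have "preserves_pos h x \<or> preserves_nonpos h' x"
      using False that
    proof (cases rule: joint_weight)
      case 1
      then show ?thesis using preserves_posI[OF h(2), of x 0] h(1) by simp
    next
      case (2 k)
      have e: "br h x = val k h *\<^sub>R x" "br h' x = val k h' *\<^sub>R x" using 2(2) h(1) h'(1) by auto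
      have v: "val k h \<in> {-1, 0, 1}" "val k h' \<in> {-1, 0, 1}"
        using h h' 2(1) euler_A_iff by blast+
      have "\<not> (val k h < 0 \<and> val k h' > 0)"
      proof (cases "\<forall>i\<in>{1..n}. k i \<ge> 0")
        case True
        then have "val k h \<ge> 0" unfolding val_def using h(3) by (intro sum_nonneg mult_nonneg_nonneg) auto
        then show ?thesis by simp
      next
        case False
        then have "\<forall>i\<in>{1..n}. k i \<le> 0" using root_sign[OF 2(1)] by blast
        then have "val k h' \<le> 0" unfolding val_def using h'(3) by (intro sum_nonpos mult_nonpos_nonneg) auto
        then show ?thesis by simp
      qed
      then have "(val k h = 0 \<or> val k h = 1) \<or> (val k h' = 0 \<or> val k h' = -1)" using v by auto
      then show ?thesis using preserves_posI[OF h(2) e(1)] preserves_nonposI[OF h'(2) e(2)] by blast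
    qed
    then show ?thesis
    proof
      assume "preserves_pos h x"
      then show ?thesis using subspace_0[OF V] by (intro CollectI exI[of _ x] exI[of _ 0]) simp
    next
      assume "preserves_nonpos h' x"
      then show ?thesis using subspace_0[OF U] by (intro CollectI exI[of _ 0] exI[of _ x]) simp
    qed
  qed
  then have "{x \<in> UNIV. \<forall>h\<in>A. \<exists>c. br h x = c *\<^sub>R x} \<subseteq> ?S" by blast
  then have "span {x \<in> UNIV. \<forall>h\<in>A. \<exists>c. br h x = c *\<^sub>R x} \<subseteq> ?S" by (rule span_minimal) (rule S)
  moreover have "y \<in> span {x \<in> UNIV. \<forall>h\<in>A. \<exists>c. br h x = c *\<^sub>R x}"
    using A_span[OF subspace_UNIV] by (rule subsetD) simp_all
  ultimately have "y \<in> ?S" by (rule subsetD)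
  then show ?thesis by blast
qed

text \<open>The volume form of the \<open>1\<close>-eigenspace of \<open>ad h'\<close>, composed with the projection along the
  other eigenspaces, plays the role of a highest weight functional on an exterior power of the
  Lie algebra, and a basis of the \<open>1\<close>-eigenspace of \<open>ad h\<close> that of a highest weight vector.
  If the weights differ, the functional vanishes on the module generated by the vector.\<close>
lemma dominant_euler_conjugate:
  assumes h: "h \<in> A" "euler_elem br h" "\<And>i. i \<in> {1..n} \<Longrightarrow> \<alpha> i h \<ge> 0"
    and h': "h' \<in> A" "euler_elem br h'" "\<And>i. i \<in> {1..n} \<Longrightarrow> \<alpha> i h' \<ge> 0"
    and \<phi>: "\<phi> \<in> inner_auts br" "\<phi> h = h'"
    and x: "x \<noteq> 0" "br h x = x" "br h' x = 0"
  shows False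
proof -
  let ?U = "{x. br h' x = x}"
  let ?P = "pos_proj h'"
  have P_lin: "linear ?P" by (rule pos_proj_linear)
  have U: "subspace ?U" by (auto simp: subspace_def br_simps)
  have PU: "?P x \<in> ?U" for x using euler_cube[OF h'(2)] by (simp add: pos_proj_def br_simps add.commute)
  have P_id: "?P x = x" if "x \<in> ?U" for x using that by (simp add: pos_proj_def flip: scaleR_2)
  obtain E where E: "E \<subseteq> ?U" "independent E" "?U \<subseteq> span E" "card E = dim ?U" by (rule basis_exists)
  have sp: "span E = ?U" using span_minimal[OF E(1) U] E(3) by blast
  have finE: "finite E" using E(2) by (rule independent_imp_finite)
  define d where "d = card E"
  obtain f where f: "bij_betw f {..<d} E"
    using ex_bij_betw_nat_finite[OF finE] by (auto simp: d_def atLeast0LessThan)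
  have fE: "f i \<in> E" if "i < d" for i using f that by (auto simp: bij_betw_def)
  have fU: "f i \<in> ?U" if "i < d" for i using fE[OF that] E(1) by blast
  define \<xi> where "\<xi> i x = representation E (?P x) (f i)" for i x
  have \<xi>_lin: "linear (\<xi> i)" for i
  proof (rule linearI)
    show "\<xi> i (x + y) = \<xi> i x + \<xi> i y" for x y
      using representation_add[OF E(2), of "?P y" "?P x"] PU by (simp add: \<xi>_def linear_add[OF P_lin] sp)
    show "\<xi> i (c *\<^sub>R x) = c *\<^sub>R \<xi> i x" for c x
      using representation_scale[OF E(2), of "?P x"] PU by (simp add: \<xi>_def linear_cmul[OF P_lin] sp)
  qed
  have expand: "?P x = (\<Sum>m<d. \<xi> m x *\<^sub>R f m)" for x
  proof -
    have "?P x = (\<Sum>b\<in>E. representation E (?P x) b *\<^sub>R b)"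
      using sum_representation_eq[OF E(2) _ finE subset_refl, of "?P x"] PU[of x] sp by simp
    also have "\<dots> = (\<Sum>m<d. \<xi> m x *\<^sub>R f m)"
      unfolding \<xi>_def by (rule sum.reindex_bij_betw[OF f, symmetric])
    finally show ?thesis .
  qed
  have dual: "\<xi> i (f j) = (if i = j then 1 else 0)" if "i < d" "j < d" for i j
    using representation_basis[OF E(2) fE[OF that(2)]] P_id[OF fU[OF that(2)]] f that
    by (auto simp: \<xi>_def bij_betw_def inj_on_def)
  have \<xi>_P: "\<xi> i x = 0" if "?P x = 0" for i x using that representation_zero[of E] by (simp add: \<xi>_def)
  have aut: "linear \<phi>" "bij \<phi>" "\<And>x y. \<phi> (br x y) = br (\<phi> x) (\<phi> y)"
    using lie_aut_inner[OF \<phi>(1)] by (auto simp: lie_aut_def)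
  \<comment> \<open>\<open>\<phi>\<close> carries the \<open>1\<close>-eigenspace of
    \<open>h\<close> onto that of \<open>h'\<close>; pulling back the basis \<open>f\<close> makes
    \<open>f\<close> the image of \<open>e\<close>, and on \<open>f\<close> the determinant is
    \<open>1\<close>.\<close>
  define e where "e i = inv \<phi> (f i)" for i
  have \<phi>e: "\<phi> (e i) = f i" for i using aut(2) by (simp add: e_def bij_is_surj surj_f_inv_f)
  have inj: "x = y" if "\<phi> x = \<phi> y" for x y using aut(2) that by (simp add: bij_is_inj inj_eq)
  have e_expand: "w = (\<Sum>m<d. \<xi> m (\<phi> w) *\<^sub>R e m)" if "br h w = w" for w
  proof (rule inj)
    have "\<phi> w \<in> ?U" using aut(3)[of h w] that \<phi>(2) by simp
    then show "\<phi> w = \<phi> (\<Sum>m<d. \<xi> m (\<phi> w) *\<^sub>R e m)"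
      using expand[of "\<phi> w"] P_id by (simp add: linear_sum[OF aut(1)] linear_cmul[OF aut(1)] \<phi>e)
  qed
  have e_eig: "br h (e i) = e i" if "i < d" for i
    by (rule inj) (use fU[OF that] in \<open>simp add: aut(3) \<phi>(2) \<phi>e\<close>)
  \<comment> \<open>The vectors \<open>e\<close> span the \<open>1\<close>-eigenspace of
    \<open>h\<close>. Expanding \<open>w\<close> in them, every term but one has a repeated
    argument.\<close>
  have replace: "G (e(i := w)) = \<xi> i (\<phi> w) * G e"
    if G: "multilin d G" "alternating d G" and i: "i < d" and w: "br h w = w" for G i w
  proof -
    have lin: "linear (\<lambda>u. G (e(i := u)))" by (rule multilin_linear[OF G(1) i])
    have "G (e(i := w)) = (\<Sum>m<d. \<xi> m (\<phi> w) * G (e(i := e m)))"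
      by (subst e_expand[OF w]) (simp add: linear_sum[OF lin] linear_cmul[OF lin])
    also have "\<dots> = (\<Sum>m<d. if m = i then \<xi> i (\<phi> w) * G e else 0)"
    proof (rule sum.cong[OF refl])
      fix m assume m: "m \<in> {..<d}"
      show "\<xi> m (\<phi> w) * G (e(i := e m)) = (if m = i then \<xi> i (\<phi> w) * G e else 0)"
        using alternatingD[OF G(2) i, of m "e(i := e m)"] m by simp
    qed
    finally show ?thesis using i by simp
  qed
  let ?D = "alt_det d \<xi>"
  have D: "multilin d ?D" "alternating d ?D" by (rule multilin_alt_det[OF \<xi>_lin], rule alternating_alt_det)
  \<comment> \<open>The vector \<open>x\<close> lies in the \<open>1\<close>-eigenspace of
    \<open>h\<close> and is killed by \<open>?P\<close>. Exchanging it into \<open>e\<close>, at a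
    slot where its coefficient is nonzero, makes the determinant vanish.\<close>
  have "?D e = 0"
  proof -
    have "\<exists>i<d. \<xi> i (\<phi> x) \<noteq> 0"
    proof (rule ccontr)
      assume "\<not> (\<exists>i<d. \<xi> i (\<phi> x) \<noteq> 0)"
      then have "x = 0" using e_expand[OF x(2)] by simp
      then show False using x(1) by simp
    qed
    then obtain i where i: "i < d" "\<xi> i (\<phi> x) \<noteq> 0" by blast
    have "?P x = 0" using x(3) by (simp add: pos_proj_def br_simps)
    then have "(\<Prod>k<d. \<xi> (p k) ((e(i := x)) k)) = 0" for p
      using i(1) \<xi>_P by (intro prod_zero) auto
    then have "?D (e(i := x)) = 0" by (simp only: alt_det_def mult_zero_right sum.neutral_const)
    then show ?thesis using replace[OF D i(1) x(2)] i(2) by simp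
  qed
  moreover have "der d (br u) G e = 0"
    if "preserves_pos h u" "multilin d G" "alternating d G" "G e = 0" for u G
  proof -
    have "br h (br u (e i)) = br u (e i)" if "i < d" for i
      using \<open>preserves_pos h u\<close> e_eig[OF that] by (simp add: preserves_pos_def)
    then show ?thesis using replace[OF that(2,3)] that(4) by (simp add: der_def)
  qed
  moreover have "\<exists>c. der d (br v) ?D = (\<lambda>x. c * ?D x)" if v: "preserves_nonpos h' v" for v
  proof -
    \<comment> \<open>The functionals factor through \<open>?P\<close>, whose kernel
      \<open>br v\<close> preserves, so the transpose of \<open>br v\<close> maps their span into
      itself; \<open>alt_det_der\<close> then yields the trace as scalar.\<close>
    have "\<xi> i (br v u) = (\<Sum>m<d. \<xi> i (br v (f m)) * \<xi> m u)" for i u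
    proof -
      have "?P (?P u) = ?P u" using P_id[OF PU] .
      then have "?P (u - ?P u) = 0" by (simp add: linear_diff[OF P_lin])
      then have "?P (br v (u - ?P u)) = 0" using v by (simp add: preserves_nonpos_def)
      then have "\<xi> i (br v (u - ?P u)) = 0" by (rule \<xi>_P)
      then have "\<xi> i (br v u) = \<xi> i (br v (?P u))" by (simp add: br_simps linear_diff[OF \<xi>_lin])
      also have "\<dots> = (\<Sum>m<d. \<xi> i (br v (f m)) * \<xi> m u)"
        unfolding expand[of u]
        by (simp add: linear_sum[OF br_linear] linear_sum[OF \<xi>_lin] br_simps linear_cmul[OF \<xi>_lin] mult.commute)
      finally show ?thesis .
    qed
    from alt_det_der[of d \<xi> "br v" "\<lambda>i m. \<xi> i (br v (f m))", OF this]
    show ?thesis by blast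
  qed
  ultimately have "word d ys ?D e = 0" for ys
    using words_vanish[OF D, of e "preserves_pos h" "preserves_nonpos h'" ys] parabolic_sum[OF h h'] by blast
  from words_vanish_inner[OF \<phi>(1) D(1) this, of "[]"] have "?D f = 0" by (simp add: word_Nil \<phi>e)
  moreover have "?D f = 1" by (rule alt_det_dual) (rule dual)
  ultimately show False by simp
qed

text \<open>The witness is a root vector of \<open>\<alpha> j\<close>: it is fixed by
  \<open>br (H j)\<close> and killed by \<open>br (H l)\<close>.\<close>

lemma coweights_not_conjugate:
  assumes "j \<in> {1..n}" "l \<in> {1..n}" "j \<noteq> l" "euler_elem br (H j)" "euler_elem br (H l)"
    and "\<phi> \<in> inner_auts br"
  shows "\<phi> (H j) \<noteq> H l"
proof
  assume eq: "\<phi> (H j) = H l"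
  obtain x where x: "x \<noteq> 0" "\<And>h. h \<in> A \<Longrightarrow> br h x = \<alpha> j h *\<^sub>R x"
    using \<alpha>_root[OF assms(1)] by (auto simp: restricted_roots_def)
  show False
  proof (rule dominant_euler_conjugate[OF H(1)[OF assms(1)] assms(4) _ H(1)[OF assms(2)] assms(5) _ assms(6) eq x(1)])
    show "br (H j) x = x" "br (H l) x = 0"
      using x(2) H assms(1-3) by simp_all
  qed (simp_all add: H assms(1,2) del: atLeastAtMost_iff One_nat_def)
qed

end

section \<open>Highest roots and minuscule coweights\<close>

lemma cartan_entry_diag: "cartan_entry T n i i = 2"
  by (simp add: cartan_entry_def)

text \<open>The closure properties by which roots are produced, detached from the Lie algebra; the
  middle clause says that only indices in \<open>{1..n}\<close> count.\<close>

definition root_closed :: "rs_type \<Rightarrow> nat \<Rightarrow> ((nat \<Rightarrow> int) \<Rightarrow> bool) \<Rightarrow> bool" where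
  "root_closed T n P \<longleftrightarrow> (\<forall>i\<in>{1..n}. P (\<lambda>l. if l = i then 1 else 0)) \<and>
     (\<forall>k k'. P k \<longrightarrow> (\<forall>i\<in>{1..n}. k' i = k i) \<longrightarrow> P k') \<and>
     (\<forall>k. \<forall>i\<in>{1..n}. P k \<longrightarrow> P (k(i := k i - (\<Sum>l=1..n. k l * cartan_entry T n l i))))"

lemma root_closed_simple: "root_closed T n P \<Longrightarrow> i \<in> {1..n} \<Longrightarrow> P (\<lambda>l. if l = i then 1 else 0)"
  unfolding root_closed_def by blast

lemma root_closed_cong: "root_closed T n P \<Longrightarrow> P k \<Longrightarrow> (\<And>i. i \<in> {1..n} \<Longrightarrow> k' i = k i) \<Longrightarrow> P k'"
  unfolding root_closed_def by blast

lemma root_closed_refl: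
  assumes "root_closed T n P" "P k" "i \<in> {1..n}"
  shows "P (k(i := k i - (\<Sum>l=1..n. k l * cartan_entry T n l i)))"
  using assms unfolding root_closed_def by blast

text \<open>Cuts the sum down to a small set \<open>N\<close>, usually \<open>i\<close> and its
  neighbours, so that a step in a diagram of arbitrary rank becomes a finite computation.\<close>

lemma root_closed_step:
  assumes P: "root_closed T n P" "P k" and i: "i \<in> {1..n}" and N: "N \<subseteq> {1..n}"
    "\<And>l. l \<in> {1..n} \<Longrightarrow> l \<notin> N \<Longrightarrow> k l = 0 \<or> cartan_entry T n l i = 0"
    and k': "k' i = k i - (\<Sum>l\<in>N. k l * cartan_entry T n l i)"
      "\<And>j. j \<in> {1..n} \<Longrightarrow> j \<noteq> i \<Longrightarrow> k' j = k j"
  shows "P k'"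
proof (rule root_closed_cong[OF P(1) root_closed_refl[OF P i]])
  fix j assume "j \<in> {1..n}"
  have "(\<Sum>l=1..n. k l * cartan_entry T n l i) = (\<Sum>l\<in>N. k l * cartan_entry T n l i)"
    using N by (intro sum.mono_neutral_right) auto
  then show "k' j = (k(i := k i - (\<Sum>l=1..n. k l * cartan_entry T n l i))) j"
    using k'(1) k'(2)[OF \<open>j \<in> {1..n}\<close>] by (cases "j = i") simp_all
qed

lemma chain_root:
  assumes "root_closed T n P" "1 \<le> m" "m \<le> n"
    and edge: "\<And>i. 1 \<le> i \<Longrightarrow> i < m \<Longrightarrow> cartan_entry T n i (Suc i) = -1"
    and nonedge: "\<And>i l. 1 \<le> l \<Longrightarrow> l < i \<Longrightarrow> i < m \<Longrightarrow> cartan_entry T n l (Suc i) = 0"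
  shows "P (\<lambda>i. if i \<le> m then 1 else 0)"
  using assms(2,3) edge nonedge
proof (induction m rule: nat_induct_at_least)
  case base
  show ?case
    by (rule root_closed_cong[OF assms(1) root_closed_simple[OF assms(1), of 1]]) (use base in auto)
next
  case (Suc m)
  have IH: "P (\<lambda>i. if i \<le> m then 1 else 0)" using Suc by simp
  show ?case
  proof (rule root_closed_step[OF assms(1) IH, of "Suc m" "{m, Suc m}"])
    show "(if l \<le> m then 1 else 0) = (0::int) \<or> cartan_entry T n l (Suc m) = 0"
      if "l \<in> {1..n}" "l \<notin> {m, Suc m}" for l
      using that Suc.prems(3)[of l m] by auto
  qed (use Suc in \<open>auto simp: cartan_entry_diag\<close>)
qed

lemma highest_A:
  assumes "root_closed TA n P" "n \<ge> 1"
  shows "P (\<lambda>i. if i \<le> n then 1 else 0)"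
  by (rule chain_root[OF assms order_refl]) (auto simp: cartan_entry_def dynkin_edge_def)

text \<open>Starting from the long simple root, reflect in \<open>n - 1\<close>,
  \<open>n - 2\<close> and so on. The Cartan entry \<open>-2\<close> at the double bond creates the
  first coefficient \<open>2\<close>, and the simple bonds pass it on.\<close>

lemma highest_C:
  assumes "root_closed TC n P" "n \<ge> 2"
  shows "d < n \<Longrightarrow> P (\<lambda>i. if i = n then 1 else if n \<le> i + d then 2 else 0)"
proof (induction d)
  case 0
  show ?case
    by (rule root_closed_cong[OF assms(1) root_closed_simple[OF assms(1), of n]]) (use assms in auto)
next
  case (Suc d)
  define i where "i = n - Suc d"
  have i: "1 \<le> i" "i < n" "d = n - Suc i" using Suc.prems by (auto simp: i_def)
  have IH: "P (\<lambda>i. if i = n then 1 else if n \<le> i + d then 2 else 0)" using Suc by simp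
  show ?case
    by (rule root_closed_step[OF assms(1) IH, of i "{i, Suc i}"])
      (use i in \<open>auto simp: cartan_entry_def dynkin_edge_def\<close>)
qed

text \<open>The double of the last simple root is not in the Weyl orbit of a simple root, so it
  enters as a hypothesis; reflections spread its coefficient \<open>2\<close> along the
  chain.\<close>

lemma highest_BC:
  assumes "root_closed TBC n P" "n \<ge> 1" and double: "P (\<lambda>l. if l = n then 2 else 0)"
  shows "d < n \<Longrightarrow> P (\<lambda>i. if n \<le> i + d then 2 else 0)"
proof (induction d)
  case 0
  show ?case by (rule root_closed_cong[OF assms(1) double]) (use assms in auto)
next
  case (Suc d)
  define i where "i = n - Suc d"
  have i: "1 \<le> i" "i < n" "d = n - Suc i" using Suc.prems by (auto simp: i_def)
  have IH: "P (\<lambda>i. if n \<le> i + d then 2 else 0)" using Suc by simp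
  show ?case
    by (rule root_closed_step[OF assms(1) IH, of i "{i, Suc i}"])
      (use i in \<open>auto simp: cartan_entry_def dynkin_edge_def\<close>)
qed

text \<open>Reflecting the sum of the first \<open>n - 1\<close> simple roots in \<open>n\<close>
  produces the last coefficient \<open>2\<close>; reflections in \<open>n - 1\<close> down to
  \<open>2\<close> raise the other coefficients except the first.\<close>

lemma highest_B:
  assumes "root_closed TB n P" "n \<ge> 2"
  shows "d + 2 \<le> n \<Longrightarrow> P (\<lambda>i. if n \<le> i + d then 2 else 1)"
proof (induction d)
  case 0
  have "P (\<lambda>i. if i \<le> n - 1 then 1 else 0)"
    by (rule chain_root[OF assms(1)]) (use assms in \<open>auto simp: cartan_entry_def dynkin_edge_def\<close>)
  then show ?case
    by (rule root_closed_step[OF assms(1), of _ n "{n - 1, n}"])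
      (use assms in \<open>auto simp: cartan_entry_def dynkin_edge_def\<close>)
next
  case (Suc d)
  define i where "i = n - Suc d"
  have i: "2 \<le> i" "i < n" "d = n - Suc i" using Suc.prems by (auto simp: i_def)
  obtain p where p: "i = Suc p" "1 \<le> p" using i(1) by (cases i) auto
  have IH: "P (\<lambda>i. if n \<le> i + d then 2 else 1)" using Suc by simp
  show ?case
    by (rule root_closed_step[OF assms(1) IH, of i "{p, Suc p, Suc (Suc p)}"])
      (use i p in \<open>auto simp: cartan_entry_def dynkin_edge_def\<close>)
qed

text \<open>The chain up to \<open>n - 1\<close> is extended over the fork to \<open>n\<close>,
  giving all coefficients \<open>1\<close>. The three neighbours of the node \<open>n - 2\<close>
  raise it to \<open>2\<close>, and the nodes down to \<open>2\<close> follow.\<close>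

lemma highest_D:
  assumes "root_closed TD n P" "n \<ge> 4"
  shows "d + 3 \<le> n \<Longrightarrow> P (\<lambda>i. if n - 1 \<le> i then 1 else if n \<le> Suc (i + d) then 2 else 1)"
proof (induction d)
  case 0
  have "P (\<lambda>i. if i \<le> n - 1 then 1 else 0)"
    by (rule chain_root[OF assms(1)]) (use assms in \<open>auto simp: cartan_entry_def dynkin_edge_def\<close>)
  then show ?case
    by (rule root_closed_step[OF assms(1), of _ n "{n - 2, n}"])
      (use assms in \<open>auto simp: cartan_entry_def dynkin_edge_def\<close>)
next
  case (Suc d)
  define i where "i = n - Suc (Suc d)"
  have i: "2 \<le> i" "i + 2 \<le> n" "d = n - Suc (Suc i)" using Suc.prems by (auto simp: i_def)
  obtain p where p: "i = Suc p" "1 \<le> p" using i(1) by (cases i) auto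
  have IH: "P (\<lambda>i. if n - 1 \<le> i then 1 else if n \<le> Suc (i + d) then 2 else 1)" using Suc by simp
  show ?case
  proof (cases "i + 2 = n")
    case True
    show ?thesis
      by (rule root_closed_step[OF assms(1) IH, of i "{p, Suc p, Suc (Suc p), Suc (Suc (Suc p))}"])
        (use i p True in \<open>auto simp: cartan_entry_def dynkin_edge_def\<close>)
  next
    case False
    show ?thesis
      by (rule root_closed_step[OF assms(1) IH, of i "{p, Suc p, Suc (Suc p)}"])
        (use i p False in \<open>auto simp: cartan_entry_def dynkin_edge_def\<close>)
  qed
qed

definition list_root_refl :: "rs_type \<Rightarrow> nat \<Rightarrow> nat \<Rightarrow> int list \<Rightarrow> int list" where
  "list_root_refl T n i xs =
     xs[i - 1 := xs ! (i - 1) - (\<Sum>l\<leftarrow>[1..<Suc n]. xs ! (l - 1) * cartan_entry T n l i)]"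

lemma root_closed_list:
  assumes P: "root_closed T n P" and "\<forall>i\<in>set ws. 1 \<le> i \<and> i \<le> n"
    and "length xs = n" "P (\<lambda>i. xs ! (i - 1))"
  shows "P (\<lambda>i. fold (list_root_refl T n) ws xs ! (i - 1))"
  using assms(2-)
proof (induction ws arbitrary: xs)
  case (Cons i ws)
  let ?k = "\<lambda>i. xs ! (i - 1)"
  have i: "1 \<le> i" "i \<le> n" using Cons.prems by auto
  have s: "(\<Sum>l=1..n. ?k l * cartan_entry T n l i) = (\<Sum>l\<leftarrow>[1..<Suc n]. xs ! (l - 1) * cartan_entry T n l i)"
    by (simp add: sum_list_distinct_conv_sum_set atLeastLessThanSuc_atLeastAtMost del: upt_Suc)
  have "i \<in> {1..n}" using i by simp
  from root_closed_refl[OF P Cons.prems(3) this] have "P (\<lambda>j. list_root_refl T n i xs ! (j - 1))"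
  proof (rule root_closed_cong[OF P])
    fix j assume "j \<in> {1..n}"
    then show "list_root_refl T n i xs ! (j - 1)
        = (?k(i := ?k i - (\<Sum>l=1..n. ?k l * cartan_entry T n l i))) j"
      unfolding s list_root_refl_def using i Cons.prems(2) by (auto simp: nth_list_update)
  qed
  then show ?case using Cons by (simp add: list_root_refl_def)
qed simp

lemma highest_list:
  assumes P: "root_closed T n P" and "1 \<le> j" "j \<le> n"
    and "list_all (\<lambda>i. 1 \<le> i \<and> i \<le> n) ws"
    and ks: "list_all (\<lambda>i. let c = fold (list_root_refl T n) ws (map (\<lambda>l. if l = j then 1 else 0) [1..<Suc n]) ! (i - 1)
      in 1 \<le> c \<and> (i \<notin> euler_indices T n \<longrightarrow> 2 \<le> c)) [1..<Suc n]"
  shows "\<exists>k. P k \<and> (\<forall>i\<in>{1..n}. 1 \<le> k i \<and> (i \<notin> euler_indices T n \<longrightarrow> 2 \<le> k i))"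
proof -
  let ?xs = "map (\<lambda>l. if l = j then 1 else 0) [1..<Suc n]"
  have "P (\<lambda>i. ?xs ! (i - 1))"
    by (rule root_closed_cong[OF P root_closed_simple[OF P, of j]]) (use assms(2,3) in \<open>auto simp del: upt_Suc\<close>)
  then have "P (\<lambda>i. fold (list_root_refl T n) ws ?xs ! (i - 1))"
    using assms(4) by (intro root_closed_list[OF P]) (simp_all add: list_all_iff)
  moreover have "i \<in> set [1..<Suc n]" if "i \<in> {1..n}" for i using that by auto
  ultimately show ?thesis using ks unfolding list_all_iff Let_def by blast
qed

text \<open>In the exceptional cases, \<open>ws\<close> lists simple reflections that take the simple root \<open>j\<close> to the
  highest root.\<close>
lemma highest_root:
  assumes "rank_ok T n" and P: "root_closed T n P"
    and double: "T = TBC \<Longrightarrow> P (\<lambda>l. if l = n then 2 else 0)"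
  shows "\<exists>k. P k \<and> (\<forall>i\<in>{1..n}. 1 \<le> k i \<and> (i \<notin> euler_indices T n \<longrightarrow> 2 \<le> k i))"
proof (cases T)
  case TA
  then show ?thesis using highest_A[of n P] assms
    by (intro exI[of _ "\<lambda>i. if i \<le> n then 1 else 0"]) (auto simp: rank_ok_def euler_indices_def)
next
  case TB
  then have n: "n \<ge> 2" using assms(1) by (simp add: rank_ok_def)
  show ?thesis using highest_B[OF P[unfolded TB] n, of "n - 2"] n
    by (intro exI[of _ "\<lambda>i. if n \<le> i + (n - 2) then 2 else 1"]) (auto simp: TB euler_indices_def)
next
  case TC
  then have n: "n \<ge> 2" using assms(1) by (simp add: rank_ok_def)
  show ?thesis using highest_C[OF P[unfolded TC] n, of "n - 1"] n
    by (intro exI[of _ "\<lambda>i. if i = n then 1 else if n \<le> i + (n - 1) then 2 else 0"])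
      (auto simp: TC euler_indices_def)
next
  case TD
  then have n: "n \<ge> 4" using assms(1) by (simp add: rank_ok_def)
  show ?thesis using highest_D[OF P[unfolded TD] n, of "n - 3"] n
    by (intro exI[of _ "\<lambda>i. if n - 1 \<le> i then 1 else if n \<le> Suc (i + (n - 3)) then 2 else 1"])
      (auto simp: TD euler_indices_def)
next
  case TE
  then consider "n = 6" | "n = 7" | "n = 8" using assms(1) by (auto simp: rank_ok_def)
  then show ?thesis
  proof cases
    case 1
    show ?thesis
      by (rule highest_list[OF P, where j = 1 and ws = "[3, 4, 2, 5, 4, 3, 6, 5, 4, 2]"], unfold 1 TE)
        code_simp+
  next
    case 2
    show ?thesis
      by (rule highest_list[OF P, where j = 1 and ws = "[3, 4, 2, 5, 4, 3, 6, 5, 4, 2, 7, 6, 5, 4, 3, 1]"],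
          unfold 2 TE) code_simp+
  next
    case 3
    show ?thesis
      by (rule highest_list[OF P, where j = 1 and ws = "[3, 4, 2, 5, 4, 3, 6, 5, 4, 2, 7, 6, 5, 4, 3, 1,
          8, 7, 6, 5, 4, 2, 3, 4, 5, 6, 7, 8]"], unfold 3 TE) code_simp+
  qed
next
  case TF
  then have n: "n = 4" using assms(1) by (simp add: rank_ok_def)
  show ?thesis
    by (rule highest_list[OF P, where j = 1 and ws = "[2, 3, 2, 4, 3, 2, 1]"], unfold n TF) code_simp+
next
  case TG
  then have n: "n = 2" using assms(1) by (simp add: rank_ok_def)
  show ?thesis
    by (rule highest_list[OF P, where j = 2 and ws = "[1, 2]"], unfold n TG) code_simp+
next
  case TBC
  then have n: "n \<ge> 1" using assms(1) by (simp add: rank_ok_def)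
  show ?thesis using highest_BC[OF P[unfolded TBC] n double[OF TBC], of "n - 1"] n
    by (intro exI[of _ "\<lambda>i. if n \<le> i + (n - 1) then 2 else 0"]) (auto simp: TBC euler_indices_def)
qed

text \<open>The index of \<open>- w\<^sub>0 h\<^sub>j\<close>, where \<open>w\<^sub>0\<close> is the longest element of the Weyl group.\<close>
definition opp :: "rs_type \<Rightarrow> nat \<Rightarrow> nat \<Rightarrow> nat" where
  "opp T n j = (case T of TA \<Rightarrow> n + 1 - j
     | TD \<Rightarrow> if odd n \<and> j = n then n - 1 else if odd n \<and> j = n - 1 then n else j
     | TE \<Rightarrow> if n = 6 then 7 - j else j
     | _ \<Rightarrow> j)"

text \<open>A set of points, given by the values of the simple roots, that is invariant under the
  simple reflections, such as the Weyl group orbit of a minuscule coweight.\<close>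
definition minuscule :: "rs_type \<Rightarrow> nat \<Rightarrow> nat \<Rightarrow> (nat \<Rightarrow> int) set \<Rightarrow> bool" where
  "minuscule T n j W \<longleftrightarrow>
     (\<forall>x\<in>W. \<forall>i\<in>{1..n}. x i \<in> {-1, 0, 1} \<and>
        (\<exists>y\<in>W. \<forall>k\<in>{1..n}. y k = x k - x i * cartan_entry T n k i)) \<and>
     (\<exists>x\<in>W. \<forall>i\<in>{1..n}. x i = (if i = j then 1 else 0)) \<and>
     (\<exists>x\<in>W. \<forall>i\<in>{1..n}. x i = (if i = opp T n j then - 1 else 0)) \<and>
     (\<forall>x\<in>W. (\<forall>i\<in>{1..n}. x i \<ge> 0) \<longrightarrow> (\<forall>i\<in>{1..n}. x i = (if i = j then 1 else 0)))"

lemma minusculeI: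
  assumes "\<And>x i. x \<in> W \<Longrightarrow> i \<in> {1..n} \<Longrightarrow> x i \<in> {-1, 0, 1}"
    and "\<And>x i. x \<in> W \<Longrightarrow> i \<in> {1..n} \<Longrightarrow> \<exists>y\<in>W. \<forall>k\<in>{1..n}. y k = x k - x i * cartan_entry T n k i"
    and "x\<^sub>1 \<in> W" "\<And>i. i \<in> {1..n} \<Longrightarrow> x\<^sub>1 i = (if i = j then 1 else 0)"
    and "x\<^sub>2 \<in> W" "\<And>i. i \<in> {1..n} \<Longrightarrow> x\<^sub>2 i = (if i = opp T n j then - 1 else 0)"
    and "\<And>x i. x \<in> W \<Longrightarrow> (\<And>i. i \<in> {1..n} \<Longrightarrow> x i \<ge> 0) \<Longrightarrow> i \<in> {1..n} \<Longrightarrow> x i = (if i = j then 1 else 0)"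
  shows "minuscule T n j W"
  unfolding minuscule_def
proof (intro conjI ballI impI)
  show "\<exists>x\<in>W. \<forall>i\<in>{1..n}. x i = (if i = j then 1 else 0)" using assms(3,4) by blast
  show "\<exists>x\<in>W. \<forall>i\<in>{1..n}. x i = (if i = opp T n j then - 1 else 0)" using assms(5,6) by blast
qed (use assms(1,2,7) in blast)+

lemma minusculeD:
  assumes "minuscule T n j W"
  shows "\<exists>x\<in>W. \<forall>i\<in>{1..n}. x i = (if i = j then 1 else 0)"
    and "\<exists>x\<in>W. \<forall>i\<in>{1..n}. x i = (if i = opp T n j then - 1 else 0)"
    and "\<forall>x\<in>W. (\<forall>i\<in>{1..n}. x i \<ge> 0) \<longrightarrow> (\<forall>i\<in>{1..n}. x i = (if i = j then 1 else 0))"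
  unfolding atomize_conj using assms[unfolded minuscule_def] by (rule conjunct2)

section \<open>Minuscule orbits by computation, for the exceptional types\<close>

definition list_point_refl :: "rs_type \<Rightarrow> nat \<Rightarrow> nat \<Rightarrow> int list \<Rightarrow> int list" where
  "list_point_refl T n i xs =
     map (\<lambda>k. xs ! (k - 1) - xs ! (i - 1) * cartan_entry T n k i) [1..<Suc n]"

text \<open>A reflection fixes the points at which its simple root is \<open>0\<close>, so
  closedness of the list is tested at nonzero entries only.\<close>

lemma minuscule_list:
  assumes closed: "list_all (\<lambda>xs. list_all (\<lambda>i. xs ! (i - 1) = 0 \<or>
        (xs ! (i - 1) = 1 \<or> xs ! (i - 1) = - 1) \<and> list_point_refl T n i xs \<in> set L) [1..<Suc n]) L"
    and "map (\<lambda>i. if i = j then 1 else 0) [1..<Suc n] \<in> set L"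
    and "map (\<lambda>i. if i = opp T n j then - 1 else 0) [1..<Suc n] \<in> set L"
    and dom: "list_all (\<lambda>xs. list_all (\<lambda>v. 0 \<le> v) xs \<longrightarrow> xs = map (\<lambda>i. if i = j then 1 else 0) [1..<Suc n]) L"
  shows "minuscule T n j {x. map x [1..<Suc n] \<in> set L}"
proof -
  have nth: "map x [1..<Suc n] ! (i - 1) = x i" if "i \<in> {1..n}" for x :: "nat \<Rightarrow> int" and i
    using that by (auto simp del: upt_Suc)
  have in_upt: "i \<in> set [1..<Suc n]" if "i \<in> {1..n}" for i using that by auto
  have cl: "x i = 0 \<or> (x i = 1 \<or> x i = - 1) \<and> list_point_refl T n i (map x [1..<Suc n]) \<in> set L"
    if "map x [1..<Suc n] \<in> set L" "i \<in> {1..n}" for x i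
    using closed that(1) in_upt[OF that(2)] nth[OF that(2), of x] unfolding list_all_iff by metis
  show ?thesis
  proof (rule minusculeI[of _ _ _ "\<lambda>i. if i = j then 1 else 0" _ "\<lambda>i. if i = opp T n j then - 1 else 0"])
    fix x i assume x: "x \<in> {x. map x [1..<Suc n] \<in> set L}" and i: "i \<in> {1..n}"
    show "x i \<in> {-1, 0, 1}" using cl[OF _ i] x by auto
    show "\<exists>y\<in>{x. map x [1..<Suc n] \<in> set L}. \<forall>k\<in>{1..n}. y k = x k - x i * cartan_entry T n k i"
    proof (cases "x i = 0")
      case True
      then show ?thesis using x by (intro bexI[of _ x]) auto
    next
      case False
      then have "list_point_refl T n i (map x [1..<Suc n]) \<in> set L" using cl[OF _ i] x by blast
      also have "list_point_refl T n i (map x [1..<Suc n]) = map (\<lambda>k. x k - x i * cartan_entry T n k i) [1..<Suc n]"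
        unfolding list_point_refl_def nth[OF i] by (intro map_cong refl) (subst nth, auto)
      finally show ?thesis by (intro bexI[of _ "\<lambda>k. x k - x i * cartan_entry T n k i"]) auto
    qed
  next
    fix x i assume x: "x \<in> {x. map x [1..<Suc n] \<in> set L}" and i: "i \<in> {1..n}"
      and pos: "\<And>i. i \<in> {1..n} \<Longrightarrow> x i \<ge> 0"
    have "list_all (\<lambda>v. 0 \<le> v) (map x [1..<Suc n])" using pos by (auto simp: list_all_iff simp del: upt_Suc)
    then have eq: "map x [1..<Suc n] = map (\<lambda>i. if i = j then 1 else 0) [1..<Suc n]"
      using dom x unfolding list_all_iff[of _ L] by blast
    show "x i = (if i = j then 1 else 0)"
      using nth[OF i, of x, unfolded eq nth[OF i]] by simp
  qed (use assms(2,3) in auto)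
qed

text \<open>The 27 weights of a minuscule representation. As points of \<open>A\<close> they form
  the orbit from \<open>H 1\<close> down to \<open>- H 6\<close>, and their negatives form the orbit
  of \<open>H 6\<close>.\<close>

definition E6_orbit :: "int list list" where
  "E6_orbit =
    [[1, 0, 0, 0, 0, 0], [-1, 0, 1, 0, 0, 0], [0, 0, -1, 1, 0, 0], [0, 1, 0, -1, 1, 0], [0, -1,
     0, 0, 1, 0], [0, 1, 0, 0, -1, 1], [0, -1, 0, 1, -1, 1], [0, 1, 0, 0, 0, -1], [0, 0, 1, -1,
     0, 1], [0, -1, 0, 1, 0, -1], [1, 0, -1, 0, 0, 1], [0, 0, 1, -1, 1, -1], [-1, 0, 0, 0, 0,
     1], [1, 0, -1, 0, 1, -1], [0, 0, 1, 0, -1, 0], [-1, 0, 0, 0, 1, -1], [1, 0, -1, 1, -1, 0],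
     [-1, 0, 0, 1, -1, 0], [1, 1, 0, -1, 0, 0], [-1, 1, 1, -1, 0, 0], [1, -1, 0, 0, 0, 0], [-1,
     -1, 1, 0, 0, 0], [0, 1, -1, 0, 0, 0], [0, -1, -1, 1, 0, 0], [0, 0, 0, -1, 1, 0], [0, 0, 0,
     0, -1, 1], [0, 0, 0, 0, 0, -1]]"

text \<open>The 56 weights of the minuscule representation, as 28 points and their negatives; the
  symmetry reflects that \<open>opp TE 7 7\<close> is \<open>7\<close>.\<close>

definition E7_orbit :: "int list list" where
  "E7_orbit =
    (let L = [[0, 0, 0, 0, 0, 0, 1], [0, 0, 0, 0, 0, 1, -1], [0, 0, 0, 0, 1, -1, 0], [0, 0, 0, 1,
      -1, 0, 0], [0, 1, 1, -1, 0, 0, 0], [0, -1, 1, 0, 0, 0, 0], [1, 1, -1, 0, 0, 0, 0], [1, -1,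
      -1, 1, 0, 0, 0], [-1, 1, 0, 0, 0, 0, 0], [-1, -1, 0, 1, 0, 0, 0], [1, 0, 0, -1, 1, 0, 0],
      [-1, 0, 1, -1, 1, 0, 0], [1, 0, 0, 0, -1, 1, 0], [0, 0, -1, 0, 1, 0, 0], [-1, 0, 1, 0, -1,
      1, 0], [1, 0, 0, 0, 0, -1, 1], [0, 0, -1, 1, -1, 1, 0], [-1, 0, 1, 0, 0, -1, 1], [1, 0, 0,
      0, 0, 0, -1], [0, 1, 0, -1, 0, 1, 0], [0, 0, -1, 1, 0, -1, 1], [-1, 0, 1, 0, 0, 0, -1], [0,
      -1, 0, 0, 0, 1, 0], [0, 1, 0, -1, 1, -1, 1], [0, 0, -1, 1, 0, 0, -1], [0, -1, 0, 0, 1, -1,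
      1], [0, 1, 0, 0, -1, 0, 1], [0, 1, 0, -1, 1, 0, -1]] in L @ map (map uminus) L)"

lemma minuscule_E6_1: "\<exists>W. minuscule TE 6 1 W"
  by (rule exI, rule minuscule_list[where L = E6_orbit]) code_simp+

lemma minuscule_E6_6: "\<exists>W. minuscule TE 6 6 W"
  by (rule exI, rule minuscule_list[where L = "map (map uminus) E6_orbit"]) code_simp+

lemma minuscule_E7: "\<exists>W. minuscule TE 7 7 W"
  by (rule exI, rule minuscule_list[where L = E7_orbit]) code_simp+

section \<open>Minuscule orbits in the classical types\<close>

abbreviation swap_next :: "nat \<Rightarrow> nat \<Rightarrow> nat" where
  "swap_next i \<equiv> Transposition.transpose i (Suc i)"

lemma sum_swap_next:
  fixes s :: "nat \<Rightarrow> int"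
  assumes "1 \<le> i" "Suc i \<le> N"
  shows "(\<Sum>k=1..N. (s \<circ> swap_next i) k) = (\<Sum>k=1..N. s k)"
  using assms by (intro sum.permute[symmetric] permutes_swap_id) auto

text \<open>Monotonicity puts the ones in front, and the sum counts them. In type A this determines
  the dominant point of the orbit.\<close>

lemma decreasing_01_threshold:
  fixes s :: "nat \<Rightarrow> int"
  assumes s: "\<And>i. s i \<in> {0, 1}" and dec: "\<And>i. 1 \<le> i \<Longrightarrow> i < N \<Longrightarrow> s (Suc i) \<le> s i"
    and sum: "(\<Sum>k=1..N. s k) = int j" and i: "1 \<le> i" "i \<le> N"
  shows "s i = (if i \<le> j then 1 else 0)"
proof -
  have mono: "s b \<le> s a" if "a \<le> b" "1 \<le> a" "b \<le> N" for a b
    using that by (induction b rule: dec_induct) (auto intro: order_trans[OF dec])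
  show ?thesis
  proof (cases "s i = 1")
    case True
    have "s k = 1" if "k \<in> {1..i}" for k using mono[of k i] that i True s[of k] by auto
    then have "int i = (\<Sum>k=1..i. s k)" by simp
    also have "\<dots> \<le> (\<Sum>k=1..N. s k)"
      using i s by (intro sum_mono2) (auto, metis insert_iff order_refl singletonD zero_le_one)
    finally show ?thesis using sum True by simp
  next
    case False
    then have z: "s i = 0" using s[of i] by auto
    have "s k = 0" if "k \<in> {i..N}" for k using mono[of i k] that i z s[of k] by auto
    then have "(\<Sum>k=1..N. s k) = (\<Sum>k=1..<i. s k)"
      using i by (intro sum.mono_neutral_right) auto
    also have "\<dots> \<le> (\<Sum>k=1..<i. 1)" by (rule sum_mono) (metis insert_iff order_refl s singletonD zero_le_one)
    also have "\<dots> < int i" using i by simp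
    finally show ?thesis using sum z by simp
  qed
qed

text \<open>In the usual coordinates the orbit consists of the indicator vectors \<open>s\<close> of
  subsets with \<open>j\<close> elements of \<open>{1..n+1}\<close>. Simple roots are differences of
  adjacent entries, and simple reflections swap them.\<close>

lemma minuscule_A:
  assumes "1 \<le> j" "j \<le> n"
  shows "\<exists>W. minuscule TA n j W"
proof -
  define W where "W = {x. \<exists>s::nat \<Rightarrow> int. (\<forall>i. s i \<in> {0, 1}) \<and> (\<Sum>k=1..Suc n. s k) = int j
      \<and> (\<forall>i\<in>{1..n}. x i = s i - s (Suc i))}"
  have "minuscule TA n j W"
  proof (rule minusculeI)
    fix x i assume "x \<in> W" and i: "i \<in> {1..n}"
    then obtain s :: "nat \<Rightarrow> int" where s: "\<And>i. s i \<in> {0, 1}" "(\<Sum>k=1..Suc n. s k) = int j"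
      "\<And>i. i \<in> {1..n} \<Longrightarrow> x i = s i - s (Suc i)" unfolding W_def by blast
    show "x i \<in> {-1, 0, 1}" using s(1)[of i] s(1)[of "Suc i"] s(3)[OF i] by auto
    let ?s = "s \<circ> swap_next i"
    show "\<exists>y\<in>W. \<forall>k\<in>{1..n}. y k = x k - x i * cartan_entry TA n k i"
    proof (intro bexI ballI)
      show "(\<lambda>k. ?s k - ?s (Suc k)) \<in> W"
        unfolding W_def using s(1) sum_swap_next[of i "Suc n" s] s(2) i by (intro CollectI exI[of _ ?s]) auto
      fix k assume k: "k \<in> {1..n}"
      consider "k = i" | "k = Suc i" | "Suc k = i" | "k \<noteq> i" "k \<noteq> Suc i" "Suc k \<noteq> i" by blast
      then show "?s k - ?s (Suc k) = x k - x i * cartan_entry TA n k i"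
        by cases (use i k s(3) in \<open>auto simp: cartan_entry_def dynkin_edge_def transpose_apply_other\<close>)
    qed
  next
    show "(\<lambda>i. if i = j then 1 else 0) \<in> W" unfolding W_def
    proof (intro CollectI exI[of _ "\<lambda>i. if i \<le> j then 1 else 0"] conjI)
      have "(\<Sum>k=1..Suc n. if k \<le> j then 1 else (0::int)) = (\<Sum>k=1..j. 1)"
        using assms by (intro sum.mono_neutral_cong_right) auto
      then show "(\<Sum>k=1..Suc n. if k \<le> j then 1 else (0::int)) = int j" by simp
    qed auto
    show "(\<lambda>i. if i = opp TA n j then - 1 else 0) \<in> W" unfolding W_def
    \<comment> \<open>The last \<open>j\<close> of the \<open>n + 1\<close> entries are ones, so the
      only jump is upwards, at the index \<open>n + 1 - j\<close>.\<close>
    proof (intro CollectI exI[of _ "\<lambda>i. if n + 2 \<le> i + j then 1 else 0"] conjI)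
      have "(\<Sum>k=1..Suc n. if n + 2 \<le> k + j then 1 else (0::int)) = (\<Sum>k=n+2-j..Suc n. 1)"
        using assms by (intro sum.mono_neutral_cong_right) auto
      also have "\<dots> = int j" using assms by simp
      finally show "(\<Sum>k=1..Suc n. if n + 2 \<le> k + j then 1 else (0::int)) = int j" .
    qed (use assms in \<open>auto simp: opp_def\<close>)
  next
    fix x i assume "x \<in> W" and i: "i \<in> {1..n}" and pos: "\<And>i. i \<in> {1..n} \<Longrightarrow> x i \<ge> 0"
    then obtain s :: "nat \<Rightarrow> int" where s: "\<And>i. s i \<in> {0, 1}" "(\<Sum>k=1..Suc n. s k) = int j"
      "\<And>i. i \<in> {1..n} \<Longrightarrow> x i = s i - s (Suc i)" unfolding W_def by blast
    have dec: "s (Suc i) \<le> s i" if "1 \<le> i" "i < Suc n" for i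
      using s(3)[of i] pos[of i] that by simp
    show "x i = (if i = j then 1 else 0)"
      using s(3)[OF i] decreasing_01_threshold[of s, OF s(1) dec s(2), of i]
        decreasing_01_threshold[of s, OF s(1) dec s(2), of "Suc i"] i by auto
  qed auto
  then show ?thesis by blast
qed

text \<open>The orbit consists of the vectors with all coordinates plus or minus one half, encoded
  as \<open>s i - 1/2\<close>. The last simple root is twice a coordinate, whence
  \<open>2 * s n - 1\<close>, and its reflection flips \<open>s n\<close>.\<close>

lemma minuscule_C:
  assumes "n \<ge> 2"
  shows "\<exists>W. minuscule TC n n W"
proof -
  define W where "W = {x. \<exists>s::nat \<Rightarrow> int. (\<forall>i. s i \<in> {0, 1})
      \<and> (\<forall>i\<in>{1..n}. x i = (if i = n then 2 * s n - 1 else s i - s (Suc i)))}"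
  have "minuscule TC n n W"
  proof (rule minusculeI)
    fix x i assume "x \<in> W" and i: "i \<in> {1..n}"
    then obtain s :: "nat \<Rightarrow> int" where s: "\<And>i. s i \<in> {0, 1}"
      "\<And>i. i \<in> {1..n} \<Longrightarrow> x i = (if i = n then 2 * s n - 1 else s i - s (Suc i))" unfolding W_def by blast
    show "x i \<in> {-1, 0, 1}" using s(1)[of i] s(1)[of "Suc i"] s(2)[OF i] by auto
    let ?s = "if i = n then s(n := 1 - s n) else s \<circ> swap_next i"
    show "\<exists>y\<in>W. \<forall>k\<in>{1..n}. y k = x k - x i * cartan_entry TC n k i"
    proof (intro bexI ballI)
      have "?s k \<in> {0, 1}" for k using s(1)[of n] s(1) by auto
      then show "(\<lambda>k. if k = n then 2 * ?s n - 1 else ?s k - ?s (Suc k)) \<in> W"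
        unfolding W_def by blast
      fix k assume k: "k \<in> {1..n}"
      show "(if k = n then 2 * ?s n - 1 else ?s k - ?s (Suc k)) = x k - x i * cartan_entry TC n k i"
      proof (cases "i = n")
        case True
        then show ?thesis using i k s(2) by (auto simp: cartan_entry_def dynkin_edge_def)
      next
        case False
        consider "k = i" | "k = Suc i" | "Suc k = i" | "k \<noteq> i" "k \<noteq> Suc i" "Suc k \<noteq> i" by blast
        then show ?thesis
          by cases (use False i k s(2) in \<open>auto simp: cartan_entry_def dynkin_edge_def transpose_apply_other\<close>)
      qed
    qed
  next
    show "(\<lambda>i. if i = n then 1 else 0) \<in> W"
      unfolding W_def by (intro CollectI exI[of _ "\<lambda>_. 1"]) auto
    show "(\<lambda>i. if i = opp TC n n then - 1 else 0) \<in> W"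
      unfolding W_def by (intro CollectI exI[of _ "\<lambda>_. 0"]) (auto simp: opp_def)
  next
    fix x i assume "x \<in> W" and i: "i \<in> {1..n}" and pos: "\<And>i. i \<in> {1..n} \<Longrightarrow> x i \<ge> 0"
    then obtain s :: "nat \<Rightarrow> int" where s: "\<And>i. s i \<in> {0, 1}"
      "\<And>i. i \<in> {1..n} \<Longrightarrow> x i = (if i = n then 2 * s n - 1 else s i - s (Suc i))" unfolding W_def by blast
    have n1: "s n = 1" using s(2)[of n] pos[of n] s(1)[of n] assms by auto
    have "s i = 1" if "i \<le> n" "1 \<le> i" for i
      using that
    proof (induction i rule: inc_induct)
      case (step i)
      then show ?case using s(2)[of i] pos[of i] s(1)[of i] by auto
    qed (rule n1)
    then show "x i = (if i = n then 1 else 0)" using s(2)[OF i] i by auto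
  qed auto
  then show ?thesis by blast
qed

definition axis :: "nat \<Rightarrow> int \<Rightarrow> nat \<Rightarrow> int" where
  "axis m c i = (if i = m then c else 0)"

text \<open>Types B and D share the orbit of positive and negative unit vectors and differ only in
  the last simple root. \<open>X\<close> converts coordinates into values of the simple roots, with
  \<open>X f n\<close> left to the instances.\<close>

lemma minuscule_axes:
  assumes "n \<ge> 2" "opp T n 1 = 1"
    and X: "\<And>f i. i \<noteq> n \<Longrightarrow> X f i = f i - f (Suc i)"
    and Xn: "\<And>c. X (axis n c) n = c" "\<And>c. X (axis 1 c) n = 0" "\<And>m c. X (axis m c) n \<in> {0, c}"
    and refl: "\<And>m c i. m \<in> {1..n} \<Longrightarrow> c \<in> {-1, 1} \<Longrightarrow> i \<in> {1..n} \<Longrightarrow>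
      \<exists>m'\<in>{1..n}. \<exists>c'\<in>{-1, 1}. \<forall>k\<in>{1..n}.
        X (axis m' c') k = X (axis m c) k - X (axis m c) i * cartan_entry T n k i"
  shows "\<exists>W. minuscule T n 1 W"
proof -
  define W where "W = {x. \<exists>m\<in>{1..n}. \<exists>c\<in>{-1, 1}. x = X (axis m c)}"
  have "minuscule T n 1 W"
  proof (rule minusculeI)
    fix x i assume "x \<in> W" and i: "i \<in> {1..n}"
    then obtain m c where m: "m \<in> {1..n}" "c \<in> {-1, 1}" "x = X (axis m c)"
      unfolding W_def by blast
    show "x i \<in> {-1, 0, 1}"
      using m(2) Xn(3)[of m c] X[of i "axis m c"] by (cases "i = n") (auto simp: m(3) axis_def)
    show "\<exists>y\<in>W. \<forall>k\<in>{1..n}. y k = x k - x i * cartan_entry T n k i"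
      using refl[OF m(1,2) i] unfolding m(3) W_def by blast
  next
    show "X (axis 1 1) \<in> W" unfolding W_def using assms(1) by (intro CollectI bexI[of _ 1]) auto
    show "X (axis 1 (- 1)) \<in> W" unfolding W_def using assms(1) by (intro CollectI bexI[of _ 1] bexI[of _ "- 1"]) auto
  next
    fix i assume i: "i \<in> {1..n}"
    show "X (axis 1 1) i = (if i = 1 then 1 else 0)"
      and "X (axis 1 (- 1)) i = (if i = opp T n 1 then - 1 else 0)"
      using i assms(1,2) Xn(2) X[of i] by (cases "i = n"; simp add: axis_def)+
  next
    fix x i assume "x \<in> W" and i: "i \<in> {1..n}" and pos: "\<And>i. i \<in> {1..n} \<Longrightarrow> x i \<ge> 0"
    then obtain m c where m: "m \<in> {1..n}" "c \<in> {-1, 1}" "x = X (axis m c)"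
      unfolding W_def by blast
    have "X (axis m c) m = c" using Xn(1) X[of m "axis m c"] by (cases "m = n") (simp_all add: axis_def)
    then have c: "c = 1" using pos[OF m(1)] m(2,3) by auto
    have "m = 1"
    proof (rule ccontr)
      assume "m \<noteq> 1"
      then have m1: "m - 1 \<in> {1..n}" "m - 1 \<noteq> n" "Suc (m - 1) = m" "m - 1 \<noteq> m" using m(1) by auto
      then have "x (m - 1) = - 1" unfolding m(3) X[OF m1(2)] by (simp add: axis_def c)
      then show False using pos[OF m1(1)] by simp
    qed
    then show "x i = (if i = 1 then 1 else 0)"
      using i m(3) c assms(1) Xn(2) X[of i] by (cases "i = n") (simp_all add: axis_def)
  qed
  then show ?thesis by blast
qed

lemma minuscule_B:
  assumes "n \<ge> 2"
  shows "\<exists>W. minuscule TB n 1 W"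
proof (rule minuscule_axes[where X = "\<lambda>f i. if i = n then f n else f i - f (Suc i)"])
  let ?X = "\<lambda>f i. if i = n then f n else f i - f (Suc i)"
  fix m c i assume m: "m \<in> {1..n}" "c \<in> {-1, 1::int}" and i: "i \<in> {1..n}"
  let ?m = "if i = n then m else swap_next i m" and ?c = "if i = n \<and> m = n then - c else c"
  show "\<exists>m'\<in>{1..n}. \<exists>c'\<in>{-1, 1}. \<forall>k\<in>{1..n}.
    ?X (axis m' c') k = ?X (axis m c) k - ?X (axis m c) i * cartan_entry TB n k i"
  proof (intro bexI ballI)
    show "?m \<in> {1..n}" "?c \<in> {-1, 1}" using m i by (auto simp: Transposition.transpose_def)
    fix k assume "k \<in> {1..n}"
    then show "?X (axis ?m ?c) k = ?X (axis m c) k - ?X (axis m c) i * cartan_entry TB n k i"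
      using i m(1)
      by (auto simp: axis_def cartan_entry_def dynkin_edge_def Transposition.transpose_def)
  qed
qed (use assms in \<open>auto simp: axis_def opp_def\<close>)

definition point_D :: "nat \<Rightarrow> (nat \<Rightarrow> int) \<Rightarrow> nat \<Rightarrow> int" where
  "point_D n f i = (if i = n then f (n - 1) + f n else f i - f (Suc i))"

text \<open>The last reflection exchanges the last two coordinates and changes both signs; the
  others swap neighbours. Arbitrary coordinates \<open>f\<close> are allowed so that the vector
  orbit and the two spin orbits are all covered.\<close>

lemma D_refl:
  fixes f :: "nat \<Rightarrow> int"
  assumes "n \<ge> 4" and i: "i \<in> {1..n}" and k: "k \<in> {1..n}"
  shows "point_D n (if i = n then f(n - 1 := - f n, n := - f (n - 1)) else f \<circ> swap_next i) k
    = point_D n f k - point_D n f i * cartan_entry TD n k i"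
proof -
  obtain p where n: "n = Suc (Suc p)" "2 \<le> p"
    by (rule that[of "n - 2"]) (use assms(1) in auto)
  show ?thesis
  proof (cases "i = n")
    case True
    consider "k = Suc (Suc p)" | "k = Suc p" | "k = p" | "k < p" using k n by force
    then show ?thesis
      by cases (use True n in \<open>auto simp: point_D_def cartan_entry_def dynkin_edge_def\<close>)
  next
    case False
    then have i: "1 \<le> i" "i \<le> Suc p" using i n by auto
    have e: "cartan_entry TD n k i = (if k = i then 2 else if Suc k = i \<or> (k = Suc i \<and> k \<noteq> n) \<or> (k = n \<and> i = p) then -1 else 0)"
      using i k n by (auto simp: cartan_entry_def dynkin_edge_def)
    consider "k = n" "i = Suc p" | "k = n" "i = p" | "k = n" "i < p"
      | "k \<noteq> n" "k = i" | "k \<noteq> n" "k = Suc i" | "k \<noteq> n" "Suc k = i" | "k \<noteq> n" "k \<noteq> i" "k \<noteq> Suc i" "Suc k \<noteq> i"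
      using i by linarith
    then show ?thesis
      unfolding e by cases (use False n i in \<open>simp_all add: point_D_def transpose_apply_other\<close>)
  qed
qed

lemma minuscule_D_1:
  assumes "n \<ge> 4"
  shows "\<exists>W. minuscule TD n 1 W"
proof (rule minuscule_axes[where X = "point_D n"])
  have ne: "n - 1 \<noteq> n" "n - 1 \<noteq> 1" "n \<noteq> 1" using assms by auto
  show "point_D n (axis n c) n = c" "point_D n (axis 1 c) n = 0" "point_D n (axis m c) n \<in> {0, c}" for m c
    using ne by (auto simp: point_D_def axis_def)
  fix m c i assume m: "m \<in> {1..n}" "c \<in> {-1, 1::int}" and i: "i \<in> {1..n}"
  let ?m = "if i = n then (if m = n then n - 1 else if m = n - 1 then n else m) else swap_next i m"
    and ?c = "if i = n \<and> (m = n \<or> m = n - 1) then - c else c"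
  show "\<exists>m'\<in>{1..n}. \<exists>c'\<in>{-1, 1}. \<forall>k\<in>{1..n}.
    point_D n (axis m' c') k = point_D n (axis m c) k - point_D n (axis m c) i * cartan_entry TD n k i"
  proof (intro bexI ballI)
    show "?m \<in> {1..n}" "?c \<in> {-1, 1}" using m i assms by (auto simp: Transposition.transpose_def)
    have v: "axis ?m ?c = (if i = n then (axis m c)(n - 1 := - axis m c n, n := - axis m c (n - 1)) else axis m c \<circ> swap_next i)"
    proof (cases "i = n")
      case True
      then show ?thesis using ne by (intro ext) (simp add: axis_def del: One_nat_def)
    next
      case False
      then show ?thesis by (intro ext) (auto simp: axis_def Transposition.transpose_def)
    qed
    show "point_D n (axis ?m ?c) k = point_D n (axis m c) k - point_D n (axis m c) i * cartan_entry TD n k i"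
      if "k \<in> {1..n}" for k
      unfolding v by (rule D_refl[OF assms i that])
  qed
qed (use assms in \<open>auto simp: point_D_def opp_def\<close>)

text \<open>Coordinates are again plus or minus one half, encoded as \<open>s i - 1/2\<close>. The
  Weyl group of type D changes signs in pairs, so the parity of the number of positive coordinates
  separates the two orbits.\<close>

lemma minuscule_D_spin:
  assumes "n \<ge> 4" and j: "j = n - 1 \<or> j = n"
  shows "\<exists>W. minuscule TD n j W"
proof -
  define X where "X s i = (if i = n then s (n - 1) + s n - 1 else s i - s (Suc i))" for s :: "nat \<Rightarrow> int" and i
  define W where "W = {x. \<exists>s::nat \<Rightarrow> int. (\<forall>i. s i \<in> {0, 1}) \<and> even ((\<Sum>k=1..n. s k) - int j)
      \<and> (\<forall>i\<in>{1..n}. x i = X s i)}"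
  have split: "(\<Sum>k=1..n. f k) = (\<Sum>k=1..<n-1. f k) + f (n - 1) + f n" for f :: "nat \<Rightarrow> int"
  proof -
    have "{1..n} = insert n (insert (n - 1) {1..<n - 1})" using assms by auto
    moreover have "n \<notin> insert (n - 1) {1..<n - 1}" "n - 1 \<notin> {1..<n - 1}" using assms by auto
    ultimately show ?thesis by (simp only: sum.insert finite_insert finite_atLeastLessThan) simp
  qed
  have "minuscule TD n j W"
  proof (rule minusculeI)
    fix x i assume "x \<in> W" and i: "i \<in> {1..n}"
    then obtain s :: "nat \<Rightarrow> int" where s: "\<And>i. s i \<in> {0, 1}" "even ((\<Sum>k=1..n. s k) - int j)"
      "\<And>i. i \<in> {1..n} \<Longrightarrow> x i = X s i" unfolding W_def by blast
    have ab: "a - b \<in> {-1, 0, 1}" "a + b - 1 \<in> {-1, 0, 1}" "1 - a \<in> {0, 1}"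
      if "a \<in> {0, 1}" "b \<in> {0, 1}" for a b :: int using that by auto
    show "x i \<in> {-1, 0, 1}"
      unfolding s(3)[OF i] X_def using ab[OF s(1) s(1)] by (simp del: insert_iff)
    let ?s = "if i = n then s(n - 1 := 1 - s n, n := 1 - s (n - 1)) else s \<circ> swap_next i"
    show "\<exists>y\<in>W. \<forall>k\<in>{1..n}. y k = x k - x i * cartan_entry TD n k i"
    proof (intro bexI ballI)
      have 01: "?s k \<in> {0, 1}" for k
        using s(1) ab(3)[OF s(1) s(1)] by (simp del: insert_iff add: fun_upd_apply)
      have "even ((\<Sum>k=1..n. ?s k) - int j)"
      proof (cases "i = n")
        case True
        have "(\<Sum>k=1..<n-1. ?s k) = (\<Sum>k=1..<n-1. s k)" by (intro sum.cong) (use True in auto)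
        then have "(\<Sum>k=1..n. ?s k) = (\<Sum>k=1..n. s k) + 2 * (1 - s n - s (n - 1))"
          unfolding split using True assms(1) by simp
        then show ?thesis using s(2) by simp
      next
        case False
        then have "(\<Sum>k=1..n. ?s k) = (\<Sum>k=1..n. s k)" using sum_swap_next[of i n s] i by simp
        then show ?thesis using s(2) by simp
      qed
      then show "X ?s \<in> W" unfolding W_def using 01 by (intro CollectI exI[of _ ?s] conjI allI) auto
      fix k assume k: "k \<in> {1..n}"
      \<comment> \<open>Doubled coordinates are integers, so \<open>D_refl\<close> applies to them;
        the factor \<open>2\<close> is cancelled at the end.\<close>
      define f where "f i = 2 * s i - 1" for i
      have "point_D n (if i = n then f(n - 1 := - f n, n := - f (n - 1)) else f \<circ> swap_next i) k
          = point_D n f k - point_D n f i * cartan_entry TD n k i"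
        by (rule D_refl[OF assms(1) i k])
      also have "(if i = n then f(n - 1 := - f n, n := - f (n - 1)) else f \<circ> swap_next i) = (\<lambda>k. 2 * ?s k - 1)"
        by (auto simp: f_def fun_eq_iff)
      finally have "point_D n (\<lambda>k. 2 * ?s k - 1) k = point_D n f k - point_D n f i * cartan_entry TD n k i" .
      moreover have "point_D n (\<lambda>k. 2 * s k - 1) k = 2 * X s k" for s k by (simp add: X_def point_D_def)
      ultimately have "2 * X ?s k = 2 * X s k - 2 * X s i * cartan_entry TD n k i" by (simp only: f_def[abs_def])
      then show "X ?s k = x k - x i * cartan_entry TD n k i" unfolding s(3)[OF i] s(3)[OF k] by linarith
    qed
  next
    have "(\<Sum>k=1..n. if k \<le> j then 1 else (0::int)) = int j"
      unfolding split using assms by auto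
    then show "X (\<lambda>i. if i \<le> j then 1 else 0) \<in> W"
      unfolding W_def by (intro CollectI exI[of _ "\<lambda>i. if i \<le> j then 1 else 0"]) auto
    \<comment> \<open>All coordinates are negative, except that the last one is positive if the
      parity of \<open>j\<close> demands it; this is minus the coweight of index \<open>n\<close> or
      \<open>n - 1\<close>.\<close>
    have "(\<Sum>k=1..n. if k = n \<and> odd j then 1 else (0::int)) = (if odd j then 1 else 0)"
      using assms(1) by (cases "odd j") simp_all
    then show "X (\<lambda>i. if i = n \<and> odd j then 1 else 0) \<in> W"
      unfolding W_def by (intro CollectI exI[of _ "\<lambda>i. if i = n \<and> odd j then 1 else 0"]) simp
  next
    fix i assume i: "i \<in> {1..n}"
    have n: "Suc (n - 1) = n" "n - 1 \<noteq> n" "n \<noteq> n - 1" using assms(1) by auto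
    show "X (\<lambda>i. if i \<le> j then 1 else 0) i = (if i = j then 1 else 0)"
      using j i n(1,2) by (cases "i = n") (auto simp: X_def)
    have opp: "opp TD n j = (if odd j then n - 1 else n)"
      using j assms(1) by (elim disjE) (simp_all add: opp_def)
    show "X (\<lambda>i. if i = n \<and> odd j then 1 else 0) i = (if i = opp TD n j then - 1 else 0)"
    proof (cases "i = n")
      case True
      then show ?thesis unfolding opp X_def using n by (cases "odd j") simp_all
    next
      case False
      then have "Suc i = n \<longleftrightarrow> i = n - 1" using n(1) by auto
      then show ?thesis unfolding opp X_def using False by (cases "odd j") simp_all
    qed
  next
    fix x i assume "x \<in> W" and i: "i \<in> {1..n}" and pos: "\<And>i. i \<in> {1..n} \<Longrightarrow> x i \<ge> 0"
    then obtain s :: "nat \<Rightarrow> int" where s: "\<And>i. s i \<in> {0, 1}" "even ((\<Sum>k=1..n. s k) - int j)"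
      "\<And>i. i \<in> {1..n} \<Longrightarrow> x i = X s i" unfolding W_def by blast
    have nn: "Suc (n - 1) = n" "n - 1 \<noteq> n" "n - 1 \<in> {1..n}" "n \<in> {1..n}" using assms(1) by auto
    have "X s n \<ge> 0" "X s (n - 1) \<ge> 0"
      using pos[OF nn(4)] s(3)[OF nn(4)] pos[OF nn(3)] s(3)[OF nn(3)] by simp_all
    then have "s (n - 1) + s n - 1 \<ge> 0" "s (n - 1) - s n \<ge> 0" using nn(1,2) by (simp_all add: X_def)
    moreover have "a = 1" if "a \<in> {0, 1}" "b \<in> {0, 1}" "a + b - 1 \<ge> 0" "a - b \<ge> 0" for a b :: int
      using that by auto
    ultimately have n1: "s (n - 1) = 1" using s(1) by blast
    have ones: "s i = 1" if "i \<le> n - 1" "1 \<le> i" for i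
      using that
    proof (induction i rule: inc_induct)
      case (step i)
      have m: "i \<in> {1..n}" "i \<noteq> n" using step.hyps step.prems by auto
      have "s (Suc i) \<le> s i" using s(3)[OF m(1)] pos[OF m(1)] m(2) by (simp add: X_def)
      then show ?case using step s(1)[of i] by auto
    qed (rule n1)
    then have "(\<Sum>k=1..<n-1. s k) = (\<Sum>k=1..<n-1. 1)" by (intro sum.cong) auto
    then have "(\<Sum>k=1..n. s k) = int (n - 1) + s n" unfolding split n1 using assms(1) by simp
    then have "s n = (if j = n then 1 else 0)" using s(2) s(1)[of n] j assms(1) by (auto simp: of_nat_diff)
    then show "x i = (if i = j then 1 else 0)"
      using s(3)[OF i] i j ones[of i] ones[of "Suc i"] n1 assms(1) by (cases "i = n"; cases "Suc i = n") (auto simp: X_def)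
  qed
  then show ?thesis by blast
qed

lemma minuscule_exists:
  assumes "rank_ok T n" "j \<in> euler_indices T n"
  shows "\<exists>W. minuscule T n j W"
proof (cases T)
  case TA
  then show ?thesis using minuscule_A assms by (simp add: euler_indices_def)
next
  case TB
  then show ?thesis using minuscule_B assms by (simp add: euler_indices_def rank_ok_def)
next
  case TC
  then show ?thesis using minuscule_C assms by (simp add: euler_indices_def rank_ok_def)
next
  case TD
  then show ?thesis using minuscule_D_1 minuscule_D_spin assms by (auto simp: euler_indices_def rank_ok_def)
next
  case TE
  then show ?thesis using minuscule_E6_1 minuscule_E6_6 minuscule_E7 assms
    by (auto simp: euler_indices_def rank_ok_def split: if_splits)
qed (use assms in \<open>simp_all add: euler_indices_def\<close>)

lemma euler_indices_range: "rank_ok T n \<Longrightarrow> j \<in> euler_indices T n \<Longrightarrow> j \<in> {1..n}"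
  by (cases T) (auto simp: euler_indices_def rank_ok_def split: if_splits)

lemma opp_euler_index: "rank_ok T n \<Longrightarrow> j \<in> euler_indices T n \<Longrightarrow> opp T n j \<in> euler_indices T n"
  by (cases T) (auto simp: euler_indices_def rank_ok_def opp_def split: if_splits)

lemma symmetric_iff_opp:
  "rank_ok T n \<Longrightarrow> j \<in> symmetric_indices T n \<longleftrightarrow> j \<in> euler_indices T n \<and> opp T n j = j"
proof (cases T)
  case TA
  have "(odd n \<longrightarrow> (j = Suc (n div 2)) = (Suc 0 \<le> j \<and> j \<le> n \<and> Suc n - j = j)) \<and>
      (even n \<longrightarrow> j \<le> n \<longrightarrow> Suc 0 \<le> j \<longrightarrow> Suc n - j \<noteq> j)" by presburger
  then show ?thesis using TA by (simp add: euler_indices_def symmetric_indices_def opp_def)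
qed (auto simp: euler_indices_def symmetric_indices_def rank_ok_def opp_def split: if_splits)

lemma opp_opp: "rank_ok T n \<Longrightarrow> j \<in> euler_indices T n \<Longrightarrow> opp T n (opp T n j) = j"
  by (cases T) (auto simp: euler_indices_def rank_ok_def opp_def split: if_splits)

section \<open>Classification\<close>

locale typed_restricted = restricted br \<theta> A \<alpha> n "cartan_entry T n"
  for br :: "'g::euclidean_space \<Rightarrow> 'g \<Rightarrow> 'g" and \<theta> A \<alpha> n T +
  assumes type: "has_type br A \<alpha> n T"
begin

lemma rank: "rank_ok T n"
  using type by (simp add: has_type_def)

lemma not_double:
  assumes "T \<noteq> TBC" "i \<in> {1..n}" shows "\<not> is_weight (\<lambda>h. 2 * \<alpha> i h)"
proof
  assume w: "is_weight (\<lambda>h. 2 * \<alpha> i h)"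
  obtain h where "h \<in> A" "\<alpha> i h \<noteq> 0" using \<alpha>_root[OF assms(2)] by (auto simp: restricted_roots_def)
  then have "(\<lambda>h. if h \<in> A then 2 * \<alpha> i h else 0) \<in> restricted_roots br A"
    using is_weight_restricted_root[OF w, of h] by simp
  moreover have "(\<lambda>h. if h \<in> A then 2 * \<alpha> i h else 0) = (\<lambda>v. 2 * \<alpha> i v)"
    using \<alpha>_dual[OF assms(2)] by (auto simp: dual_on_def fun_eq_iff)
  moreover have "(\<lambda>v. 2 * \<alpha> i v) \<notin> restricted_roots br A"
    using type assms(1) \<alpha>_root[OF assms(2)] by (auto simp: has_type_def)
  ultimately show False by simp
qed

lemma root_closed_is_root: "root_closed T n is_root"
  unfolding root_closed_def
proof (intro conjI ballI allI impI)
  show "is_root k'" if "is_root k" "\<forall>i\<in>{1..n}. k' i = k i" for k k'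
  proof -
    have "val k' = val k" using that(2) by (simp add: val_def fun_eq_iff)
    then show ?thesis using that unfolding is_root_def by simp
  qed
  show "is_root (k(i := k i - (\<Sum>l=1..n. k l * cartan_entry T n l i)))"
    if "i \<in> {1..n}" "is_root k" for k i
    using root_refl[OF that] by (simp add: srefl_def)
qed (rule simple_is_root)

lemma highest:
  obtains k where "is_root k" "\<And>i. i \<in> {1..n} \<Longrightarrow> 1 \<le> k i"
    "\<And>i. i \<in> {1..n} \<Longrightarrow> i \<notin> euler_indices T n \<Longrightarrow> 2 \<le> k i"
proof -
  have "is_root (\<lambda>l. if l = n then 2 else 0)" if "T = TBC"
  proof -
    have n: "n \<in> {1..n}" using rank that by (simp add: rank_ok_def)
    have "(\<lambda>v. 2 * \<alpha> n v) \<in> restricted_roots br A" using type that by (simp add: has_type_def)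
    then have "is_weight (\<lambda>v. 2 * \<alpha> n v)" by (auto simp: restricted_roots_def is_weight_def)
    then have "is_weight (val (\<lambda>l. if l = n then 2 else 0))"
      using val_single[OF n, of 2] by (subst is_weight_cong[of _ "\<lambda>v. 2 * \<alpha> n v"]) simp_all
    then show ?thesis using n unfolding is_root_def by (intro conjI bexI[of _ n]) simp_all
  qed
  from highest_root[OF rank root_closed_is_root this] show thesis using that by blast
qed

text \<open>At the root \<open>k\<close> of \<open>highest\<close>, the terms
  \<open>k i * \<alpha> i h\<close> are nonnegative integers with sum at most \<open>1\<close>. So
  one simple root alone is nonzero on \<open>h\<close>, and its coefficient in \<open>k\<close> is
  \<open>1\<close>, which excludes unlisted indices.\<close>

lemma dominant_euler_is_coweight:
  assumes h: "h \<in> A" "euler_elem br h" "\<And>i. i \<in> {1..n} \<Longrightarrow> \<alpha> i h \<ge> 0"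
  obtains j where "j \<in> {1..n}" "j \<in> euler_indices T n" "h = H j"
proof -
  obtain k where k: "is_root k" "\<And>i. i \<in> {1..n} \<Longrightarrow> 1 \<le> k i"
    "\<And>i. i \<in> {1..n} \<Longrightarrow> i \<notin> euler_indices T n \<Longrightarrow> 2 \<le> k i" using highest by blast
  have bound: "\<And>k. is_root k \<Longrightarrow> val k h \<in> {-1, 0, 1}" and "h \<noteq> 0" using h(2) euler_A_iff[OF h(1)] by auto
  have 01: "\<alpha> i h \<in> {0, 1}" if "i \<in> {1..n}" for i
    using bound[OF simple_is_root[OF that]] h(3)[OF that] val_single[OF that, of 1 h] by auto
  obtain j where j: "j \<in> {1..n}" "\<alpha> j h \<noteq> 0" using \<alpha>_all_zero[OF h(1)] \<open>h \<noteq> 0\<close> by blast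
  have j1: "\<alpha> j h = 1" using 01[OF j(1)] j(2) by simp
  have "val k h = of_int (k j) * \<alpha> j h + (\<Sum>i\<in>{1..n} - {j}. of_int (k i) * \<alpha> i h)"
    unfolding val_def using j(1) by (intro sum.remove) auto
  then have eq: "of_int (k j) + (\<Sum>i\<in>{1..n} - {j}. of_int (k i) * \<alpha> i h) \<le> 1"
    using bound[OF k(1)] j1 by auto
  have nonneg: "of_int (k i) * \<alpha> i h \<ge> 0" if "i \<in> {1..n}" for i
    using k(2)[OF that] h(3)[OF that] by simp
  have kj: "real_of_int (k j) \<ge> 1" using k(2)[OF j(1)] by simp
  have "(\<Sum>i\<in>{1..n} - {j}. of_int (k i) * \<alpha> i h) \<ge> 0" using nonneg by (intro sum_nonneg) auto
  then have "real_of_int (k j) \<le> 1" and sum0: "(\<Sum>i\<in>{1..n} - {j}. of_int (k i) * \<alpha> i h) = 0"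
    using eq kj by linarith+
  then have "\<not> 2 \<le> k j" by linarith
  then have je: "j \<in> euler_indices T n" using k(3)[OF j(1)] by blast
  have "\<alpha> i h = 0" if i: "i \<in> {1..n}" "i \<noteq> j" for i
  proof -
    have "of_int (k i) * \<alpha> i h = 0"
      using sum0 sum_nonneg_eq_0_iff[of "{1..n} - {j}" "\<lambda>i. of_int (k i) * \<alpha> i h"] nonneg i by auto
    then show ?thesis using k(2)[OF i(1)] by simp
  qed
  then have "h = H j" using j1 by (intro H_eqI j(1) h(1)) simp
  then show thesis using that j(1) je by blast
qed

lemma H_inj: "j \<in> {1..n} \<Longrightarrow> l \<in> {1..n} \<Longrightarrow> H j = H l \<Longrightarrow> j = l"
  using H(2)[of j j] H(2)[of l j] by (simp split: if_splits)

lemma minuscule_stable: "minuscule T n j W \<Longrightarrow> stable W"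
  unfolding minuscule_def stable_def by (rule conjunct1)

lemma ptz_H:
  assumes "j \<in> {1..n}" "\<forall>i\<in>{1..n}. x i = (if i = j then 1 else 0)" shows "ptz x = H j"
  by (rule H_eqI[OF assms(1) ptz(1)]) (use assms(2) in \<open>simp add: ptz(2) del: One_nat_def\<close>)

lemma euler_coweight_iff:
  assumes j: "j \<in> {1..n}"
  shows "euler_elem br (H j) \<longleftrightarrow> j \<in> euler_indices T n"
proof
  assume "euler_elem br (H j)"
  moreover have "\<alpha> i (H j) \<ge> 0" if "i \<in> {1..n}" for i using H(2)[OF j that] by simp
  ultimately obtain l where "l \<in> {1..n}" "l \<in> euler_indices T n" "H j = H l"
    using dominant_euler_is_coweight[OF H(1)[OF j]] by blast
  then show "j \<in> euler_indices T n" using H_inj[OF j] by blast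
next
  assume je: "j \<in> euler_indices T n"
  then have red: "T \<noteq> TBC" by (auto simp: euler_indices_def)
  obtain W where W: "minuscule T n j W" using minuscule_exists[OF rank je] by blast
  obtain x where x: "x \<in> W" "\<forall>i\<in>{1..n}. x i = (if i = j then 1 else 0)"
    using minusculeD(1)[OF W] by (rule bexE)
  have "val k (H j) \<in> {-1, 0, 1}" if "is_root k" for k
    using stable_bound[OF not_double[OF red] minuscule_stable[OF W] x(1) that] ptz_H[OF j x(2)] by simp
  moreover have "H j \<noteq> 0" using H(2)[OF j j] \<alpha>_zero[OF j] by auto
  ultimately show "euler_elem br (H j)" using euler_A_iff[OF H(1)[OF j]] by blast
qed

text \<open>The minuscule set contains \<open>- H (opp T n j)\<close> and has \<open>H j\<close> as
  its only dominant point, so the passage to a dominant point inside the set must end there.\<close>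

lemma conjugate_opp:
  assumes j: "j \<in> euler_indices T n"
  obtains \<phi> where "\<phi> \<in> inner_auts br" "\<phi> (- H (opp T n j)) = H j"
proof -
  have jn: "j \<in> {1..n}" "opp T n j \<in> {1..n}"
    using euler_indices_range[OF rank] opp_euler_index[OF rank] j by blast+
  obtain W where W: "minuscule T n j W" using minuscule_exists[OF rank j] by blast
  obtain x where x: "x \<in> W" "\<forall>i\<in>{1..n}. x i = (if i = opp T n j then - 1 else 0)"
    using minusculeD(2)[OF W] by (rule bexE)
  obtain \<phi> y where \<phi>: "\<phi> \<in> inner_auts br" "y \<in> W" "\<phi> (ptz x) = ptz y" "\<And>i. i \<in> {1..n} \<Longrightarrow> y i \<ge> 0"
    using stable_dominant[OF minuscule_stable[OF W] x(1)] by blast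
  have "\<forall>i\<in>{1..n}. y i = (if i = j then 1 else 0)" using bspec[OF minusculeD(3)[OF W] \<phi>(2)] \<phi>(4) by simp
  then have "ptz y = H j" by (rule ptz_H[OF jn(1)])
  moreover have "- H (opp T n j) = ptz x"
  proof (rule ptz_eqI)
    show "- H (opp T n j) \<in> A" using H(1)[OF jn(2)] A_subspace by (simp add: subspace_neg)
    show "\<alpha> k (- H (opp T n j)) = of_int (x k)" if "k \<in> {1..n}" for k
      using \<alpha>_scale[OF that H(1)[OF jn(2)], of "-1"] H(2)[OF jn(2) that] x(2) that by simp
  qed
  ultimately show thesis using that \<phi>(1,3) by simp
qed

lemma symmetric_coweight_iff:
  assumes j: "j \<in> {1..n}"
  shows "symmetric_euler br (H j) \<longleftrightarrow> j \<in> symmetric_indices T n"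
proof
  assume s: "symmetric_euler br (H j)"
  then have e: "euler_elem br (H j)" and "- H j \<in> inn_orbit br (H j)" by (auto simp: symmetric_euler_def)
  then obtain \<psi> where \<psi>: "\<psi> \<in> inner_auts br" "\<psi> (H j) = - H j" by (auto simp: inn_orbit_def)
  have je: "j \<in> euler_indices T n" using e euler_coweight_iff[OF j] by blast
  define l where "l = opp T n j"
  have l: "l \<in> euler_indices T n" "opp T n l = j"
    unfolding l_def using opp_euler_index[OF rank je] opp_opp[OF rank je] by auto
  have ln: "l \<in> {1..n}" using euler_indices_range[OF rank l(1)] .
  obtain \<phi> where \<phi>: "\<phi> \<in> inner_auts br" "\<phi> (- H j) = H l" using conjugate_opp[OF l(1)] l(2) by auto
  \<comment> \<open>A symmetric \<open>H j\<close> is conjugate to the coweight of the opposite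
    index; both are dominant Euler elements, so the indices agree.\<close>
  have "(\<phi> \<circ> \<psi>) (H j) = H l" by (simp add: \<psi>(2) \<phi>(2))
  then have "j = l"
    using coweights_not_conjugate[OF j ln _ e _ inner_auts_comp[OF \<phi>(1) \<psi>(1)]] euler_coweight_iff[OF ln] l(1) by blast
  then show "j \<in> symmetric_indices T n" using symmetric_iff_opp[OF rank] je l_def by simp
next
  assume "j \<in> symmetric_indices T n"
  then have je: "j \<in> euler_indices T n" "opp T n j = j" using symmetric_iff_opp[OF rank] by blast+
  obtain \<phi> where \<phi>: "\<phi> \<in> inner_auts br" "\<phi> (- H j) = H j" using conjugate_opp[OF je(1)] je(2) by auto
  have "\<phi> (H j) = - H j"
  proof -
    have "linear \<phi>" using lie_aut_inner[OF \<phi>(1)] by (simp add: lie_aut_def)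
    then have "- \<phi> (H j) = H j" using \<phi>(2) by (simp add: linear_neg)
    then show ?thesis by (simp only: minus_equation_iff[of "\<phi> (H j)"])
  qed
  then have "- H j \<in> inn_orbit br (H j)" using \<phi>(1) unfolding inn_orbit_def by (intro CollectI exI[of _ \<phi>]) simp
  then show "symmetric_euler br (H j)" using euler_coweight_iff[OF j] je(1) by (simp add: symmetric_euler_def)
qed

end

theorem theorem3p10:
  fixes br :: "'g::euclidean_space \<Rightarrow> 'g \<Rightarrow> 'g"
    and \<theta> :: "'g \<Rightarrow> 'g" and A :: "'g set"
    and \<alpha> :: "nat \<Rightarrow> 'g \<Rightarrow> real" and n :: nat and T :: rs_type
  assumes "simple_lie br"
    and "noncompact_lie br"
    and "cartan_involution br \<theta>"
    and "max_abelian_in_p br \<theta> A"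
    and "simple_system br A \<alpha> n"
    and "has_type br A \<alpha> n T"
  shows "(\<forall>h\<in>A. euler_elem br h \<and> (\<forall>i\<in>{1..n}. \<alpha> i h \<ge> 0) \<longrightarrow>
            (\<exists>j\<in>{1..n}. h = coweight A \<alpha> n j))
    \<and> (\<forall>j\<in>{1..n}. euler_elem br (coweight A \<alpha> n j) \<longleftrightarrow> j \<in> euler_indices T n)
    \<and> ((T = TBC \<or> (T = TE \<and> n = 8) \<or> T = TF \<or> T = TG) \<longrightarrow> \<not> (\<exists>x. euler_elem br x))
    \<and> (\<forall>j\<in>{1..n}. symmetric_euler br (coweight A \<alpha> n j) \<longleftrightarrow> j \<in> symmetric_indices T n)"
proof -
  interpret typed_restricted br \<theta> A \<alpha> n T
    using assms by unfold_locales (auto simp: simple_lie_def has_type_def)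
  have "\<not> euler_elem br x" if T: "T = TBC \<or> (T = TE \<and> n = 8) \<or> T = TF \<or> T = TG" for x
  proof
    assume "euler_elem br x"
    then obtain h where "h \<in> A" "euler_elem br h" "\<And>i. i \<in> {1..n} \<Longrightarrow> \<alpha> i h \<ge> 0"
      using euler_dominant by blast
    then obtain j where "j \<in> euler_indices T n" using dominant_euler_is_coweight by blast
    then show False using T by (auto simp: euler_indices_def)
  qed
  moreover have "\<exists>j\<in>{1..n}. h = H j"
    if "h \<in> A" "euler_elem br h \<and> (\<forall>i\<in>{1..n}. \<alpha> i h \<ge> 0)" for h
    using that dominant_euler_is_coweight[of h] by blast
  ultimately show ?thesis using euler_coweight_iff symmetric_coweight_iff by blast
qed

end
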